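(* Let $C_1 := \frac{1}{M}\exp\left(\frac{d}{4s^2}\right) + \frac{4s^2}{d}\left(\frac{d}{4s^2M}+1\right)^{M-1} - \left(\frac{4s^2}{d}+1\right)$. Suppose Algorithm AR-QPRSGD (described in the context) is run with a constant stepsize $\gamma_n=\bar\gamma>0$ for which there exist $\epsilon\in(0,1)$ and $\delta\in(0,1)$ such that $$\frac{(8C_1L^2\bar\gamma^2+(K-1)L\bar\gamma+2C_1)KL\bar\gamma}{1-2(K+1)(K-2)L^2\bar\gamma^2}\le\frac{1-\epsilon}{2},\qquad 2(K+1)(K-2)L^2\bar\gamma^2\le 1-\delta,$$ $$1-L\bar\gamma-\frac{(4KL\bar\gamma C_1+1)(K-1)KL^2\bar\gamma^2}{1-2(K+1)(K-2)L^2\bar\gamma^2}>0.$$ Then, under the smoothness and bounded variance assumptions in the context (with constants $L>0$, $\sigma\ge0$, $\kappa\ge0$), for all $N\ge1$, $$\frac{1}{NK}\sum_{n=1}^N\sum_{k=0}^{K-1}\mathbb{E}\left\|\nabla F(\bar{x}_{n;k})\right\|_2^2\le \frac{4KL\bar\gamma C_1+1}{\delta\epsilon}\left(\frac{\sigma^2(M+1)}{2M}+2K\kappa^2\right)(K-1)L^2\bar\gamma^2+\frac{1}{\epsilon}\left(2C_1\sigma^2+4KC_1\kappa^2+\frac{\sigma^2}{M}\right)L\bar\gamma+\frac{2[F(\tilde{x}_1)-F_*]}{NK\bar\gamma\epsilon}.$$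
   Context: Problem. There are $M$ workers; worker $m$ has data distribution $\mathcal{D}_m$ and loss $f_m(x,\xi)$, $x\in\mathbb{R}^d$. Put $F_m(x)=\mathbb{E}_{\xi\sim\mathcal{D}_m}[f_m(x,\xi)]$ and $F=\frac1M\sum_{m=1}^M F_m$. $F_*$ is the (finite) optimal value of $\min_{x\in\mathbb{R}^d}F(x)$. The objective need not be convex. Stochastic gradients are unbiased: $\mathbb{E}_{\xi\sim\mathcal{D}_m}\nabla f_m(x,\xi)=\nabla F_m(x)$. Assumptions. (Smoothness) every $F_m$ is continuously differentiable with $L$-Lipschitz gradient, $L>0$. (Bounded variance) there are $\sigma,\kappa\ge0$ such that for all $m$ and $x\in\mathbb{R}^d$: $\mathbb{E}_{\xi\sim\mathcal{D}_m}\|\nabla f_m(x,\xi)-\nabla F_m(x)\|_2^2\le\sigma^2$ and $\frac1M\sum_{m=1}^M\|\nabla F(x)-\nabla F_m(x)\|_2^2\le\kappa^2$. Quantizer. For an integer $s\ge1$ and a nonzero vector $v$, $Q_s(v)$ is the random vector with independent coordinates $Q_s(v)_i=\|v\|_2\,\mathrm{sgn}(v_i)\,\zeta(v_i,s)/s$, where, with $\ell\in\{0,\dots,s-1\}$ an integer such that $|v_i|/\|v\|_2\in[\ell/s,(\ell+1)/s]$, $\zeta(v_i,s)=\ell+1$ with probability $\frac{|v_i|}{\|v\|_2}s-\ell$ and $\zeta(v_i,s)=\ell$ otherwise; $Q_s(0)=0$. Different applications use independent randomness. Algorithm AR-QPRSGD (Ring All-Reduce). Let $K\ge1$ be the number of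 local updates per synchronization, $\{\gamma_n\}$ the stepsizes, and $\tilde{x}_1\in\mathbb{R}^d$ the initial point. For $n=1,2,\dots,N$: each worker $m$ sets $x_{n;0}^{(m)}=\tilde{x}_n$ and, for $k=0,\dots,K-1$, draws a fresh independent sample $\xi_k^{(m)}\sim\mathcal{D}_m$ and sets $x_{n;k+1}^{(m)}=x_{n;k}^{(m)}-\gamma_n\nabla f_m(x_{n;k}^{(m)},\xi_k^{(m)})$. Put $g_n^{(m)}=x_{n;0}^{(m)}-x_{n;K}^{(m)}=\gamma_n\sum_{k=0}^{K-1}\nabla f_m(x_{n;k}^{(m)},\xi_k^{(m)})$. Then $$\tilde{x}_{n+1}=\tilde{x}_n-\frac1M Q_s\left(\dots Q_s\left(Q_s\left(g_n^{(1)}\right)+g_n^{(2)}\right)+\dots+g_n^{(M)}\right),$$ where the recursive compression is carried out segmentwise: each vector of $\mathbb{R}^d$ is split into $M$ consecutive segments in $\mathbb{R}^{d/M}$ ($M$ divides $d$), and for each segment $j$ the nested quantized sum is computed with $Q_s$ acting on $\mathbb{R}^{d/M}$, the workers being visited in the cyclic order of the ring starting with worker $j$. Finally $\bar{x}_{n;k}=\frac1M\sum_{m=1}^M x_{n;k}^{(m)}$. *)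

theory Defs
  imports "HOL-Probability.Probability"
begin

definition gradient :: "('v::real_inner \<Rightarrow> real) \<Rightarrow> 'v \<Rightarrow> 'v" where
  "gradient g x = (THE D. GDERIV g x :> D)"

lemma gradient_eqI: "GDERIV g x :> D \<Longrightarrow> gradient g x = D"
proof -
  assume D: "GDERIV g x :> D"
  have "E = D" if E: "GDERIV g x :> E" for E
  proof -
    have "(\<lambda>h. h \<bullet> E) = (\<lambda>h. h \<bullet> D)"
      using D E unfolding gderiv_def by (rule has_derivative_unique[rotated])
    then have "(E - D) \<bullet> (E - D) = 0"
      by (metis inner_diff_right right_minus_eq)
    then show ?thesis by simp
  qed
  then show ?thesis unfolding gradient_def using D by blast
qed

definition local_obj :: "'z measure \<Rightarrow> ('v \<Rightarrow> 'z \<Rightarrow> real) \<Rightarrow> 'v \<Rightarrow> real" where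
  "local_obj D f x = (\<integral>z. f x z \<partial>D)"

definition global_obj ::
    "nat \<Rightarrow> (nat \<Rightarrow> 'z measure) \<Rightarrow> (nat \<Rightarrow> 'v \<Rightarrow> 'z \<Rightarrow> real) \<Rightarrow> 'v \<Rightarrow> real" where
  "global_obj M D f x = (\<Sum>m=1..M. local_obj (D m) (f m) x) / real M"

text \<open>
  Two families of random variables, with possibly different value types, that are mutually
  independent as one family: each family is mutually independent, and the two tuples generate
  independent sigma-algebras. (The library's \<open>indep_vars\<close> needs a common value type.)
\<close>
definition independent_families ::
    "'a measure \<Rightarrow> 'i set \<Rightarrow> ('i \<Rightarrow> 'b measure) \<Rightarrow> ('i \<Rightarrow> 'a \<Rightarrow> 'b) \<Rightarrow>
     'j set \<Rightarrow> ('j \<Rightarrow> 'c measure) \<Rightarrow> ('j \<Rightarrow> 'a \<Rightarrow> 'c) \<Rightarrow> bool" where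
  "independent_families P I A X J B Y \<longleftrightarrow>
     prob_space.indep_vars P A X I \<and>
     prob_space.indep_vars P B Y J \<and>
     prob_space.indep_set P
       {(\<lambda>\<omega>. \<lambda>i\<in>I. X i \<omega>) -` S \<inter> space P | S. S \<in> sets (PiM I A)}
       {(\<lambda>\<omega>. \<lambda>j\<in>J. Y j \<omega>) -` S \<inter> space P | S. S \<in> sets (PiM J B)}"

text \<open>
  A realization of the random integer \<open>\<zeta>\<close>: \<open>R\<close> is the law of the random seed used for one
  coordinate in one application of the quantizer, and \<open>r\<close> stands for \<open>\<bar>v\<^sub>i\<bar> / \<parallel>v\<parallel>\<close>. Only the law
  of \<open>\<zeta> r\<close> for each \<open>r\<close> is prescribed, not how it is obtained from the seed. At a breakpoint
  \<open>r = l / s\<close> the two admissible choices of the integer prescribe the same law.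
\<close>
definition stochastic_rounding :: "'w measure \<Rightarrow> nat \<Rightarrow> (real \<Rightarrow> 'w \<Rightarrow> nat) \<Rightarrow> bool" where
  "stochastic_rounding R s \<zeta> \<longleftrightarrow>
     prob_space R \<and>
     (\<lambda>(r, w). \<zeta> r w) \<in> borel \<Otimes>\<^sub>M R \<rightarrow>\<^sub>M count_space UNIV \<and>
     (\<forall>l<s. \<forall>r\<in>{real l / real s .. (real l + 1) / real s}.
        measure R {w \<in> space R. \<zeta> r w = l + 1} = r * real s - real l \<and>
        measure R {w \<in> space R. \<zeta> r w = l} = 1 - (r * real s - real l))"

text \<open>Such a realization exists: compare a uniform seed with the fractional part.\<close>
lemma stochastic_rounding_uniform:
  assumes "s \<ge> 1"
  shows "stochastic_rounding (uniform_measure lborel {0..<1::real}) s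
           (\<lambda>r u. nat \<lfloor>r * real s\<rfloor> + (if u < frac (r * real s) then 1 else 0))"
    (is "stochastic_rounding ?R s ?z")
proof -
  have P: "prob_space ?R" by (rule prob_space_uniform_measure) auto
  then interpret prob_space ?R .
  have sets_R: "sets ?R = sets borel" by simp
  have meas: "(\<lambda>(r, u). ?z r u) \<in> borel \<Otimes>\<^sub>M ?R \<rightarrow>\<^sub>M count_space UNIV"
  proof -
    have "(\<lambda>(r::real, u::real). ?z r u) \<in> borel \<Otimes>\<^sub>M borel \<rightarrow>\<^sub>M count_space UNIV"
      unfolding frac_def by measurable
    moreover have "sets (borel \<Otimes>\<^sub>M ?R) = sets (borel \<Otimes>\<^sub>M (borel :: real measure))"
      by (intro sets_pair_measure_cong refl sets_R)
    ultimately show ?thesis by (simp cong: measurable_cong_sets)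
  qed
  have below: "measure ?R {u. u < p} = p" if "0 \<le> p" "p \<le> 1" for p :: real
  proof -
    have "{0..<1} \<inter> {u. u < p} = {0..<p}" using that by auto
    then have "emeasure ?R {u. u < p} = ennreal p"
      using that by (subst emeasure_uniform_measure) (auto simp: divide_ennreal_def)
    then show ?thesis using that by (simp add: measure_def)
  qed
  have above: "measure ?R {u. \<not> u < p} = 1 - p" if "0 \<le> p" "p \<le> 1" for p :: real
    using prob_compl[of "{u. u < p}"] below[OF that] by (simp add: Compl_eq_Diff_UNIV[symmetric] Collect_neg_eq)
  have law: "measure ?R {w \<in> space ?R. ?z r w = l + 1} = r * real s - real l \<and>
        measure ?R {w \<in> space ?R. ?z r w = l} = 1 - (r * real s - real l)"
    if ls: "l < s" and r: "r \<in> {real l / real s .. (real l + 1) / real s}" for l r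
  proof -
    have b: "real l \<le> r * real s" "r * real s \<le> real l + 1"
      using r assms by (auto simp: field_simps)
    show ?thesis
    proof (cases "r * real s = real l + 1")
      case True
      then have fl: "\<lfloor>r * real s\<rfloor> = int l + 1" by linarith
      then have fr: "frac (r * real s) = 0" using True by (simp add: frac_def)
      have "nat (int l + 1) = l + 1" by simp
      then have "{w. ?z r w = l + 1} = {u. \<not> u < 0}" "{w. ?z r w = l} = {}"
        unfolding fl fr by auto
      then show ?thesis using True above[of 0] by simp
    next
      case False
      then have fl: "\<lfloor>r * real s\<rfloor> = int l" using b by linarith
      define p where "p = frac (r * real s)"
      have p: "p = r * real s - real l" using fl by (simp add: frac_def p_def)
      have "{w. ?z r w = l + 1} = {u. u < p}" "{w. ?z r w = l} = {u. \<not> u < p}"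
        unfolding fl p_def[symmetric] by auto
      then show ?thesis using below[of p] above[of p] b p by simp
    qed
  qed
  show ?thesis unfolding stochastic_rounding_def using P meas law by blast
qed

text \<open>
  \<open>Q\<^sub>s(v)\<close>, where \<open>w i\<close> is the seed of coordinate \<open>i\<close>; it is \<open>0\<close> for \<open>v = 0\<close>. Coordinates with
  \<open>v\<^sub>i = 0\<close> are mapped to \<open>0\<close> and do not contribute to the norm, so applying it to a zero-padded
  segment is the same as applying the quantizer of the smaller space to the segment.
\<close>
definition quantize ::
    "nat \<Rightarrow> (real \<Rightarrow> 'w \<Rightarrow> nat) \<Rightarrow> ('d::finite \<Rightarrow> 'w) \<Rightarrow> real^'d \<Rightarrow> real^'d" where
  "quantize s \<zeta> w v =
     (\<chi> i. norm v * sgn (v $ i) * real (\<zeta> (\<bar>v $ i\<bar> / norm v) (w i)) / real s)"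

text \<open>
  The \<open>j\<close>-th of \<open>M\<close> consecutive segments, \<open>1 \<le> j \<le> M\<close>, as a zero-padded vector;
  \<open>pos\<close> numbers the coordinates by \<open>1, \<dots>, d\<close>.
\<close>
definition segment :: "nat \<Rightarrow> ('d::finite \<Rightarrow> nat) \<Rightarrow> nat \<Rightarrow> real^'d \<Rightarrow> real^'d" where
  "segment M pos j v =
     (let p = CARD('d) div M
      in \<chi> i. if (j - 1) * p < pos i \<and> pos i \<le> j * p then v $ i else 0)"

text \<open>
  The worker in \<open>{1..M}\<close> visited after \<open>t\<close> steps around the ring, starting with worker \<open>j\<close>.
\<close>
definition ring_worker :: "nat \<Rightarrow> nat \<Rightarrow> nat \<Rightarrow> nat" where
  "ring_worker M j t = (j - 1 + t) mod M + 1"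

text \<open>
  \<open>nested_sum q a t = q\<^bsub>t-1\<^esub> (\<dots> q\<^sub>1 (q\<^sub>0 (a\<^sub>0) + a\<^sub>1) \<dots> + a\<^bsub>t-1\<^esub>)\<close>
\<close>
primrec nested_sum ::
    "(nat \<Rightarrow> 'v \<Rightarrow> 'v) \<Rightarrow> (nat \<Rightarrow> 'v) \<Rightarrow> nat \<Rightarrow> 'v::monoid_add" where
  "nested_sum q a 0 = 0"
| "nested_sum q a (Suc t) = q t (nested_sum q a t + a t)"

text \<open>
  The segmentwise nested quantized sum of \<open>g 1, \<dots>, g M\<close>; \<open>w j t i\<close> is the seed used for
  coordinate \<open>i\<close> by the \<open>t\<close>-th application of the quantizer to segment \<open>j\<close>.
\<close>
definition ring_all_reduce ::
    "nat \<Rightarrow> nat \<Rightarrow> ('d::finite \<Rightarrow> nat) \<Rightarrow> (real \<Rightarrow> 'w \<Rightarrow> nat) \<Rightarrow>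
     (nat \<Rightarrow> nat \<Rightarrow> 'd \<Rightarrow> 'w) \<Rightarrow> (nat \<Rightarrow> real^'d) \<Rightarrow> real^'d" where
  "ring_all_reduce M s pos \<zeta> w g =
     (\<Sum>j=1..M. nested_sum (\<lambda>t. quantize s \<zeta> (w j t))
                           (\<lambda>t. segment M pos j (g (ring_worker M j t))) M)"

end

theory Submission
  imports Defs
begin

text \<open>
  A round consists of \<open>K\<close> averaged stochastic gradient steps, to which the descent lemma applies, and
  of a quantization error of conditional mean zero, which enters only through its second moment. Two
  quantities have to be bounded: the squared distance between the average local gradient and the
  gradient at the average iterate, and the second moment of the quantization error. Both reduce to
  the deviation of the workers from their average.

  The sampling noise of a step is correlated with the gradients of later steps, so it cannot simply
  be split off. But it is uncorrelated with the gradients at the start of the round; subtracting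
  those leaves cross terms with the drift since the start of the round only, and this drift is small
  under the step size conditions. In the quantization error, noises of different workers are
  uncorrelated and accumulate with the weights \<open>q (1 + q)\<^sup>M\<^sup>-\<^sup>t\<close>, whereas gradients accumulate with
  \<open>t q (1 + q)\<^sup>M\<^sup>-\<^sup>t\<close>, where \<open>q = d / (4 s\<^sup>2 M)\<close>. The former are within \<open>C\<^sub>1\<close>, the latter only within
  \<open>3/2 C\<^sub>1\<close>; the excess is absorbed by sharper Young inequalities.
\<close>

section \<open>Square-integrable random vectors\<close>

text \<open>No filtration is used. Samples and seeds live on different spaces and interleave across
  workers, segments and coordinates, so every uncorrelatedness claim is reduced to one pattern: a
  single variable against a function of all the others, past or future.

  One application of the quantizer to a segment of \<open>d / M\<close> coordinates adds variance at
  most \<open>q\<close> times the second moment of its input. Hence the error recursion has growth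
  factor \<open>1 + q\<close>, and
  \<open>M * C1 = exp (M * q) + (\<Sum>i<M - 1. (1 + q) ^ i) - M\<close> has to dominate its
  solution.

  The product \<open>(K + 1) * (K - 2)\<close> of the step size conditions is twice
  \<open>2 + 3 + ... + (K - 1)\<close>: deviations feed back into later steps with these weights,
  and the feedback vanishes at step 0 because the workers start together.

  The Young weights are not free choices of taste. Splitting a local gradient as the gradient at the
  average plus a deviation gets the factor 8/3 because 3/2 * 8/3 = 4 is exactly the coefficient that
  the claim leaves for heterogeneity and for the gradient; the surplus on the deviations must then
  fit into what the drift bound leaves over.\<close>

definition sq_integrable :: "'a measure \<Rightarrow> ('a \<Rightarrow> 'b::euclidean_space) \<Rightarrow> bool" where
  "sq_integrable P X \<longleftrightarrow> X \<in> borel_measurable P \<and> integrable P (\<lambda>\<omega>. (norm (X \<omega>))\<^sup>2)"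

lemma sq_integrable_measurable [measurable_dest]: "sq_integrable P X \<Longrightarrow> X \<in> borel_measurable P"
  by (simp add: sq_integrable_def)

lemma sq_integrable_norm: "sq_integrable P X \<Longrightarrow> integrable P (\<lambda>\<omega>. (norm (X \<omega>))\<^sup>2)"
  by (simp add: sq_integrable_def)

lemma sq_integrable_power2:
  fixes X :: "'a \<Rightarrow> real"
  shows "sq_integrable P X \<Longrightarrow> integrable P (\<lambda>\<omega>. (X \<omega>)\<^sup>2)"
  by (simp add: sq_integrable_def)

lemma sq_integrable_bound:
  assumes "sq_integrable P Y" "X \<in> borel_measurable P" "\<And>\<omega>. \<omega> \<in> space P \<Longrightarrow> norm (X \<omega>) \<le> norm (Y \<omega>)"
  shows "sq_integrable P X"
  unfolding sq_integrable_def
proof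
  show "integrable P (\<lambda>\<omega>. (norm (X \<omega>))\<^sup>2)"
  proof (rule Bochner_Integration.integrable_bound[OF sq_integrable_norm[OF assms(1)]])
    show "AE \<omega> in P. norm ((norm (X \<omega>))\<^sup>2) \<le> norm ((norm (Y \<omega>))\<^sup>2)"
      using assms(3) by (intro AE_I2) (simp add: power_mono)
  qed (use assms(2) in measurable)
qed fact

lemma sq_integrable_cong:
  assumes "\<And>\<omega>. \<omega> \<in> space P \<Longrightarrow> X \<omega> = Y \<omega>"
  shows "sq_integrable P X \<longleftrightarrow> sq_integrable P Y"
  unfolding sq_integrable_def using assms
  by (simp cong: measurable_cong Bochner_Integration.integrable_cong)

lemma norm_add_power2_le:
  fixes x y :: "'b::real_inner"
  shows "(norm (x + y))\<^sup>2 \<le> 2 * (norm x)\<^sup>2 + 2 * (norm y)\<^sup>2"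
proof -
  have "0 \<le> (norm (x - y))\<^sup>2" by simp
  then show ?thesis
    unfolding power2_norm_eq_inner by (simp add: inner_add inner_diff inner_commute)
qed

lemma sq_integrable_add:
  assumes "sq_integrable P X" "sq_integrable P Y"
  shows "sq_integrable P (\<lambda>\<omega>. X \<omega> + Y \<omega>)"
  unfolding sq_integrable_def
proof
  note [measurable] = assms[THEN sq_integrable_measurable]
  show "(\<lambda>\<omega>. X \<omega> + Y \<omega>) \<in> borel_measurable P" by measurable
  show "integrable P (\<lambda>\<omega>. (norm (X \<omega> + Y \<omega>))\<^sup>2)"
  proof (rule Bochner_Integration.integrable_bound)
    show "integrable P (\<lambda>\<omega>. 2 * (norm (X \<omega>))\<^sup>2 + 2 * (norm (Y \<omega>))\<^sup>2)"
      using assms[THEN sq_integrable_norm] by auto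
    show "AE \<omega> in P. norm ((norm (X \<omega> + Y \<omega>))\<^sup>2) \<le> norm (2 * (norm (X \<omega>))\<^sup>2 + 2 * (norm (Y \<omega>))\<^sup>2)"
      using norm_add_power2_le by (intro AE_I2) simp
  qed measurable
qed

lemma sq_integrable_scaleR:
  assumes "sq_integrable P X"
  shows "sq_integrable P (\<lambda>\<omega>. c *\<^sub>R X \<omega>)"
  using assms unfolding sq_integrable_def by (auto simp: power_mult_distrib)

lemma sq_integrable_diff:
  assumes "sq_integrable P X" "sq_integrable P Y"
  shows "sq_integrable P (\<lambda>\<omega>. X \<omega> - Y \<omega>)"
  using sq_integrable_add[OF assms(1) sq_integrable_scaleR[OF assms(2), of "-1"]] by simp

lemma sq_integrable_zero: "sq_integrable P (\<lambda>_. 0)"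
  by (simp add: sq_integrable_def)

lemma sq_integrable_sum:
  assumes "\<And>i. i \<in> A \<Longrightarrow> sq_integrable P (X i)"
  shows "sq_integrable P (\<lambda>\<omega>. \<Sum>i\<in>A. X i \<omega>)"
proof (cases "finite A")
  case True
  then show ?thesis using assms
    by (induction A) (auto intro!: sq_integrable_add simp: sq_integrable_zero)
qed (simp add: sq_integrable_zero)

lemma sq_integrable_nth:
  fixes X :: "'a \<Rightarrow> real^'d"
  assumes "sq_integrable P X"
  shows "sq_integrable P (\<lambda>\<omega>. X \<omega> $ i)"
proof (rule sq_integrable_bound[OF assms])
  show "(\<lambda>\<omega>. X \<omega> $ i) \<in> borel_measurable P"
    using sq_integrable_measurable[OF assms] by (rule measurable_compose) simp
  show "norm (X \<omega> $ i) \<le> norm (X \<omega>)" for \<omega> by (metis component_le_norm_cart real_norm_def)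
qed

lemma norm_power2_cart: "(norm (x::real^'d))\<^sup>2 = (\<Sum>i\<in>UNIV. (x $ i)\<^sup>2)"
  unfolding power2_norm_eq_inner inner_vec_def by (simp add: power2_eq_square)

lemma borel_measurable_vecI:
  fixes X :: "'a \<Rightarrow> real^'d"
  assumes "\<And>i. (\<lambda>\<omega>. X \<omega> $ i) \<in> borel_measurable P"
  shows "X \<in> borel_measurable P"
proof (rule borel_measurable_euclidean_space[THEN iffD2], intro ballI)
  fix b :: "real^'d" assume "b \<in> Basis"
  then obtain i where "b = axis i 1" by (auto simp: Basis_vec_def)
  then show "(\<lambda>\<omega>. X \<omega> \<bullet> b) \<in> borel_measurable P" using assms by (simp add: inner_axis)
qed

lemma sq_integrable_vecI:
  fixes X :: "'a \<Rightarrow> real^'d"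
  assumes "\<And>i. sq_integrable P (\<lambda>\<omega>. X \<omega> $ i)"
  shows "sq_integrable P X"
  unfolding sq_integrable_def
proof
  show "X \<in> borel_measurable P"
    using assms by (intro borel_measurable_vecI) (auto dest: sq_integrable_measurable)
  show "integrable P (\<lambda>\<omega>. (norm (X \<omega>))\<^sup>2)"
    unfolding norm_power2_cart using assms
    by (intro Bochner_Integration.integrable_sum sq_integrable_power2)
qed

lemma borel_measurable_nth:
  fixes X :: "'a \<Rightarrow> real^'d"
  shows "X \<in> borel_measurable P \<Longrightarrow> (\<lambda>\<omega>. X \<omega> $ i) \<in> borel_measurable P"
  by (rule measurable_compose[where g = "\<lambda>v. v $ i" and N = borel]) simp_all

lemma sq_integrable_inner:
  assumes "sq_integrable P X" "sq_integrable P Y"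
  shows "integrable P (\<lambda>\<omega>. X \<omega> \<bullet> Y \<omega>)"
proof (rule Bochner_Integration.integrable_bound)
  note [measurable] = assms[THEN sq_integrable_measurable]
  show "integrable P (\<lambda>\<omega>. (norm (X \<omega>))\<^sup>2 + (norm (Y \<omega>))\<^sup>2)"
    using assms[THEN sq_integrable_norm] by auto
  show "(\<lambda>\<omega>. X \<omega> \<bullet> Y \<omega>) \<in> borel_measurable P" by measurable
  show "AE \<omega> in P. norm (X \<omega> \<bullet> Y \<omega>) \<le> norm ((norm (X \<omega>))\<^sup>2 + (norm (Y \<omega>))\<^sup>2)"
  proof (rule AE_I2)
    fix \<omega>
    have "\<bar>X \<omega> \<bullet> Y \<omega>\<bar> \<le> norm (X \<omega>) * norm (Y \<omega>)" by (rule Cauchy_Schwarz_ineq2)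
    also have "2 * (norm (X \<omega>) * norm (Y \<omega>)) \<le> (norm (X \<omega>))\<^sup>2 + (norm (Y \<omega>))\<^sup>2"
      using sum_squares_bound[of "norm (X \<omega>)" "norm (Y \<omega>)"] by simp
    finally show "norm (X \<omega> \<bullet> Y \<omega>) \<le> norm ((norm (X \<omega>))\<^sup>2 + (norm (Y \<omega>))\<^sup>2)"
      using zero_le_mult_iff[of "norm (X \<omega>)" "norm (Y \<omega>)"] by simp
  qed
qed

lemma sq_integrable_mult:
  fixes X Y :: "'a \<Rightarrow> real"
  assumes "sq_integrable P X" "sq_integrable P Y"
  shows "integrable P (\<lambda>\<omega>. X \<omega> * Y \<omega>)"
  using sq_integrable_inner[OF assms] by simp

lemma (in finite_measure) sq_integrable_const: "sq_integrable M (\<lambda>_. c)"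
  by (simp add: sq_integrable_def)

lemma (in finite_measure) sq_integrable_lipschitz:
  assumes X: "sq_integrable M X" and G: "L-lipschitz_on UNIV G"
  shows "sq_integrable M (\<lambda>\<omega>. G (X \<omega>))"
proof -
  have "continuous_on UNIV G" using G by (rule lipschitz_on_continuous_on)
  then have "G \<in> borel_measurable borel" by (rule borel_measurable_continuous_onI)
  then have m: "(\<lambda>\<omega>. G (X \<omega>)) \<in> borel_measurable M"
    using sq_integrable_measurable[OF X] by measurable
  have "sq_integrable M (\<lambda>\<omega>. G (X \<omega>) - G 0)"
  proof (rule sq_integrable_bound[OF sq_integrable_scaleR[OF X, of L]])
    show "norm (G (X \<omega>) - G 0) \<le> norm (L *\<^sub>R X \<omega>)" for \<omega>
      using lipschitz_onD[OF G, of "X \<omega>" 0] lipschitz_on_nonneg[OF G] by (simp add: dist_norm)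
  qed (use m in measurable)
  from sq_integrable_add[OF this sq_integrable_const[of "G 0"]] show ?thesis by simp
qed

section \<open>Independence of a single variable from all the others\<close>

lemma (in prob_space) indep_set_sym: "indep_set A B \<Longrightarrow> indep_set B A"
  unfolding indep_sets2_eq by (metis Int_commute mult.commute)

lemma independent_families_sym:
  assumes "prob_space P" "independent_families P I A X J B Y"
  shows "independent_families P J B Y I A X"
  using assms(2) prob_space.indep_set_sym[OF assms(1)] unfolding independent_families_def by blast

text \<open>The sigma-algebra is generated by intersections of an event of the remaining
  \<open>X\<close>-tuple with an event of the \<open>Y\<close>-tuple. These are stable under
  intersection, so independence is checked on them only. There it follows in two stages: the full
  \<open>X\<close>-tuple is independent of the \<open>Y\<close>-tuple, and inside the
  \<open>X\<close>-family \<open>X i0\<close> is independent of the rest.\<close>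

lemma independent_families_rest:
  assumes P: "prob_space P" and ind: "independent_families P I A X J B Y" and i0: "i0 \<in> I"
  obtains N where "space N = space P" "sets N \<subseteq> sets P"
    "\<And>i. i \<in> I \<Longrightarrow> i \<noteq> i0 \<Longrightarrow> X i \<in> measurable N (A i)" "\<And>j. j \<in> J \<Longrightarrow> Y j \<in> measurable N (B j)"
    "prob_space.indep_set P (sets N) {X i0 -` C \<inter> space P | C. C \<in> sets (A i0)}"
proof -
  interpret prob_space P by fact
  let ?I = "I - {i0}"
  define XR where "XR \<omega> = (\<lambda>i\<in>?I. X i \<omega>)" for \<omega>
  define XI where "XI \<omega> = (\<lambda>i\<in>I. X i \<omega>)" for \<omega>
  define YT where "YT \<omega> = (\<lambda>j\<in>J. Y j \<omega>)" for \<omega>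
  have iX: "indep_vars A X I" and iY: "indep_vars B Y J"
    and iXY: "indep_set {XI -` S \<inter> space P | S. S \<in> sets (PiM I A)} {YT -` S \<inter> space P | S. S \<in> sets (PiM J B)}"
    using ind unfolding independent_families_def XI_def YT_def by auto
  have mX[measurable]: "\<And>i. i \<in> I \<Longrightarrow> X i \<in> measurable P (A i)"
    and mY[measurable]: "\<And>j. j \<in> J \<Longrightarrow> Y j \<in> measurable P (B j)"
    using iX iY unfolding indep_vars_def2 by auto
  have mXR: "XR \<in> measurable P (PiM ?I A)" and mYT: "YT \<in> measurable P (PiM J B)"
    and mXI: "XI \<in> measurable P (PiM I A)"
    unfolding XR_def YT_def XI_def by (auto intro!: measurable_restrict)
  have split: "prob (X i0 -` C \<inter> space P \<inter> (XR -` S \<inter> space P)) = prob (X i0 -` C \<inter> space P) * prob (XR -` S \<inter> space P)"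
    if C: "C \<in> sets (A i0)" and S: "S \<in> sets (PiM ?I A)" for C S
  proof -
    have "indep_var (PiM {i0} A) (\<lambda>\<omega>. restrict (\<lambda>i. X i \<omega>) {i0}) (PiM ?I A) (\<lambda>\<omega>. restrict (\<lambda>i. X i \<omega>) ?I)"
      using i0 by (intro indep_var_restrict[OF iX]) auto
    moreover define C' where "C' = {f \<in> space (PiM {i0} A). f i0 \<in> C}"
    have "C' \<in> sets (PiM {i0} A)" unfolding C'_def using C by measurable
    ultimately have "prob ((\<lambda>\<omega>. (restrict (\<lambda>i. X i \<omega>) {i0}, restrict (\<lambda>i. X i \<omega>) ?I)) -` (C' \<times> S) \<inter> space P)
      = prob ((\<lambda>\<omega>. restrict (\<lambda>i. X i \<omega>) {i0}) -` C' \<inter> space P) * prob ((\<lambda>\<omega>. restrict (\<lambda>i. X i \<omega>) ?I) -` S \<inter> space P)"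
      using S by (intro indep_varD) auto
    moreover have "(\<lambda>\<omega>. restrict (\<lambda>i. X i \<omega>) {i0}) -` C' \<inter> space P = X i0 -` C \<inter> space P"
      using mX[OF i0] by (auto simp: C'_def space_PiM dest: measurable_space)
    moreover from this have "(\<lambda>\<omega>. (restrict (\<lambda>i. X i \<omega>) {i0}, restrict (\<lambda>i. X i \<omega>) ?I)) -` (C' \<times> S) \<inter> space P
      = X i0 -` C \<inter> space P \<inter> (XR -` S \<inter> space P)"
      unfolding XR_def by auto
    ultimately show ?thesis unfolding XR_def by simp
  qed
  \<comment> \<open>An event about \<open>X i0\<close> together with the rest is an event about the
    whole tuple \<open>XI\<close>, the only form in which independence from \<open>YT\<close> is
    given.\<close>
  have fromI: "\<exists>T\<in>sets (PiM I A). X i0 -` C \<inter> space P \<inter> (XR -` S \<inter> space P) = XI -` T \<inter> space P"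
    if C: "C \<in> sets (A i0)" and S: "S \<in> sets (PiM ?I A)" for C S
  proof
    let ?T = "((\<lambda>f. f i0) -` C \<inter> space (PiM I A)) \<inter> ((\<lambda>f. restrict f ?I) -` S \<inter> space (PiM I A))"
    show "?T \<in> sets (PiM I A)"
      by (intro sets.Int measurable_sets[OF _ C] measurable_sets[OF _ S]
          measurable_component_singleton measurable_restrict_subset i0 Diff_subset)
    have "restrict (XI \<omega>) ?I = XR \<omega>" "XI \<omega> i0 = X i0 \<omega>" for \<omega>
      using i0 by (auto simp: XI_def XR_def fun_eq_iff)
    then show "X i0 -` C \<inter> space P \<inter> (XR -` S \<inter> space P) = XI -` ?T \<inter> space P"
      using measurable_space[OF mXI] by auto
  qed
  define G where "G = {(XR -` S \<inter> space P) \<inter> (YT -` T \<inter> space P) | S T. S \<in> sets (PiM ?I A) \<and> T \<in> sets (PiM J B)}"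
  define N where "N = sigma (space P) G"
  have Gsub: "G \<subseteq> Pow (space P)" unfolding G_def by auto
  have Gev: "G \<subseteq> events" unfolding G_def using mXR mYT by (auto intro!: sets.Int measurable_sets)
  have sp: "space N = space P" and sN: "sets N = sigma_sets (space P) G"
    unfolding N_def using Gsub by auto
  have subN: "sets N \<subseteq> sets P" unfolding sN using Gev by (rule sets.sigma_sets_subset)
  have genX: "XR -` S \<inter> space P \<in> sets N" if "S \<in> sets (PiM ?I A)" for S
  proof -
    have "XR -` S \<inter> space P = (XR -` S \<inter> space P) \<inter> (YT -` space (PiM J B) \<inter> space P)"
      using measurable_space[OF mYT] by auto
    then have "XR -` S \<inter> space P \<in> G" unfolding G_def using that by blast
    then show ?thesis unfolding sN by (rule sigma_sets.Basic)
  qed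
  have genY: "YT -` T \<inter> space P \<in> sets N" if "T \<in> sets (PiM J B)" for T
  proof -
    have "YT -` T \<inter> space P = (XR -` space (PiM ?I A) \<inter> space P) \<inter> (YT -` T \<inter> space P)"
      using measurable_space[OF mXR] by auto
    then have "YT -` T \<inter> space P \<in> G" unfolding G_def using that by blast
    then show ?thesis unfolding sN by (rule sigma_sets.Basic)
  qed
  have XRN: "XR \<in> measurable N (PiM ?I A)"
    by (rule measurableI) (use genX measurable_space[OF mXR] sp in auto)
  have YTN: "YT \<in> measurable N (PiM J B)"
    by (rule measurableI) (use genY measurable_space[OF mYT] sp in auto)
  show thesis
  proof (rule that[OF sp subN])
    fix i assume i: "i \<in> I" "i \<noteq> i0"
    have "(\<lambda>\<omega>. XR \<omega> i) \<in> measurable N (A i)"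
      using i by (intro measurable_compose[OF XRN] measurable_component_singleton) auto
    then show "X i \<in> measurable N (A i)" using i by (simp add: XR_def)
  next
    fix j assume j: "j \<in> J"
    have "(\<lambda>\<omega>. YT \<omega> j) \<in> measurable N (B j)"
      using j by (intro measurable_compose[OF YTN] measurable_component_singleton) auto
    then show "Y j \<in> measurable N (B j)" using j by (simp add: YT_def)
  next
    let ?C = "{X i0 -` C \<inter> space P | C. C \<in> sets (A i0)}"
    have Cev: "?C \<subseteq> events" using mX[OF i0] by (auto intro: measurable_sets)
    have "indep_set G ?C"
      unfolding indep_sets2_eq
    proof (intro conjI Gev Cev ballI)
      fix a b assume "a \<in> G" "b \<in> ?C"
      then obtain S T C where STC: "S \<in> sets (PiM ?I A)" "T \<in> sets (PiM J B)" "C \<in> sets (A i0)"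
        and a: "a = (XR -` S \<inter> space P) \<inter> (YT -` T \<inter> space P)" and b: "b = X i0 -` C \<inter> space P"
        unfolding G_def by blast
      let ?S = "XR -` S \<inter> space P" and ?T = "YT -` T \<inter> space P"
      obtain U where U: "U \<in> sets (PiM I A)" "b \<inter> ?S = XI -` U \<inter> space P"
        using fromI[OF STC(3,1)] b by blast
      \<comment> \<open>Same conversion for the rest alone, by imposing no condition on
        \<open>X i0\<close>.\<close>
      obtain U' where U': "U' \<in> sets (PiM I A)" "?S = XI -` U' \<inter> space P"
      proof -
        have "X i0 -` space (A i0) \<inter> space P \<inter> ?S = ?S"
          using measurable_space[OF mX[OF i0]] by auto
        then show ?thesis using fromI[OF sets.top STC(1)] that by metis
      qed
      have "prob (a \<inter> b) = prob ((b \<inter> ?S) \<inter> ?T)" unfolding a by (simp add: ac_simps)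
      also have "\<dots> = prob (b \<inter> ?S) * prob ?T"
        using iXY U STC(2) unfolding indep_sets2_eq by blast
      also have "\<dots> = prob b * (prob ?S * prob ?T)"
        using split[OF STC(3,1)] b by simp
      also have "prob ?S * prob ?T = prob (?S \<inter> ?T)"
        using iXY U' STC(2) unfolding indep_sets2_eq by (metis (mono_tags, lifting) mem_Collect_eq)
      finally show "prob (a \<inter> b) = prob a * prob b" unfolding a by simp
    qed
    moreover have "Int_stable G"
    proof (rule Int_stableI)
      fix a b assume "a \<in> G" "b \<in> G"
      then obtain S T S' T' where "S \<in> sets (PiM ?I A)" "T \<in> sets (PiM J B)"
        "S' \<in> sets (PiM ?I A)" "T' \<in> sets (PiM J B)"
        and ab: "a = (XR -` S \<inter> space P) \<inter> (YT -` T \<inter> space P)" "b = (XR -` S' \<inter> space P) \<inter> (YT -` T' \<inter> space P)"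
        unfolding G_def by blast
      then show "a \<inter> b \<in> G" unfolding G_def
        by (auto intro!: exI[of _ "S \<inter> S'"] exI[of _ "T \<inter> T'"])
    qed
    moreover have "Int_stable ?C"
    proof (rule Int_stableI)
      fix a b assume "a \<in> ?C" "b \<in> ?C"
      then obtain C C' where "C \<in> sets (A i0)" "C' \<in> sets (A i0)"
        "a = X i0 -` C \<inter> space P" "b = X i0 -` C' \<inter> space P" by blast
      then show "a \<inter> b \<in> ?C" by (auto intro!: exI[of _ "C \<inter> C'"])
    qed
    ultimately have "indep_set (sigma_sets (space P) G) (sigma_sets (space P) ?C)"
      by (rule indep_set_sigma_sets)
    then show "indep_set (sets N) ?C"
      unfolding sN indep_sets2_eq by (auto intro: sigma_sets.Basic)
  qed
qed

context prob_space
begin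

text \<open>The working form of independence: whatever state \<open>U\<close> is read off from
  \<open>N\<close>, its joint law with the fresh variable is a product, so Fubini can freeze the
  state while the fresh variable is integrated out.\<close>

lemma distr_pair_indep:
  assumes sp: "space N = space M" and sub: "sets N \<subseteq> sets M"
    and U: "U \<in> measurable N S" and X: "X \<in> measurable M D"
    and ind: "indep_set (sets N) {X -` C \<inter> space M | C. C \<in> sets D}"
  shows "distr M (S \<Otimes>\<^sub>M D) (\<lambda>\<omega>. (U \<omega>, X \<omega>)) = distr M S U \<Otimes>\<^sub>M distr M D X"
proof -
  have UM: "U \<in> measurable M S" using U sp sub by (auto simp: measurable_def)
  interpret SU: prob_space "distr M S U" by (rule prob_space_distr) fact
  interpret DX: prob_space "distr M D X" by (rule prob_space_distr) fact
  have UX: "(\<lambda>\<omega>. (U \<omega>, X \<omega>)) \<in> measurable M (S \<Otimes>\<^sub>M D)" using UM X by measurable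
  show ?thesis
  proof (rule pair_measure_eqI[symmetric])
    fix A C assume A: "A \<in> sets (distr M S U)" and C: "C \<in> sets (distr M D X)"
    let ?a = "U -` A \<inter> space M" and ?c = "X -` C \<inter> space M"
    have "?a \<in> sets N" using measurable_sets[OF U] A sp by auto
    then have "prob (?a \<inter> ?c) = prob ?a * prob ?c"
      using ind C unfolding indep_sets2_eq by (metis (mono_tags, lifting) mem_Collect_eq sets_distr)
    moreover have "(\<lambda>\<omega>. (U \<omega>, X \<omega>)) -` (A \<times> C) \<inter> space M = ?a \<inter> ?c" by auto
    ultimately show "emeasure (distr M S U) A * emeasure (distr M D X) C
        = emeasure (distr M (S \<Otimes>\<^sub>M D) (\<lambda>\<omega>. (U \<omega>, X \<omega>))) (A \<times> C)"
      using A C UM X UX by (simp add: emeasure_distr emeasure_eq_measure ennreal_mult)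
  qed (auto intro: SU.sigma_finite_measure_axioms DX.sigma_finite_measure_axioms)
qed

text \<open>Fubini with the state frozen. The joint integrability assumed here is supplied in each
  application by the Cauchy-Schwarz bound \<open>sq_integrable_mult\<close>.\<close>

lemma integral_indep_eq_0:
  fixes \<phi> :: "'s \<times> 'z \<Rightarrow> real"
  assumes law: "distr M (S \<Otimes>\<^sub>M D) (\<lambda>\<omega>. (U \<omega>, X \<omega>)) = distr M S U \<Otimes>\<^sub>M D"
    and U [measurable]: "U \<in> measurable M S" and X [measurable]: "X \<in> measurable M D" and D: "prob_space D"
    and \<phi> [measurable]: "\<phi> \<in> borel_measurable (S \<Otimes>\<^sub>M D)"
    and int: "integrable M (\<lambda>\<omega>. \<phi> (U \<omega>, X \<omega>))"
    and zero: "\<And>u. u \<in> space S \<Longrightarrow> (\<integral>z. \<phi> (u, z) \<partial>D) = 0"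
  shows "(\<integral>\<omega>. \<phi> (U \<omega>, X \<omega>) \<partial>M) = 0"
proof -
  interpret D: prob_space D by fact
  interpret SU: prob_space "distr M S U" by (rule prob_space_distr) fact
  interpret pair_sigma_finite "distr M S U" D ..
  have "integrable (distr M (S \<Otimes>\<^sub>M D) (\<lambda>\<omega>. (U \<omega>, X \<omega>))) \<phi>"
    using int by (subst integrable_distr_eq) auto
  then have i: "integrable (distr M S U \<Otimes>\<^sub>M D) \<phi>" unfolding law .
  have "(\<integral>\<omega>. \<phi> (U \<omega>, X \<omega>) \<partial>M) = (\<integral>p. \<phi> p \<partial>(distr M S U \<Otimes>\<^sub>M D))"
    unfolding law[symmetric] by (subst integral_distr) auto
  also have "\<dots> = (\<integral>u. (\<integral>z. \<phi> (u, z) \<partial>D) \<partial>distr M S U)"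
    using integral_fst'[OF i] by simp
  also have "\<dots> = (\<integral>u. 0 \<partial>distr M S U)"
    using zero by (intro Bochner_Integration.integral_cong) auto
  finally show ?thesis by simp
qed

text \<open>Computed with nonnegative integrals, so that integrability is a conclusion. This is how
  sampling noise and rounding errors are first shown to be square integrable.\<close>

lemma integral_indep_le:
  fixes \<phi> :: "'s \<times> 'z \<Rightarrow> real"
  assumes law: "distr M (S \<Otimes>\<^sub>M D) (\<lambda>\<omega>. (U \<omega>, X \<omega>)) = distr M S U \<Otimes>\<^sub>M D"
    and U [measurable]: "U \<in> measurable M S" and X [measurable]: "X \<in> measurable M D" and D: "prob_space D"
    and \<phi> [measurable]: "\<phi> \<in> borel_measurable (S \<Otimes>\<^sub>M D)" and nonneg: "\<And>p. \<phi> p \<ge> 0"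
    and b [measurable]: "b \<in> borel_measurable S" and b0: "\<And>u. b u \<ge> 0"
    and intb: "integrable M (\<lambda>\<omega>. b (U \<omega>))"
    and le: "\<And>u. u \<in> space S \<Longrightarrow> integrable D (\<lambda>z. \<phi> (u, z)) \<and> (\<integral>z. \<phi> (u, z) \<partial>D) \<le> b u"
  shows "integrable M (\<lambda>\<omega>. \<phi> (U \<omega>, X \<omega>))" "(\<integral>\<omega>. \<phi> (U \<omega>, X \<omega>) \<partial>M) \<le> (\<integral>\<omega>. b (U \<omega>) \<partial>M)"
proof -
  interpret D: prob_space D by fact
  have "(\<integral>\<^sup>+\<omega>. \<phi> (U \<omega>, X \<omega>) \<partial>M) = (\<integral>\<^sup>+p. \<phi> p \<partial>(distr M S U \<Otimes>\<^sub>M D))"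
    unfolding law[symmetric] by (subst nn_integral_distr) auto
  also have "\<dots> = (\<integral>\<^sup>+u. (\<integral>\<^sup>+z. \<phi> (u, z) \<partial>D) \<partial>distr M S U)"
    by (subst D.nn_integral_fst[symmetric]) auto
  also have "\<dots> \<le> (\<integral>\<^sup>+u. b u \<partial>distr M S U)"
  proof (rule nn_integral_mono)
    fix u assume "u \<in> space (distr M S U)"
    then have u: "integrable D (\<lambda>z. \<phi> (u, z))" "(\<integral>z. \<phi> (u, z) \<partial>D) \<le> b u" using le by auto
    then show "(\<integral>\<^sup>+z. \<phi> (u, z) \<partial>D) \<le> ennreal (b u)"
      using nonneg by (subst nn_integral_eq_integral) (auto intro: ennreal_leI)
  qed
  also have "\<dots> = (\<integral>\<^sup>+\<omega>. b (U \<omega>) \<partial>M)" by (subst nn_integral_distr) auto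
  also have "\<dots> = ennreal (\<integral>\<omega>. b (U \<omega>) \<partial>M)"
    using intb b0 by (intro nn_integral_eq_integral) auto
  finally have le': "(\<integral>\<^sup>+\<omega>. \<phi> (U \<omega>, X \<omega>) \<partial>M) \<le> ennreal (\<integral>\<omega>. b (U \<omega>) \<partial>M)" .
  show i: "integrable M (\<lambda>\<omega>. \<phi> (U \<omega>, X \<omega>))"
    using le' nonneg by (intro integrableI_nonneg) (auto simp: less_top[symmetric] top_unique)
  show "(\<integral>\<omega>. \<phi> (U \<omega>, X \<omega>) \<partial>M) \<le> (\<integral>\<omega>. b (U \<omega>) \<partial>M)"
    using le' nonneg b0 by (subst (asm) nn_integral_eq_integral[OF i]) (auto simp: integral_nonneg_AE)
qed

end

section \<open>The quantizer\<close>

text \<open>The two prescribed probabilities add up to 1, so \<open>\<zeta> r\<close> is almost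
  surely \<open>l\<close> or \<open>l + 1\<close>. Its variance is that of a Bernoulli variable,
  \<open>p * (1 - p)\<close>, hence at most 1/4.\<close>

lemma stochastic_rounding_moments:
  assumes R: "stochastic_rounding R s \<zeta>" and s: "s \<ge> 1" and r: "0 \<le> r" "r \<le> 1"
  shows "integrable R (\<lambda>w. real (\<zeta> r w))" "(\<integral>w. real (\<zeta> r w) \<partial>R) = r * real s"
    and "integrable R (\<lambda>w. (real (\<zeta> r w) - r * real s)\<^sup>2)"
    and "(\<integral>w. (real (\<zeta> r w) - r * real s)\<^sup>2 \<partial>R) \<le> 1 / 4"
proof -
  interpret prob_space R using R by (simp add: stochastic_rounding_def)
  have "(\<lambda>(r, w). \<zeta> r w) \<in> borel \<Otimes>\<^sub>M R \<rightarrow>\<^sub>M count_space UNIV"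
    using R by (simp add: stochastic_rounding_def)
  from measurable_compose[OF measurable_Pair1' this, of r]
  have [measurable]: "(\<lambda>w. \<zeta> r w) \<in> measurable R (count_space UNIV)" by simp
  have s0: "real s > 0" using s by simp
  \<comment> \<open>The minimum covers \<open>r = 1\<close>, where the floor equals \<open>s\<close>
    and is no admissible \<open>l\<close>.\<close>
  define l where "l = min (nat \<lfloor>r * real s\<rfloor>) (s - 1)"
  have l: "l < s" unfolding l_def using s by linarith
  have rl: "real l \<le> r * real s" "r * real s \<le> real l + 1"
  proof -
    have 0: "0 \<le> r * real s" "r * real s \<le> real s"
      using r s0 by (auto simp: mult_left_le_one_le)
    show "real l \<le> r * real s" using 0 unfolding l_def by linarith
    show "r * real s \<le> real l + 1"
    proof (cases "nat \<lfloor>r * real s\<rfloor> \<le> s - 1")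
      case True
      then show ?thesis using 0 unfolding l_def by linarith
    next
      case False
      then show ?thesis using 0 s unfolding l_def by (simp add: of_nat_diff)
    qed
  qed
  define p where "p = r * real s - real l"
  have p: "0 \<le> p" "p \<le> 1" using rl by (auto simp: p_def)
  let ?A = "{w \<in> space R. \<zeta> r w = l + 1}" and ?B = "{w \<in> space R. \<zeta> r w = l}"
  have AB: "?A \<in> events" "?B \<in> events" by measurable
  have "r \<in> {real l / real s .. (real l + 1) / real s}" using rl s0 by (auto simp: field_simps)
  then have pA: "prob ?A = p" and pB: "prob ?B = 1 - p"
    using R l unfolding stochastic_rounding_def p_def by auto
  have "prob (?A \<union> ?B) = prob ?A + prob ?B" using AB by (intro finite_measure_Union) auto
  then have "prob (?A \<union> ?B) = 1" using pA pB by simp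
  then have "AE w in R. w \<in> ?A \<union> ?B" using AB by (intro AE_prob_1) auto
  then have ae: "AE w in R. \<zeta> r w = l \<or> \<zeta> r w = l + 1" by auto
  have iA: "integrable R (indicat_real ?A)" "(\<integral>w. indicat_real ?A w \<partial>R) = p"
    and iB: "integrable R (indicat_real ?B)" "(\<integral>w. indicat_real ?B w \<partial>R) = 1 - p"
    using AB pA pB by (auto simp: integrable_real_indicator emeasure_eq_measure)
  have e1: "AE w in R. real (\<zeta> r w) = real l + indicat_real ?A w"
    using ae AE_space by eventually_elim (auto simp: indicator_def)
  have e2: "AE w in R. (real (\<zeta> r w) - r * real s)\<^sup>2 = (1 - p)\<^sup>2 * indicat_real ?A w + p\<^sup>2 * indicat_real ?B w"
    using ae AE_space by eventually_elim (auto simp: indicator_def p_def power2_commute algebra_simps)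
  have i1: "integrable R (\<lambda>w. real l + indicat_real ?A w)" using iA by simp
  show "integrable R (\<lambda>w. real (\<zeta> r w))"
    using i1 by (subst integrable_cong_AE[OF _ _ e1]) (use AB in measurable)
  have "(\<integral>w. real (\<zeta> r w) \<partial>R) = (\<integral>w. real l + indicat_real ?A w \<partial>R)"
    by (rule integral_cong_AE[OF _ _ e1]) (use AB in measurable)
  also have "\<dots> = r * real s" using iA by (simp add: prob_space p_def)
  finally show "(\<integral>w. real (\<zeta> r w) \<partial>R) = r * real s" .
  have i2: "integrable R (\<lambda>w. (1 - p)\<^sup>2 * indicat_real ?A w + p\<^sup>2 * indicat_real ?B w)"
    using iA iB by auto
  show "integrable R (\<lambda>w. (real (\<zeta> r w) - r * real s)\<^sup>2)"
    using i2 by (subst integrable_cong_AE[OF _ _ e2]) (use AB in measurable)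
  have "(\<integral>w. (real (\<zeta> r w) - r * real s)\<^sup>2 \<partial>R)
      = (\<integral>w. (1 - p)\<^sup>2 * indicat_real ?A w + p\<^sup>2 * indicat_real ?B w \<partial>R)"
    by (rule integral_cong_AE[OF _ _ e2]) (use AB in measurable)
  also have "\<dots> = (1 - p)\<^sup>2 * p + p\<^sup>2 * (1 - p)" using iA iB by simp
  also have "\<dots> = 1 / 4 - (p - 1 / 2)\<^sup>2" by (simp add: power2_eq_square field_simps)
  also have "\<dots> \<le> 1 / 4" by simp
  finally show "(\<integral>w. (real (\<zeta> r w) - r * real s)\<^sup>2 \<partial>R) \<le> 1 / 4" .
qed

text \<open>Every coordinate has its own seed and independence is available for one seed at a time,
  so the quantizer is analysed coordinate by coordinate.\<close>

definition quantize_coord :: "nat \<Rightarrow> (real \<Rightarrow> 'w \<Rightarrow> nat) \<Rightarrow> 'd::finite \<Rightarrow> real^'d \<Rightarrow> 'w \<Rightarrow> real" where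
  "quantize_coord s \<zeta> i v w = norm v * sgn (v $ i) * real (\<zeta> (\<bar>v $ i\<bar> / norm v) w) / real s"

lemma quantize_nth: "quantize s \<zeta> w v $ i = quantize_coord s \<zeta> i v (w i)"
  by (simp add: quantize_def quantize_coord_def)

lemma quantize_coord_zero: "v $ i = 0 \<Longrightarrow> quantize_coord s \<zeta> i v w = 0"
  by (simp add: quantize_coord_def)

lemma quantize_coord_measurable:
  assumes "stochastic_rounding R s \<zeta>"
  shows "(\<lambda>(v :: real^'d, w). quantize_coord s \<zeta> i v w) \<in> borel_measurable (borel \<Otimes>\<^sub>M R)"
proof -
  have z: "(\<lambda>(r, w). \<zeta> r w) \<in> borel \<Otimes>\<^sub>M R \<rightarrow>\<^sub>M count_space UNIV"
    using assms by (simp add: stochastic_rounding_def)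
  have [measurable]: "(\<lambda>v :: real^'d. v $ i) \<in> borel_measurable borel" by simp
  have "(\<lambda>p :: (real^'d) \<times> 'a. (\<bar>fst p $ i\<bar> / norm (fst p), snd p)) \<in> borel \<Otimes>\<^sub>M R \<rightarrow>\<^sub>M borel \<Otimes>\<^sub>M R"
    by measurable
  from measurable_compose[OF this z]
  have [measurable]: "(\<lambda>p :: (real^'d) \<times> 'a. \<zeta> (\<bar>fst p $ i\<bar> / norm (fst p)) (snd p))
      \<in> borel \<Otimes>\<^sub>M R \<rightarrow>\<^sub>M count_space UNIV" by simp
  have [measurable]: "(\<lambda>v :: real^'d. sgn (v $ i)) \<in> borel_measurable borel"
    unfolding sgn_real_def by measurable
  show ?thesis unfolding quantize_coord_def case_prod_beta by measurable
qed

lemma quantize_measurable: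
  fixes v :: "'a \<Rightarrow> real^'d"
  assumes "stochastic_rounding R s \<zeta>" "v \<in> borel_measurable N" "\<And>i. w i \<in> measurable N R"
  shows "(\<lambda>\<omega>. quantize s \<zeta> (\<lambda>i. w i \<omega>) (v \<omega>)) \<in> borel_measurable N"
proof (rule borel_measurable_vecI)
  fix i
  have "(\<lambda>\<omega>. (v \<omega>, w i \<omega>)) \<in> measurable N (borel \<Otimes>\<^sub>M R)" using assms by measurable
  from measurable_compose[OF this quantize_coord_measurable[OF assms(1), of i]]
  show "(\<lambda>\<omega>. quantize s \<zeta> (\<lambda>i. w i \<omega>) (v \<omega>) $ i) \<in> borel_measurable N"
    by (simp add: quantize_nth)
qed

text \<open>The error is the centred rounding error times \<open>c\<close>, and \<open>c\<close> has
  absolute value at most \<open>norm v / s\<close>. The bound is the same for all coordinates and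
  involves the whole norm, so a segment collects it once per coordinate.\<close>

lemma quantize_coord_moments:
  fixes v :: "real^'d"
  assumes R: "stochastic_rounding R s \<zeta>" and s: "s \<ge> 1"
  shows "integrable R (\<lambda>w. quantize_coord s \<zeta> i v w - v $ i)"
    and "(\<integral>w. quantize_coord s \<zeta> i v w - v $ i \<partial>R) = 0"
    and "integrable R (\<lambda>w. (quantize_coord s \<zeta> i v w - v $ i)\<^sup>2)"
    and "(\<integral>w. (quantize_coord s \<zeta> i v w - v $ i)\<^sup>2 \<partial>R) \<le> (norm v)\<^sup>2 / (4 * (real s)\<^sup>2)"
proof -
  interpret prob_space R using R by (simp add: stochastic_rounding_def)
  define r where "r = \<bar>v $ i\<bar> / norm v"
  define c where "c = norm v * sgn (v $ i) / real s"
  have r: "0 \<le> r" "r \<le> 1"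
    using component_le_norm_cart[of v i] unfolding r_def by (auto simp: divide_le_eq_1)
  have s0: "real s > 0" using s by simp
  have "c * (r * real s) = v $ i"
  proof (cases "v = 0")
    case False
    then show ?thesis using s0 unfolding c_def r_def by (simp add: mult.commute abs_mult_sgn)
  qed (simp add: c_def)
  then have e: "quantize_coord s \<zeta> i v w - v $ i = c * (real (\<zeta> r w) - r * real s)" for w
    unfolding quantize_coord_def r_def[symmetric] by (simp add: c_def right_diff_distrib)
  note m = stochastic_rounding_moments[OF R s r]
  show "integrable R (\<lambda>w. quantize_coord s \<zeta> i v w - v $ i)" unfolding e using m by auto
  show "(\<integral>w. quantize_coord s \<zeta> i v w - v $ i \<partial>R) = 0"
    unfolding e using m by (simp add: prob_space)
  show "integrable R (\<lambda>w. (quantize_coord s \<zeta> i v w - v $ i)\<^sup>2)"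
    unfolding e power_mult_distrib using m by auto
  have "(\<integral>w. (quantize_coord s \<zeta> i v w - v $ i)\<^sup>2 \<partial>R) \<le> c\<^sup>2 * (1 / 4)"
    unfolding e power_mult_distrib integral_mult_right_zero using m(4) by (intro mult_left_mono) auto
  also have "\<dots> \<le> (norm v)\<^sup>2 / (4 * (real s)\<^sup>2)"
    unfolding c_def by (simp add: power_mult_distrib power_divide sgn_real_def)
  finally show "(\<integral>w. (quantize_coord s \<zeta> i v w - v $ i)\<^sup>2 \<partial>R) \<le> (norm v)\<^sup>2 / (4 * (real s)\<^sup>2)" .
qed

context prob_space
begin

lemma quantize_coord_error:
  fixes v :: "'a \<Rightarrow> real^'d"
  assumes R: "stochastic_rounding R s \<zeta>" and s: "s \<ge> 1"
    and sp: "space N = space M" and sub: "sets N \<subseteq> sets M"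
    and v: "v \<in> borel_measurable N" "sq_integrable M v"
    and w: "w \<in> measurable M R" "distr M R w = R"
    and ind: "indep_set (sets N) {w -` C \<inter> space M | C. C \<in> sets R}"
  shows "sq_integrable M (\<lambda>\<omega>. quantize_coord s \<zeta> i (v \<omega>) (w \<omega>) - v \<omega> $ i)" (is "sq_integrable M ?\<delta>")
    and "(\<integral>\<omega>. (quantize_coord s \<zeta> i (v \<omega>) (w \<omega>) - v \<omega> $ i)\<^sup>2 \<partial>M)
      \<le> (\<integral>\<omega>. (norm (v \<omega>))\<^sup>2 \<partial>M) / (4 * (real s)\<^sup>2)"
    and "Z \<in> borel_measurable N \<Longrightarrow> sq_integrable M Z \<Longrightarrow>
      (\<integral>\<omega>. (quantize_coord s \<zeta> i (v \<omega>) (w \<omega>) - v \<omega> $ i) * Z \<omega> \<partial>M) = 0"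
proof -
  have PR: "prob_space R" using R by (simp add: stochastic_rounding_def)
  have [measurable]: "(\<lambda>v :: real^'d. v $ i) \<in> borel_measurable borel" by simp
  define \<phi> where "\<phi> p = quantize_coord s \<zeta> i (fst p) (snd p) - fst p $ i" for p :: "(real^'d) \<times> 'b"
  have \<phi>[measurable]: "\<phi> \<in> borel_measurable (borel \<Otimes>\<^sub>M R)"
    using quantize_coord_measurable[OF R, of i] unfolding \<phi>_def case_prod_beta by measurable
  have vM[measurable]: "v \<in> borel_measurable M" using v(2) by (rule sq_integrable_measurable)
  note [measurable] = w(1)
  have law: "distr M (borel \<Otimes>\<^sub>M R) (\<lambda>\<omega>. (v \<omega>, w \<omega>)) = distr M borel v \<Otimes>\<^sub>M R"
    using distr_pair_indep[OF sp sub v(1) w(1) ind] w(2) by simp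
  let ?b = "\<lambda>v :: real^'d. (norm v)\<^sup>2 / (4 * (real s)\<^sup>2)"
  have \<phi>2: "(\<lambda>p. (\<phi> p)\<^sup>2) \<in> borel_measurable (borel \<Otimes>\<^sub>M R)" by measurable
  have b: "?b \<in> borel_measurable borel" by measurable
  have ib: "integrable M (\<lambda>\<omega>. ?b (v \<omega>))" using sq_integrable_norm[OF v(2)] by simp
  have le: "integrable R (\<lambda>z. (\<phi> (u, z))\<^sup>2) \<and> (\<integral>z. (\<phi> (u, z))\<^sup>2 \<partial>R) \<le> ?b u" for u
    unfolding \<phi>_def fst_conv snd_conv using quantize_coord_moments(3,4)[OF R s] by blast
  have 1: "integrable M (\<lambda>\<omega>. (\<phi> (v \<omega>, w \<omega>))\<^sup>2)" "(\<integral>\<omega>. (\<phi> (v \<omega>, w \<omega>))\<^sup>2 \<partial>M) \<le> (\<integral>\<omega>. ?b (v \<omega>) \<partial>M)"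
    using integral_indep_le[OF law vM w(1) PR \<phi>2 _ b _ ib le] by simp_all
  have "(\<lambda>\<omega>. \<phi> (v \<omega>, w \<omega>)) \<in> borel_measurable M" by measurable
  then show d: "sq_integrable M ?\<delta>"
    using 1(1) unfolding sq_integrable_def \<phi>_def by simp
  show "(\<integral>\<omega>. (?\<delta> \<omega>)\<^sup>2 \<partial>M) \<le> (\<integral>\<omega>. (norm (v \<omega>))\<^sup>2 \<partial>M) / (4 * (real s)\<^sup>2)"
    using 1(2) unfolding \<phi>_def fst_conv snd_conv by simp
  assume Z: "Z \<in> borel_measurable N" "sq_integrable M Z"
  have [measurable]: "Z \<in> borel_measurable M" using Z(2) by (rule sq_integrable_measurable)
  have vZ: "(\<lambda>\<omega>. (v \<omega>, Z \<omega>)) \<in> measurable N (borel \<Otimes>\<^sub>M borel)" using v(1) Z(1) by measurable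
  have law': "distr M ((borel \<Otimes>\<^sub>M borel) \<Otimes>\<^sub>M R) (\<lambda>\<omega>. ((v \<omega>, Z \<omega>), w \<omega>))
      = distr M (borel \<Otimes>\<^sub>M borel) (\<lambda>\<omega>. (v \<omega>, Z \<omega>)) \<Otimes>\<^sub>M R"
    using distr_pair_indep[OF sp sub vZ w(1) ind] w(2) by simp
  have "(\<integral>\<omega>. (\<lambda>p. \<phi> (fst (fst p), snd p) * snd (fst p)) ((v \<omega>, Z \<omega>), w \<omega>) \<partial>M) = 0"
  proof (rule integral_indep_eq_0[OF law' _ w(1) PR])
    show "integrable M (\<lambda>\<omega>. \<phi> (fst (fst ((v \<omega>, Z \<omega>), w \<omega>)), snd ((v \<omega>, Z \<omega>), w \<omega>)) * snd (fst ((v \<omega>, Z \<omega>), w \<omega>)))"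
      using sq_integrable_mult[OF d Z(2)] by (simp add: \<phi>_def)
    show "(\<integral>z. \<phi> (fst (fst (u, z)), snd (u, z)) * snd (fst (u, z)) \<partial>R) = 0" for u
      using quantize_coord_moments(1,2)[OF R s, of i "fst u"] by (simp add: \<phi>_def)
  qed measurable
  then show "(\<integral>\<omega>. ?\<delta> \<omega> * Z \<omega> \<partial>M) = 0" by (simp add: \<phi>_def)
qed

end

text \<open>
  One segment \<open>C\<close> of the ring: \<open>N t i\<close> is a \<open>\<sigma>\<close>-algebra carrying everything except the seed of
  coordinate \<open>i\<close> in the \<open>t\<close>-th application of the quantizer.
\<close>

locale quantizer_chain = prob_space M for M :: "'a measure" +
  fixes R :: "'w measure" and s :: nat and \<zeta> :: "real \<Rightarrow> 'w \<Rightarrow> nat"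
    and w :: "nat \<Rightarrow> 'd::finite \<Rightarrow> 'a \<Rightarrow> 'w" and T :: nat
    and a :: "nat \<Rightarrow> 'a \<Rightarrow> real^'d" and N :: "nat \<Rightarrow> 'd \<Rightarrow> 'a measure" and C :: "'d set"
  assumes R: "stochastic_rounding R s \<zeta>" and s: "s \<ge> 1"
    and space_N: "\<And>t i. t < T \<Longrightarrow> space (N t i) = space M"
    and sets_N: "\<And>t i. t < T \<Longrightarrow> sets (N t i) \<subseteq> sets M"
    and w_meas: "\<And>t i. t < T \<Longrightarrow> w t i \<in> measurable M R"
    and w_law: "\<And>t i. t < T \<Longrightarrow> distr M R (w t i) = R"
    and w_indep: "\<And>t i. t < T \<Longrightarrow> indep_set (sets (N t i)) {w t i -` C \<inter> space M | C. C \<in> sets R}"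
    and w_N: "\<And>t i t' i'. t < T \<Longrightarrow> t' < t \<Longrightarrow> w t' i' \<in> measurable (N t i) R"
    and a_N: "\<And>t i t'. t < T \<Longrightarrow> t' < T \<Longrightarrow> a t' \<in> borel_measurable (N t i)"
    and a_sq: "\<And>t. t < T \<Longrightarrow> sq_integrable M (a t)"
    and a_supp: "\<And>t i \<omega>. t < T \<Longrightarrow> i \<notin> C \<Longrightarrow> a t \<omega> $ i = 0"
begin

definition qsum :: "nat \<Rightarrow> 'a \<Rightarrow> real^'d" where
  "qsum t \<omega> = nested_sum (\<lambda>t. quantize s \<zeta> (\<lambda>i. w t i \<omega>)) (\<lambda>t. a t \<omega>) t"

definition psum :: "nat \<Rightarrow> 'a \<Rightarrow> real^'d" where
  "psum t \<omega> = (\<Sum>r<t. a r \<omega>)"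

definition err :: "nat \<Rightarrow> 'a \<Rightarrow> real^'d" where
  "err t \<omega> = qsum t \<omega> - psum t \<omega>"

definition qin :: "nat \<Rightarrow> 'a \<Rightarrow> real^'d" where
  "qin t \<omega> = qsum t \<omega> + a t \<omega>"

definition step_err :: "nat \<Rightarrow> 'a \<Rightarrow> real^'d" where
  "step_err t \<omega> = quantize s \<zeta> (\<lambda>i. w t i \<omega>) (qin t \<omega>) - qin t \<omega>"

lemma qsum_Suc: "qsum (Suc t) \<omega> = quantize s \<zeta> (\<lambda>i. w t i \<omega>) (qin t \<omega>)"
  by (simp add: qsum_def qin_def)

lemma err_Suc: "err (Suc t) \<omega> = err t \<omega> + step_err t \<omega>"
  by (simp add: err_def step_err_def qsum_Suc psum_def qin_def)

lemma err_0: "err 0 \<omega> = 0"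
  by (simp add: err_def qsum_def psum_def)

lemma qin_eq: "qin t \<omega> = err t \<omega> + psum (Suc t) \<omega>"
  by (simp add: qin_def err_def psum_def)

lemma step_err_nth: "step_err t \<omega> $ i = quantize_coord s \<zeta> i (qin t \<omega>) (w t i \<omega>) - qin t \<omega> $ i"
  by (simp add: step_err_def quantize_nth)

lemma qsum_measurable:
  assumes "t \<le> u" "u < T"
  shows "qsum t \<in> borel_measurable (N u i)"
  using assms(1)
proof (induction t)
  case (Suc t)
  then have "qin t \<in> borel_measurable (N u i)"
    unfolding qin_def using a_N[of u t i] assms(2) by (intro borel_measurable_add) auto
  from quantize_measurable[OF R this, of "w t"] show ?case
    unfolding qsum_Suc using w_N Suc.prems assms(2) by simp
next
  case 0
  have "qsum 0 = (\<lambda>_. 0)" by (simp add: fun_eq_iff qsum_def)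
  then show ?case by simp
qed

lemma psum_measurable: "u < T \<Longrightarrow> t \<le> T \<Longrightarrow> psum t \<in> borel_measurable (N u i)"
  unfolding psum_def using a_N by (intro borel_measurable_sum) auto

lemma qin_measurable: "t < T \<Longrightarrow> qin t \<in> borel_measurable (N t i)"
  unfolding qin_def using qsum_measurable[of t t i] a_N by (intro borel_measurable_add) auto

lemma err_measurable: "t < T \<Longrightarrow> err t \<in> borel_measurable (N t i)"
  unfolding err_def using qsum_measurable[of t t i] psum_measurable by (intro borel_measurable_diff) auto

lemma psum_sq: "t \<le> T \<Longrightarrow> sq_integrable M (psum t)"
  unfolding psum_def using a_sq by (intro sq_integrable_sum) auto

text \<open>The square integrability of the input is assumed because it is obtained from
  \<open>err_sq\<close>, whose induction relies on this lemma.\<close>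

lemma step_err_sq_aux:
  assumes "t < T" "sq_integrable M (qin t)"
  shows "sq_integrable M (step_err t)"
  using quantize_coord_error(1)[OF R s space_N sets_N qin_measurable assms(2) w_meas w_law w_indep] assms(1)
  by (intro sq_integrable_vecI) (simp add: step_err_nth)

lemma err_sq: "t \<le> T \<Longrightarrow> sq_integrable M (err t)"
proof (induction t)
  case (Suc t)
  then have e: "sq_integrable M (err t)" by simp
  have "sq_integrable M (qin t)"
    unfolding qin_eq using sq_integrable_add[OF e psum_sq[of "Suc t"]] Suc.prems by simp
  from sq_integrable_add[OF e step_err_sq_aux[OF _ this]] Suc.prems show ?case by (simp add: err_Suc)
next
  case 0
  have "err 0 = (\<lambda>_. 0)" by (simp add: fun_eq_iff err_0)
  then show ?case by (simp add: sq_integrable_zero)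
qed

lemma qin_sq: "t < T \<Longrightarrow> sq_integrable M (qin t)"
  unfolding qin_eq using sq_integrable_add[OF err_sq[of t] psum_sq[of "Suc t"]] by simp

lemma step_err_sq: "t < T \<Longrightarrow> sq_integrable M (step_err t)"
  using step_err_sq_aux qin_sq by blast

lemma step_err_orth:
  assumes "t < T" "Z \<in> borel_measurable (N t i)" "sq_integrable M Z"
  shows "(\<integral>\<omega>. step_err t \<omega> $ i * Z \<omega> \<partial>M) = 0"
  using quantize_coord_error(3)[OF R s space_N sets_N qin_measurable qin_sq w_meas w_law w_indep] assms
  by (simp add: step_err_nth)

lemma qsum_supp: "t \<le> T \<Longrightarrow> i \<notin> C \<Longrightarrow> qsum t \<omega> $ i = 0"
proof (induction t)
  case (Suc t)
  then have "qin t \<omega> $ i = 0" using a_supp by (simp add: qin_def)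
  then show ?case by (simp add: qsum_Suc quantize_nth quantize_coord_zero)
qed (simp add: qsum_def)

lemma err_supp: "t \<le> T \<Longrightarrow> i \<notin> C \<Longrightarrow> err t \<omega> $ i = 0"
  using a_supp by (simp add: err_def qsum_supp psum_def)

lemma step_err_supp: "t < T \<Longrightarrow> i \<notin> C \<Longrightarrow> step_err t \<omega> $ i = 0"
  using a_supp by (simp add: step_err_def quantize_nth quantize_coord_zero qin_def qsum_supp)

text \<open>\<open>Z\<close> must avoid the seeds of coordinate \<open>i\<close> in every
  application, not only in the last one; then each step error is orthogonal to it separately. This
  is the conditional mean zero of the accumulated error.\<close>

lemma err_orth:
  assumes "t \<le> T" and Z: "\<And>u. u < T \<Longrightarrow> Z \<in> borel_measurable (N u i)" "sq_integrable M Z"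
  shows "(\<integral>\<omega>. err t \<omega> $ i * Z \<omega> \<partial>M) = 0"
  using assms(1)
proof (induction t)
  case (Suc t)
  have i: "integrable M (\<lambda>\<omega>. err t \<omega> $ i * Z \<omega>)" "integrable M (\<lambda>\<omega>. step_err t \<omega> $ i * Z \<omega>)"
    using Suc.prems by (auto intro!: sq_integrable_mult sq_integrable_nth err_sq step_err_sq Z(2))
  then show ?case
    using Suc step_err_orth[OF _ Z(1) Z(2)] by (simp add: err_Suc distrib_right)
qed (simp add: err_0)

text \<open>Two Pythagorean identities: the new rounding error is orthogonal to the accumulated
  error, and the accumulated error is orthogonal to the exact partial sum inside the quantizer's
  input. Coordinates outside \<open>C\<close> are mapped to 0 without error, so
  \<open>card C\<close> coordinates contribute.\<close>

lemma err_step_le: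
  assumes t: "t < T"
  defines "q \<equiv> real (card C) / (4 * (real s)\<^sup>2)"
  shows "(\<integral>\<omega>. (norm (err (Suc t) \<omega>))\<^sup>2 \<partial>M)
    \<le> (1 + q) * (\<integral>\<omega>. (norm (err t \<omega>))\<^sup>2 \<partial>M) + q * (\<integral>\<omega>. (norm (psum (Suc t) \<omega>))\<^sup>2 \<partial>M)"
proof -
  have split: "(\<integral>\<omega>. (norm (X \<omega> + Y \<omega>))\<^sup>2 \<partial>M) = (\<integral>\<omega>. (norm (X \<omega>))\<^sup>2 \<partial>M) + (\<integral>\<omega>. (norm (Y \<omega>))\<^sup>2 \<partial>M)"
    if X: "sq_integrable M X" and Y: "sq_integrable M Y"
      and o: "\<And>i. (\<integral>\<omega>. X \<omega> $ i * Y \<omega> $ i \<partial>M) = 0" for X Y :: "'a \<Rightarrow> real^'d"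
  proof -
    have i: "integrable M (\<lambda>\<omega>. X \<omega> \<bullet> Y \<omega>)" using X Y by (rule sq_integrable_inner)
    have "(\<integral>\<omega>. X \<omega> \<bullet> Y \<omega> \<partial>M) = (\<Sum>i\<in>UNIV. \<integral>\<omega>. X \<omega> $ i * Y \<omega> $ i \<partial>M)"
      unfolding inner_vec_def using X Y
      by (subst Bochner_Integration.integral_sum) (auto intro!: sq_integrable_mult sq_integrable_nth)
    then have "(\<integral>\<omega>. X \<omega> \<bullet> Y \<omega> \<partial>M) = 0" using o by simp
    moreover have "(norm (X \<omega> + Y \<omega>))\<^sup>2 = (norm (X \<omega>))\<^sup>2 + (norm (Y \<omega>))\<^sup>2 + 2 * (X \<omega> \<bullet> Y \<omega>)" for \<omega>
      unfolding power2_norm_eq_inner by (simp add: inner_add inner_commute)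
    ultimately show ?thesis
      using i sq_integrable_norm[OF X] sq_integrable_norm[OF Y] by simp
  qed
  have tT: "t \<le> T" "Suc t \<le> T" using t by auto
  have "(\<integral>\<omega>. step_err t \<omega> $ i * err t \<omega> $ i \<partial>M) = 0" for i
    using t by (intro step_err_orth borel_measurable_nth err_measurable sq_integrable_nth err_sq) auto
  then have 1: "(\<integral>\<omega>. (norm (err (Suc t) \<omega>))\<^sup>2 \<partial>M)
      = (\<integral>\<omega>. (norm (err t \<omega>))\<^sup>2 \<partial>M) + (\<integral>\<omega>. (norm (step_err t \<omega>))\<^sup>2 \<partial>M)"
    unfolding err_Suc using t by (intro split err_sq step_err_sq) (auto simp: mult.commute)
  have "(\<integral>\<omega>. err t \<omega> $ i * psum (Suc t) \<omega> $ i \<partial>M) = 0" for i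
    using tT by (intro err_orth borel_measurable_nth psum_measurable sq_integrable_nth psum_sq) auto
  then have 2: "(\<integral>\<omega>. (norm (qin t \<omega>))\<^sup>2 \<partial>M)
      = (\<integral>\<omega>. (norm (err t \<omega>))\<^sup>2 \<partial>M) + (\<integral>\<omega>. (norm (psum (Suc t) \<omega>))\<^sup>2 \<partial>M)"
    unfolding qin_eq using tT by (intro split err_sq psum_sq) auto
  have "(\<integral>\<omega>. (norm (step_err t \<omega>))\<^sup>2 \<partial>M) = (\<Sum>i\<in>UNIV. \<integral>\<omega>. (step_err t \<omega> $ i)\<^sup>2 \<partial>M)"
    unfolding norm_power2_cart using t
    by (subst Bochner_Integration.integral_sum) (auto intro!: sq_integrable_power2 sq_integrable_nth step_err_sq)
  also have "\<dots> = (\<Sum>i\<in>C. \<integral>\<omega>. (step_err t \<omega> $ i)\<^sup>2 \<partial>M)"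
    using step_err_supp[OF t] by (intro sum.mono_neutral_right) auto
  also have "\<dots> \<le> (\<Sum>i\<in>C. (\<integral>\<omega>. (norm (qin t \<omega>))\<^sup>2 \<partial>M) / (4 * (real s)\<^sup>2))"
    using quantize_coord_error(2)[OF R s space_N sets_N qin_measurable qin_sq w_meas w_law w_indep] t
    by (intro sum_mono) (simp add: step_err_nth)
  also have "\<dots> = q * (\<integral>\<omega>. (norm (qin t \<omega>))\<^sup>2 \<partial>M)" by (simp add: q_def)
  finally show ?thesis unfolding 1 2 by (simp add: algebra_simps)
qed

text \<open>The recursion unrolled: an error created in application \<open>t\<close> is amplified by
  \<open>1 + q\<close> in each of the \<open>T - 1 - t\<close> later ones.\<close>

lemma err_le:
  defines "q \<equiv> real (card C) / (4 * (real s)\<^sup>2)"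
  shows "(\<integral>\<omega>. (norm (err T \<omega>))\<^sup>2 \<partial>M)
    \<le> (\<Sum>t<T. q * (1 + q) ^ (T - 1 - t) * (\<integral>\<omega>. (norm (psum (Suc t) \<omega>))\<^sup>2 \<partial>M))"
proof -
  have "q \<ge> 0" by (simp add: q_def)
  have "(\<integral>\<omega>. (norm (err u \<omega>))\<^sup>2 \<partial>M)
    \<le> (\<Sum>t<u. q * (1 + q) ^ (u - 1 - t) * (\<integral>\<omega>. (norm (psum (Suc t) \<omega>))\<^sup>2 \<partial>M))" if "u \<le> T" for u
    using that
  proof (induction u)
    case (Suc u)
    let ?P = "\<lambda>t. \<integral>\<omega>. (norm (psum (Suc t) \<omega>))\<^sup>2 \<partial>M"
    have "(\<integral>\<omega>. (norm (err (Suc u) \<omega>))\<^sup>2 \<partial>M)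
        \<le> (1 + q) * (\<Sum>t<u. q * (1 + q) ^ (u - 1 - t) * ?P t) + q * ?P u"
      using err_step_le[of u, folded q_def] Suc mult_left_mono[of _ _ "1 + q"] \<open>q \<ge> 0\<close>
      by (smt (verit, ccfv_threshold) Suc_le_lessD Suc_leD)
    also have "(1 + q) * (\<Sum>t<u. q * (1 + q) ^ (u - 1 - t) * ?P t) = (\<Sum>t<u. q * (1 + q) ^ (Suc u - 1 - t) * ?P t)"
      unfolding sum_distrib_left
    proof (rule sum.cong)
      fix t assume "t \<in> {..<u}"
      then have "Suc u - 1 - t = Suc (u - 1 - t)" by auto
      then show "(1 + q) * (q * (1 + q) ^ (u - 1 - t) * ?P t) = q * (1 + q) ^ (Suc u - 1 - t) * ?P t"
        by (simp only: power_Suc mult_ac)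
    qed simp
    finally show ?case by simp
  qed (simp add: err_0)
  then show ?thesis by simp
qed

end

section \<open>Means over the workers and second moments\<close>

text \<open>Convexity of the squared norm for the weights \<open>1 - w\<close> and \<open>w\<close>.
  The weight stays a parameter because several later bounds close only for particular
  values.\<close>

lemma norm_add_young:
  fixes x y :: "'b::real_inner"
  assumes w: "0 < w" "w < 1"
  shows "(norm (x + y))\<^sup>2 \<le> (norm x)\<^sup>2 / (1 - w) + (norm y)\<^sup>2 / w"
proof -
  have "0 \<le> (norm (w *\<^sub>R x - (1 - w) *\<^sub>R y))\<^sup>2" by simp
  also have "\<dots> = w\<^sup>2 * (x \<bullet> x) + (1 - w)\<^sup>2 * (y \<bullet> y) - 2 * w * (1 - w) * (x \<bullet> y)"
    unfolding power2_norm_eq_inner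
    by (simp add: inner_diff inner_commute power2_eq_square algebra_simps)
  finally have "w * (1 - w) * ((x \<bullet> x) + (y \<bullet> y) + 2 * (x \<bullet> y)) \<le> w * (x \<bullet> x) + (1 - w) * (y \<bullet> y)"
    by (simp add: power2_eq_square algebra_simps)
  then have "(x \<bullet> x) + (y \<bullet> y) + 2 * (x \<bullet> y) \<le> (w * (x \<bullet> x) + (1 - w) * (y \<bullet> y)) / (w * (1 - w))"
    using w by (simp add: pos_le_divide_eq mult.commute)
  also have "\<dots> = (x \<bullet> x) / (1 - w) + (y \<bullet> y) / w" using w by (simp add: field_simps)
  finally show ?thesis
    unfolding power2_norm_eq_inner by (simp add: inner_add inner_commute)
qed

lemma norm_sum_power2_le:
  fixes x :: "'i \<Rightarrow> 'b::real_inner"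
  shows "(norm (\<Sum>i\<in>A. x i))\<^sup>2 \<le> real (card A) * (\<Sum>i\<in>A. (norm (x i))\<^sup>2)"
proof -
  have "(norm (\<Sum>i\<in>A. x i))\<^sup>2 \<le> (\<Sum>i\<in>A. norm (x i))\<^sup>2"
    by (intro power_mono norm_sum) auto
  also have "\<dots> \<le> real (card A) * (\<Sum>i\<in>A. (norm (x i))\<^sup>2)"
    using sum_squared_le_sum_of_squares[of "\<lambda>i. norm (x i)" A] by (simp add: mult.commute)
  finally show ?thesis .
qed

definition mean :: "nat \<Rightarrow> (nat \<Rightarrow> 'b::real_vector) \<Rightarrow> 'b" where
  "mean M f = (1 / real M) *\<^sub>R (\<Sum>m=1..M. f m)"

lemma mean_add: "mean M (\<lambda>m. f m + g m) = mean M f + mean M g"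
  by (simp add: mean_def sum.distrib scaleR_add_right)

lemma mean_diff: "mean M (\<lambda>m. f m - g m) = mean M f - mean M g"
  by (simp add: mean_def sum_subtractf scaleR_diff_right)

lemma mean_scaleR: "mean M (\<lambda>m. c *\<^sub>R f m) = c *\<^sub>R mean M f"
  by (simp add: mean_def scaleR_sum_right[symmetric] mult.commute)

lemma mean_mult: "mean M (\<lambda>m. c * f m) = c * mean M f" for c :: real
  using mean_scaleR[of M c f] by simp

lemma mean_sum: "mean M (\<lambda>m. \<Sum>i\<in>A. f i m) = (\<Sum>i\<in>A. mean M (f i))"
  unfolding mean_def by (subst sum.swap) (simp add: scaleR_sum_right)

lemma mean_const: "M \<ge> 1 \<Longrightarrow> mean M (\<lambda>_. c) = c"
  by (simp add: mean_def sum_constant_scaleR)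

lemma mean_cong: "(\<And>m. m \<in> {1..M} \<Longrightarrow> f m = g m) \<Longrightarrow> mean M f = mean M g"
  by (simp add: mean_def)

lemma mean_mono:
  fixes f g :: "nat \<Rightarrow> real"
  shows "(\<And>m. m \<in> {1..M} \<Longrightarrow> f m \<le> g m) \<Longrightarrow> mean M f \<le> mean M g"
  unfolding mean_def by (intro scaleR_left_mono sum_mono) auto

lemma mean_nonneg:
  fixes f :: "nat \<Rightarrow> real"
  shows "(\<And>m. m \<in> {1..M} \<Longrightarrow> 0 \<le> f m) \<Longrightarrow> 0 \<le> mean M f"
  unfolding mean_def by (intro scaleR_nonneg_nonneg sum_nonneg) auto

lemma mean_inner_left: "mean M f \<bullet> y = mean M (\<lambda>m. f m \<bullet> y)"
  by (simp add: mean_def inner_sum_left)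

lemma mean_variance:
  fixes f :: "nat \<Rightarrow> 'b::real_inner"
  assumes "M \<ge> 1"
  shows "mean M (\<lambda>m. (norm (f m - mean M f))\<^sup>2) = mean M (\<lambda>m. (norm (f m))\<^sup>2) - (norm (mean M f))\<^sup>2"
proof -
  let ?a = "mean M f"
  have "(norm (f m - ?a))\<^sup>2 = (norm (f m))\<^sup>2 - 2 * (f m \<bullet> ?a) + (norm ?a)\<^sup>2" for m
    unfolding power2_norm_eq_inner by (simp add: inner_diff inner_commute)
  then have "mean M (\<lambda>m. (norm (f m - ?a))\<^sup>2)
      = mean M (\<lambda>m. (norm (f m))\<^sup>2) - 2 * mean M (\<lambda>m. f m \<bullet> ?a) + (norm ?a)\<^sup>2"
    using assms by (simp add: mean_add mean_diff mean_mult mean_const)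
  also have "mean M (\<lambda>m. f m \<bullet> ?a) = (norm ?a)\<^sup>2"
    unfolding power2_norm_eq_inner by (simp add: mean_inner_left)
  finally show ?thesis by simp
qed

lemma sq_integrable_mean:
  "(\<And>m. m \<in> {1..M} \<Longrightarrow> sq_integrable P (X m)) \<Longrightarrow> sq_integrable P (\<lambda>\<omega>. mean M (\<lambda>m. X m \<omega>))"
  unfolding mean_def by (intro sq_integrable_scaleR sq_integrable_sum)

lemma borel_measurable_mean:
  fixes X :: "nat \<Rightarrow> 'a \<Rightarrow> 'b::euclidean_space"
  shows "(\<And>m. m \<in> {1..M} \<Longrightarrow> X m \<in> borel_measurable P) \<Longrightarrow> (\<lambda>\<omega>. mean M (\<lambda>m. X m \<omega>)) \<in> borel_measurable P"
  unfolding mean_def by (intro borel_measurable_scaleR borel_measurable_sum) auto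

context prob_space
begin

definition msq :: "('a \<Rightarrow> 'b::real_normed_vector) \<Rightarrow> real" where
  "msq X = (\<integral>\<omega>. (norm (X \<omega>))\<^sup>2 \<partial>M)"

lemma msq_nonneg: "0 \<le> msq X"
  by (simp add: msq_def)

lemma msq_cong: "(\<And>\<omega>. \<omega> \<in> space M \<Longrightarrow> X \<omega> = Y \<omega>) \<Longrightarrow> msq X = msq Y"
  unfolding msq_def by (intro Bochner_Integration.integral_cong) auto

lemma msq_scaleR: "msq (\<lambda>\<omega>. c *\<^sub>R X \<omega>) = c\<^sup>2 * msq X"
  by (simp add: msq_def power_mult_distrib)

lemma msq_mono:
  assumes "sq_integrable M X" "sq_integrable M Y" "\<And>\<omega>. \<omega> \<in> space M \<Longrightarrow> norm (X \<omega>) \<le> norm (Y \<omega>)"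
  shows "msq X \<le> msq Y"
  unfolding msq_def using assms
  by (intro integral_mono sq_integrable_norm) (auto intro: power_mono)

lemma msq_add:
  assumes "sq_integrable M X" "sq_integrable M Y"
  shows "msq (\<lambda>\<omega>. X \<omega> + Y \<omega>) = msq X + msq Y + 2 * (\<integral>\<omega>. X \<omega> \<bullet> Y \<omega> \<partial>M)"
proof -
  have "(norm (X \<omega> + Y \<omega>))\<^sup>2 = (norm (X \<omega>))\<^sup>2 + (norm (Y \<omega>))\<^sup>2 + 2 * (X \<omega> \<bullet> Y \<omega>)" for \<omega>
    unfolding power2_norm_eq_inner by (simp add: inner_add inner_commute)
  then show ?thesis unfolding msq_def
    using assms[THEN sq_integrable_norm] sq_integrable_inner[OF assms] by simp
qed

lemma msq_young:
  assumes "sq_integrable M X" "sq_integrable M Y" "0 < w" "w < 1"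
  shows "msq (\<lambda>\<omega>. X \<omega> + Y \<omega>) \<le> msq X / (1 - w) + msq Y / w"
proof -
  have "msq (\<lambda>\<omega>. X \<omega> + Y \<omega>) \<le> (\<integral>\<omega>. (norm (X \<omega>))\<^sup>2 / (1 - w) + (norm (Y \<omega>))\<^sup>2 / w \<partial>M)"
    unfolding msq_def using assms norm_add_young
    by (intro integral_mono) (auto intro!: sq_integrable_norm sq_integrable_add)
  then show ?thesis
    unfolding msq_def using assms(1,2)[THEN sq_integrable_norm] by simp
qed

lemma msq_sum_le:
  assumes "\<And>i. i \<in> A \<Longrightarrow> sq_integrable M (X i)"
  shows "msq (\<lambda>\<omega>. \<Sum>i\<in>A. X i \<omega>) \<le> real (card A) * (\<Sum>i\<in>A. msq (X i))"
proof -
  have "msq (\<lambda>\<omega>. \<Sum>i\<in>A. X i \<omega>) \<le> (\<integral>\<omega>. real (card A) * (\<Sum>i\<in>A. (norm (X i \<omega>))\<^sup>2) \<partial>M)"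
    unfolding msq_def using assms norm_sum_power2_le
    by (intro integral_mono) (auto intro!: sq_integrable_norm sq_integrable_sum)
  also have "\<dots> = real (card A) * (\<Sum>i\<in>A. msq (X i))"
    unfolding msq_def using assms[THEN sq_integrable_norm] by simp
  finally show ?thesis .
qed

lemma msq_sum_orth:
  assumes "finite A" "\<And>i. i \<in> A \<Longrightarrow> sq_integrable M (X i)"
    and "\<And>i j. i \<in> A \<Longrightarrow> j \<in> A \<Longrightarrow> i \<noteq> j \<Longrightarrow> (\<integral>\<omega>. X i \<omega> \<bullet> X j \<omega> \<partial>M) = 0"
  shows "msq (\<lambda>\<omega>. \<Sum>i\<in>A. X i \<omega>) = (\<Sum>i\<in>A. msq (X i))"
  using assms
proof (induction A)
  case (insert a A)
  have "(\<integral>\<omega>. X a \<omega> \<bullet> (\<Sum>i\<in>A. X i \<omega>) \<partial>M) = (\<Sum>i\<in>A. \<integral>\<omega>. X a \<omega> \<bullet> X i \<omega> \<partial>M)"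
    unfolding inner_sum_right using insert.prems
    by (intro Bochner_Integration.integral_sum sq_integrable_inner) auto
  also have "\<dots> = 0" using insert by (intro sum.neutral) auto
  finally show ?case
    using insert msq_add[of "X a" "\<lambda>\<omega>. \<Sum>i\<in>A. X i \<omega>"] by (simp add: sq_integrable_sum)
qed (simp add: msq_def)

lemma expectation_mean:
  fixes f :: "nat \<Rightarrow> 'a \<Rightarrow> real"
  assumes "\<And>m. m \<in> {1..n} \<Longrightarrow> integrable M (f m)"
  shows "(\<integral>\<omega>. mean n (\<lambda>m. f m \<omega>) \<partial>M) = mean n (\<lambda>m. \<integral>\<omega>. f m \<omega> \<partial>M)"
    and "integrable M (\<lambda>\<omega>. mean n (\<lambda>m. f m \<omega>))"
proof -
  show "(\<integral>\<omega>. mean n (\<lambda>m. f m \<omega>) \<partial>M) = mean n (\<lambda>m. \<integral>\<omega>. f m \<omega> \<partial>M)"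
    using assms by (simp add: mean_def Bochner_Integration.integral_sum del: One_nat_def)
  show "integrable M (\<lambda>\<omega>. mean n (\<lambda>m. f m \<omega>))"
    unfolding mean_def using assms
    by (intro integrable_scaleR_right Bochner_Integration.integrable_sum)
qed

lemma mean_msq_mono:
  assumes X: "\<And>m. m \<in> {1..n} \<Longrightarrow> sq_integrable M (X m)" and Y: "sq_integrable M Y"
    and le: "\<And>\<omega>. \<omega> \<in> space M \<Longrightarrow> mean n (\<lambda>m. (norm (X m \<omega>))\<^sup>2) \<le> c * (norm (Y \<omega>))\<^sup>2"
  shows "mean n (\<lambda>m. msq (X m)) \<le> c * msq Y"
proof -
  have i: "\<And>m. m \<in> {1..n} \<Longrightarrow> integrable M (\<lambda>\<omega>. (norm (X m \<omega>))\<^sup>2)" using X by (rule sq_integrable_norm)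
  have "mean n (\<lambda>m. msq (X m)) = (\<integral>\<omega>. mean n (\<lambda>m. (norm (X m \<omega>))\<^sup>2) \<partial>M)"
    unfolding msq_def using expectation_mean(1)[of n "\<lambda>m \<omega>. (norm (X m \<omega>))\<^sup>2", OF i] by simp
  also have "\<dots> \<le> (\<integral>\<omega>. c * (norm (Y \<omega>))\<^sup>2 \<partial>M)"
    using le Y expectation_mean(2)[of n "\<lambda>m \<omega>. (norm (X m \<omega>))\<^sup>2", OF i]
    by (intro integral_mono) (auto intro: sq_integrable_norm)
  finally show ?thesis by (simp add: msq_def)
qed

lemma mean_msq_variance:
  assumes n: "n \<ge> 1" and X: "\<And>m. m \<in> {1..n} \<Longrightarrow> sq_integrable M (X m)"
  shows "mean n (\<lambda>m. msq (\<lambda>\<omega>. X m \<omega> - mean n (\<lambda>m. X m \<omega>))) = mean n (\<lambda>m. msq (X m)) - msq (\<lambda>\<omega>. mean n (\<lambda>m. X m \<omega>))"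
proof -
  let ?Y = "\<lambda>\<omega>. mean n (\<lambda>m. X m \<omega>)"
  have Y: "sq_integrable M ?Y" using X by (rule sq_integrable_mean)
  have i: "\<And>m. m \<in> {1..n} \<Longrightarrow> integrable M (\<lambda>\<omega>. (norm (X m \<omega>))\<^sup>2)" using X by (rule sq_integrable_norm)
  have d: "\<And>m. m \<in> {1..n} \<Longrightarrow> integrable M (\<lambda>\<omega>. (norm (X m \<omega> - ?Y \<omega>))\<^sup>2)"
    using X Y by (intro sq_integrable_norm sq_integrable_diff)
  have "mean n (\<lambda>m. msq (\<lambda>\<omega>. X m \<omega> - ?Y \<omega>)) = (\<integral>\<omega>. mean n (\<lambda>m. (norm (X m \<omega> - ?Y \<omega>))\<^sup>2) \<partial>M)"
    unfolding msq_def using expectation_mean(1)[of n "\<lambda>m \<omega>. (norm (X m \<omega> - ?Y \<omega>))\<^sup>2", OF d] by simp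
  also have "\<dots> = (\<integral>\<omega>. mean n (\<lambda>m. (norm (X m \<omega>))\<^sup>2) - (norm (?Y \<omega>))\<^sup>2 \<partial>M)"
    using n by (simp add: mean_variance)
  also have "\<dots> = mean n (\<lambda>m. msq (X m)) - msq ?Y"
    using sq_integrable_norm[OF Y] expectation_mean[of n "\<lambda>m \<omega>. (norm (X m \<omega>))\<^sup>2", OF i]
    by (simp add: msq_def)
  finally show ?thesis .
qed

end

section \<open>One communication round\<close>

lemma mean_divide: "mean M (\<lambda>m. f m / c) = mean M f / c" for c :: real
  by (simp add: mean_def sum_divide_distrib[symmetric] mult.commute)

section \<open>Double sums over the local steps\<close>

lemma sum_nat_below: "(\<Sum>k<K. real k) = real K * (real K - 1) / 2"
  by (induction K) (auto simp: field_simps)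

text \<open>The exact value is \<open>K * (K - 1) * (2 * K - 1) / 6\<close>, with
  \<open>2 * K - 1\<close> rounded up to \<open>2 * K\<close>.\<close>

lemma sum_square_below_le: "(\<Sum>k<K. (real k)\<^sup>2) \<le> (real K)\<^sup>2 * (real K - 1) / 3"
proof (induction K)
  case (Suc K)
  have "(real K)\<^sup>2 * (real K - 1) / 3 + (real K)\<^sup>2 \<le> (real (Suc K))\<^sup>2 * (real (Suc K) - 1) / 3"
    by (simp add: power2_eq_square field_simps)
  with Suc show ?case by simp
qed simp

text \<open>\<open>v l\<close> occurs once for every \<open>k\<close> with
  \<open>l < k < K\<close>.\<close>

lemma sum_partial_sums:
  fixes v :: "nat \<Rightarrow> real"
  shows "(\<Sum>k<K. \<Sum>l<k. v l) = (\<Sum>l<K. (real K - 1 - real l) * v l)"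
proof (induction K)
  case (Suc K)
  have "(\<Sum>l<Suc K. (real (Suc K) - 1 - real l) * v l) = (\<Sum>l<K. (real K - 1 - real l) * v l + v l)"
    by (simp add: algebra_simps)
  with Suc show ?case by (simp add: sum.distrib)
qed simp

text \<open>A term \<open>r j\<close> with \<open>j \<ge> 1\<close> receives the total weight of all
  \<open>k > j\<close>, at most \<open>2 + ... + (K - 1)\<close>, which is
  \<open>(K + 1) * (K - 2) / 2\<close>. The condition \<open>r 0 = 0\<close> removes
  \<open>k = 1\<close> and so produces the factor \<open>K - 2\<close> of the step size
  conditions.\<close>

lemma sum_weighted_partial_sums_le:
  fixes r :: "nat \<Rightarrow> real"
  assumes "K \<ge> 2" "r 0 = 0" "\<And>k. r k \<ge> 0"
  shows "(\<Sum>k<K. real k * (\<Sum>j<k. r j)) \<le> ((real K)\<^sup>2 - real K - 2) / 2 * (\<Sum>j<K. r j)"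
  using assms(1)
proof (induction K rule: dec_induct)
  case base
  then show ?case using assms(2) by (simp add: numeral_2_eq_2)
next
  case (step K)
  have W: "((real (Suc K))\<^sup>2 - real (Suc K) - 2) / 2 = ((real K)\<^sup>2 - real K - 2) / 2 + real K"
    by (simp add: power2_eq_square field_simps)
  have "((real K)\<^sup>2 - real K - 2) / 2 + real K = (real K - 1) * (real K + 2) / 2"
    by (simp add: power2_eq_square field_simps)
  moreover have "0 \<le> (real K - 1) * (real K + 2) / 2" using step.hyps by simp
  ultimately have "0 \<le> ((real K)\<^sup>2 - real K - 2) / 2 + real K" by (simp only:)
  then have "0 \<le> (((real K)\<^sup>2 - real K - 2) / 2 + real K) * r K" using assms(3) by simp
  with step.IH show ?case unfolding W by (simp add: distrib_left distrib_right)
qed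

text \<open>Half of what \<open>sum_weighted_partial_sums_le\<close> gives for
  \<open>r j = j\<close>.\<close>

lemma sum_weighted_squares_le:
  assumes "K \<ge> 2"
  shows "(\<Sum>k<K. real k * (\<Sum>j<k. real j)) \<le> ((real K)\<^sup>2 - real K - 2) / 2 * (real K * (real K - 1) / 4)"
  using assms
proof (induction K rule: dec_induct)
  case base
  then show ?case by (simp add: numeral_2_eq_2)
next
  case (step K)
  have "((real (Suc K))\<^sup>2 - real (Suc K) - 2) / 2 * (real (Suc K) * (real (Suc K) - 1) / 4)
     = ((real K)\<^sup>2 - real K - 2) / 2 * (real K * (real K - 1) / 4) + real K * (real K * (real K - 1) / 2)
       + real K * (real K - 1) / 2"
    by (simp add: power2_eq_square field_simps)
  moreover have "0 \<le> real K * (real K - 1) / 2" using step.hyps by simp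
  ultimately show ?case using step.IH by (simp add: sum_nat_below)
qed

text \<open>Summation of the drift recursion as a statement about reals, instantiated in
  \<open>SV_le\<close>: \<open>V\<close> is the scaled deviation of the workers, \<open>e\<close>
  and \<open>R\<close> are \<open>EKP\<close> and \<open>ER\<close>, \<open>H\<close> is the second
  moment of the averaged gradient. Bounding the inner sums of \<open>H\<close> by the full sum makes
  \<open>e\<close> linear in the step, so the sharper \<open>sum_weighted_squares_le\<close> applies
  to it.\<close>

lemma drift_sum_le:
  fixes V R e H :: "nat \<Rightarrow> real"
  assumes K: "K \<ge> 2" and w: "0 < w" "w < 1" "0 < w'" "w' < 1"
    and V: "\<And>k. k < K \<Longrightarrow> V k \<le> u2 * ((real k * s1 + (real k)\<^sup>2 * k2) / (1 - w)
              + real k / w * (\<Sum>j<k. e j / (1 - w') + R j / w'))"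
    and e: "\<And>k. k < K \<Longrightarrow> e k \<le> u2 * (2 * (real k * s2) + 2 * (real k * (\<Sum>i<k. H i)))"
    and R: "R 0 = 0" "\<And>k. R k \<ge> 0" and H: "\<And>k. H k \<ge> 0"
    and nn: "u2 \<ge> 0" "s1 \<ge> 0" "s2 \<ge> 0" "k2 \<ge> 0"
  defines "X \<equiv> real K * (real K - 1) * u2" and "W \<equiv> ((real K)\<^sup>2 - real K - 2) / 2"
  shows "(\<Sum>k<K. V k) \<le> (X * s1 / 2 + real K * X * k2 / 3) / (1 - w)
     + u2 * W / w * (X / 2 * (s2 + (\<Sum>k<K. H k)) / (1 - w') + (\<Sum>k<K. R k) / w')"
proof -
  let ?SH = "\<Sum>k<K. H k" and ?SR = "\<Sum>k<K. R k"
  have eb: "e j \<le> 2 * u2 * (s2 + ?SH) * real j" if "j < K" for j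
  proof -
    have "(\<Sum>i<j. H i) \<le> ?SH" using that H by (intro sum_mono2) auto
    then have "real j * (\<Sum>i<j. H i) \<le> real j * ?SH" by (intro mult_left_mono) auto
    then have "u2 * (2 * (real j * s2) + 2 * (real j * (\<Sum>i<j. H i))) \<le> u2 * (2 * (real j * s2) + 2 * (real j * ?SH))"
      using nn by (intro mult_left_mono) auto
    with e[OF that] show ?thesis by (simp add: algebra_simps)
  qed
  have E: "(\<Sum>k<K. real k * (\<Sum>j<k. e j)) \<le> W * (X / 2) * (s2 + ?SH)"
  proof -
    have "(\<Sum>k<K. real k * (\<Sum>j<k. e j)) \<le> (\<Sum>k<K. real k * (\<Sum>j<k. 2 * u2 * (s2 + ?SH) * real j))"
      using eb by (intro sum_mono mult_left_mono) auto
    also have "\<dots> = 2 * u2 * (s2 + ?SH) * (\<Sum>k<K. real k * (\<Sum>j<k. real j))"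
      by (subst sum_distrib_left, intro sum.cong refl)
        (simp only: sum_distrib_left[symmetric] mult.left_commute)
    also have "\<dots> \<le> 2 * u2 * (s2 + ?SH) * (W * (real K * (real K - 1) / 4))"
      unfolding W_def using nn H K
      by (intro mult_left_mono sum_weighted_squares_le) (auto intro!: mult_nonneg_nonneg add_nonneg_nonneg sum_nonneg)
    also have "\<dots> = W * (X / 2) * (s2 + ?SH)" by (simp add: X_def)
    finally show ?thesis .
  qed
  have RR: "(\<Sum>k<K. real k * (\<Sum>j<k. R j)) \<le> W * ?SR"
    unfolding W_def by (rule sum_weighted_partial_sums_le[where r = R, OF K R])
  have k2s: "(\<Sum>k<K. (real k)\<^sup>2) * k2 \<le> (real K)\<^sup>2 * (real K - 1) / 3 * k2"
    using nn by (intro mult_right_mono sum_square_below_le) auto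
  have "(\<Sum>k<K. V k) \<le> (\<Sum>k<K. u2 * ((real k * s1 + (real k)\<^sup>2 * k2) / (1 - w)
              + real k / w * (\<Sum>j<k. e j / (1 - w') + R j / w')))"
    using V by (intro sum_mono) auto
  also have "\<dots> = u2 * (((\<Sum>k<K. real k) * s1 + (\<Sum>k<K. (real k)\<^sup>2) * k2) / (1 - w)
      + ((\<Sum>k<K. real k * (\<Sum>j<k. e j)) / (1 - w') + (\<Sum>k<K. real k * (\<Sum>j<k. R j)) / w') / w)"
    by (simp add: sum_distrib_left sum_distrib_right sum_divide_distrib sum.distrib add_divide_distrib
        distrib_left mult_ac)
  also have "\<dots> \<le> u2 * (((real K * (real K - 1) / 2) * s1 + (real K)\<^sup>2 * (real K - 1) / 3 * k2) / (1 - w)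
      + (W * (X / 2) * (s2 + ?SH) / (1 - w') + W * ?SR / w') / w)"
    using E RR k2s w nn K unfolding sum_nat_below
    by (intro mult_left_mono add_mono divide_right_mono) auto
  also have "\<dots> = (X * s1 / 2 + real K * X * k2 / 3) / (1 - w)
     + u2 * W / w * (X / 2 * (s2 + ?SH) / (1 - w') + ?SR / w')"
    by (simp add: X_def power2_eq_square distrib_left add_divide_distrib mult_ac)
  finally show ?thesis .
qed

text \<open>
  One communication round: \<open>gf m\<close> is the gradient of the \<open>m\<close>-th objective, \<open>nz k m\<close> the sampling
  noise of worker \<open>m\<close> in its \<open>k\<close>-th step, and \<open>N k m\<close> a \<open>\<sigma>\<close>-algebra carrying everything that this
  noise has to be uncorrelated with.
\<close>

locale local_sgd = prob_space P for P :: "'a measure" +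
  fixes M K :: nat and L \<gamma> \<sigma> \<kappa> :: real
    and gf :: "nat \<Rightarrow> real^'d \<Rightarrow> real^'d"
    and xs nz :: "nat \<Rightarrow> nat \<Rightarrow> 'a \<Rightarrow> real^'d"
    and N :: "nat \<Rightarrow> nat \<Rightarrow> 'a measure"
  assumes M: "M \<ge> 1" and K: "K \<ge> 1" and L: "L > 0" and \<gamma>: "\<gamma> > 0"
    and lip: "\<And>m. m \<in> {1..M} \<Longrightarrow> L-lipschitz_on UNIV (gf m)"
    and hetero: "\<And>y. mean M (\<lambda>m. (norm (gf m y - mean M (\<lambda>m. gf m y)))\<^sup>2) \<le> \<kappa>\<^sup>2"
    and start: "\<And>m \<omega>. m \<in> {1..M} \<Longrightarrow> \<omega> \<in> space P \<Longrightarrow> xs 0 m \<omega> = xs 0 1 \<omega>"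
    and step: "\<And>k m \<omega>. k < K \<Longrightarrow> m \<in> {1..M} \<Longrightarrow> \<omega> \<in> space P \<Longrightarrow>
        xs (Suc k) m \<omega> = xs k m \<omega> - \<gamma> *\<^sub>R (gf m (xs k m \<omega>) + nz k m \<omega>)"
    and xs_sq: "\<And>k m. k \<le> K \<Longrightarrow> m \<in> {1..M} \<Longrightarrow> sq_integrable P (xs k m)"
    and nz_sq: "\<And>k m. k < K \<Longrightarrow> m \<in> {1..M} \<Longrightarrow> sq_integrable P (nz k m)"
    and nz_var: "\<And>k m. k < K \<Longrightarrow> m \<in> {1..M} \<Longrightarrow> msq (nz k m) \<le> \<sigma>\<^sup>2"
    and nz_orth: "\<And>k m i Z. k < K \<Longrightarrow> m \<in> {1..M} \<Longrightarrow> Z \<in> borel_measurable (N k m) \<Longrightarrow>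
        sq_integrable P Z \<Longrightarrow> (\<integral>\<omega>. nz k m \<omega> $ i * Z \<omega> \<partial>P) = 0"
    and xs_N: "\<And>k m j m'. k < K \<Longrightarrow> m \<in> {1..M} \<Longrightarrow> j \<le> k \<Longrightarrow> m' \<in> {1..M} \<Longrightarrow>
        xs j m' \<in> borel_measurable (N k m)"
    and nz_N: "\<And>k m j m'. k < K \<Longrightarrow> m \<in> {1..M} \<Longrightarrow> m' \<in> {1..M} \<Longrightarrow> j < k \<or> j = k \<and> m' \<noteq> m \<Longrightarrow>
        nz j m' \<in> borel_measurable (N k m)"
begin

definition xb :: "nat \<Rightarrow> 'a \<Rightarrow> real^'d" where "xb k \<omega> = mean M (\<lambda>m. xs k m \<omega>)"
definition h :: "nat \<Rightarrow> nat \<Rightarrow> 'a \<Rightarrow> real^'d" where "h k m \<omega> = gf m (xs k m \<omega>)"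
definition p :: "nat \<Rightarrow> nat \<Rightarrow> 'a \<Rightarrow> real^'d" where "p k m \<omega> = gf m (xb k \<omega>)"
definition rho :: "nat \<Rightarrow> nat \<Rightarrow> 'a \<Rightarrow> real^'d" where "rho k m \<omega> = h k m \<omega> - p k m \<omega>"
definition ga :: "nat \<Rightarrow> 'a \<Rightarrow> real^'d" where "ga k \<omega> = mean M (\<lambda>m. p k m \<omega>)"
definition ah :: "nat \<Rightarrow> 'a \<Rightarrow> real^'d" where "ah k \<omega> = mean M (\<lambda>m. h k m \<omega>)"
definition an :: "nat \<Rightarrow> 'a \<Rightarrow> real^'d" where "an k \<omega> = mean M (\<lambda>m. nz k m \<omega>)"
definition kap :: "nat \<Rightarrow> nat \<Rightarrow> 'a \<Rightarrow> real^'d" where "kap k m \<omega> = p k m \<omega> - ga k \<omega>"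
definition kp :: "nat \<Rightarrow> nat \<Rightarrow> 'a \<Rightarrow> real^'d" where "kp k m \<omega> = kap k m \<omega> - kap 0 m \<omega>"
definition dl :: "nat \<Rightarrow> 'a \<Rightarrow> real^'d" where "dl k \<omega> = ah k \<omega> - ga k \<omega>"
definition rt :: "nat \<Rightarrow> nat \<Rightarrow> 'a \<Rightarrow> real^'d" where "rt k m \<omega> = rho k m \<omega> - dl k \<omega>"

text \<open>
  \<open>h - ah = kap 0 + kp + rt\<close>: the heterogeneity at the start of the round, which is uncorrelated with
  the noise, plus two terms that vanish in step \<open>0\<close>.
\<close>

definition EV :: "nat \<Rightarrow> real" where "EV k = mean M (\<lambda>m. msq (\<lambda>\<omega>. xs k m \<omega> - xb k \<omega>))"
definition ER :: "nat \<Rightarrow> real" where "ER k = mean M (\<lambda>m. msq (rt k m))"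
definition EKP :: "nat \<Rightarrow> real" where "EKP k = mean M (\<lambda>m. msq (kp k m))"

lemma gf_measurable: "m \<in> {1..M} \<Longrightarrow> gf m \<in> borel_measurable borel"
  using lip by (intro borel_measurable_continuous_onI lipschitz_on_continuous_on)

lemma past_measurable:
  assumes "j < K" "m \<in> {1..M}" "k \<le> j"
  shows "xb k \<in> borel_measurable (N j m)"
    and "m' \<in> {1..M} \<Longrightarrow> h k m' \<in> borel_measurable (N j m)"
    and "m' \<in> {1..M} \<Longrightarrow> p k m' \<in> borel_measurable (N j m)"
    and "ga k \<in> borel_measurable (N j m)"
    and "ah k \<in> borel_measurable (N j m)"
    and "m' \<in> {1..M} \<Longrightarrow> kap k m' \<in> borel_measurable (N j m)"
proof -
  show xb: "xb k \<in> borel_measurable (N j m)"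
    unfolding xb_def using assms by (intro borel_measurable_mean xs_N)
  show h: "h k m' \<in> borel_measurable (N j m)" if "m' \<in> {1..M}" for m'
    unfolding h_def using assms that by (intro measurable_compose[OF xs_N gf_measurable])
  show p: "p k m' \<in> borel_measurable (N j m)" if "m' \<in> {1..M}" for m'
    unfolding p_def using that by (intro measurable_compose[OF xb gf_measurable])
  show ga: "ga k \<in> borel_measurable (N j m)"
    unfolding ga_def using p by (intro borel_measurable_mean)
  show "ah k \<in> borel_measurable (N j m)"
    unfolding ah_def using h by (intro borel_measurable_mean)
  show "kap k m' \<in> borel_measurable (N j m)" if "m' \<in> {1..M}" for m'
    unfolding kap_def using p[OF that] ga by (intro borel_measurable_diff)
qed

lemma sq:
  shows xb_sq: "k \<le> K \<Longrightarrow> sq_integrable P (xb k)"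
    and h_sq: "k \<le> K \<Longrightarrow> m \<in> {1..M} \<Longrightarrow> sq_integrable P (h k m)"
    and p_sq: "k \<le> K \<Longrightarrow> m \<in> {1..M} \<Longrightarrow> sq_integrable P (p k m)"
    and rho_sq: "k \<le> K \<Longrightarrow> m \<in> {1..M} \<Longrightarrow> sq_integrable P (rho k m)"
    and ga_sq: "k \<le> K \<Longrightarrow> sq_integrable P (ga k)"
    and ah_sq: "k \<le> K \<Longrightarrow> sq_integrable P (ah k)"
    and an_sq: "k < K \<Longrightarrow> sq_integrable P (an k)"
    and kap_sq: "k \<le> K \<Longrightarrow> m \<in> {1..M} \<Longrightarrow> sq_integrable P (kap k m)"
    and kp_sq: "k \<le> K \<Longrightarrow> m \<in> {1..M} \<Longrightarrow> sq_integrable P (kp k m)"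
    and dl_sq: "k \<le> K \<Longrightarrow> sq_integrable P (dl k)"
    and rt_sq: "k \<le> K \<Longrightarrow> m \<in> {1..M} \<Longrightarrow> sq_integrable P (rt k m)"
proof -
  show xb: "k \<le> K \<Longrightarrow> sq_integrable P (xb k)" for k
    unfolding xb_def by (intro sq_integrable_mean xs_sq)
  show h: "k \<le> K \<Longrightarrow> m \<in> {1..M} \<Longrightarrow> sq_integrable P (h k m)" for k m
    unfolding h_def by (intro sq_integrable_lipschitz[OF xs_sq lip])
  show p: "k \<le> K \<Longrightarrow> m \<in> {1..M} \<Longrightarrow> sq_integrable P (p k m)" for k m
    unfolding p_def by (intro sq_integrable_lipschitz[OF xb lip])
  show rho: "k \<le> K \<Longrightarrow> m \<in> {1..M} \<Longrightarrow> sq_integrable P (rho k m)" for k m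
    unfolding rho_def by (intro sq_integrable_diff h p)
  show ga: "k \<le> K \<Longrightarrow> sq_integrable P (ga k)" for k
    unfolding ga_def by (intro sq_integrable_mean p)
  show ah: "k \<le> K \<Longrightarrow> sq_integrable P (ah k)" for k
    unfolding ah_def by (intro sq_integrable_mean h)
  show "k < K \<Longrightarrow> sq_integrable P (an k)" for k
    unfolding an_def by (intro sq_integrable_mean nz_sq)
  show kap: "k \<le> K \<Longrightarrow> m \<in> {1..M} \<Longrightarrow> sq_integrable P (kap k m)" for k m
    unfolding kap_def by (intro sq_integrable_diff p ga)
  show "k \<le> K \<Longrightarrow> m \<in> {1..M} \<Longrightarrow> sq_integrable P (kp k m)" for k m
    unfolding kp_def by (intro sq_integrable_diff kap) auto
  show dl: "k \<le> K \<Longrightarrow> sq_integrable P (dl k)" for k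
    unfolding dl_def by (intro sq_integrable_diff ah ga)
  show "k \<le> K \<Longrightarrow> m \<in> {1..M} \<Longrightarrow> sq_integrable P (rt k m)" for k m
    unfolding rt_def by (intro sq_integrable_diff rho dl)
qed

lemma nz_orth_inner:
  assumes "k < K" "m \<in> {1..M}" "Z \<in> borel_measurable (N k m)" "sq_integrable P Z"
  shows "(\<integral>\<omega>. nz k m \<omega> \<bullet> Z \<omega> \<partial>P) = 0"
proof -
  have "(\<integral>\<omega>. nz k m \<omega> \<bullet> Z \<omega> \<partial>P) = (\<Sum>i\<in>UNIV. \<integral>\<omega>. nz k m \<omega> $ i * Z \<omega> $ i \<partial>P)"
    unfolding inner_vec_def using assms nz_sq
    by (subst Bochner_Integration.integral_sum) (auto intro!: sq_integrable_mult sq_integrable_nth)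
  also have "\<dots> = 0"
    using assms by (intro sum.neutral ballI nz_orth borel_measurable_nth sq_integrable_nth)
  finally show ?thesis .
qed

lemma an_orth:
  assumes "k < K" "\<And>m. m \<in> {1..M} \<Longrightarrow> Z \<in> borel_measurable (N k m)" "sq_integrable P Z"
  shows "(\<integral>\<omega>. an k \<omega> \<bullet> Z \<omega> \<partial>P) = 0"
proof -
  have "(\<integral>\<omega>. an k \<omega> \<bullet> Z \<omega> \<partial>P) = mean M (\<lambda>m. \<integral>\<omega>. nz k m \<omega> \<bullet> Z \<omega> \<partial>P)"
    unfolding an_def mean_inner_left using assms nz_sq
    by (intro expectation_mean(1)) (auto intro!: sq_integrable_inner)
  also have "\<dots> = mean M (\<lambda>_. 0)" using assms by (intro mean_cong nz_orth_inner)
  finally show ?thesis by (simp add: mean_const[OF M])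
qed

text \<open>Of two distinct noises one is always measurable for the sigma-algebra of the other: the
  earlier for that of the later, and either one at equal steps.\<close>

lemma nz_orth_nz:
  assumes "k < K" "m \<in> {1..M}" "k' < K" "m' \<in> {1..M}" "(k, m) \<noteq> (k', m')"
  shows "(\<integral>\<omega>. nz k m \<omega> $ i * nz k' m' \<omega> $ i \<partial>P) = 0" "(\<integral>\<omega>. nz k m \<omega> \<bullet> nz k' m' \<omega> \<partial>P) = 0"
proof -
  have "(k' < k \<or> k' = k \<and> m' \<noteq> m) \<or> (k < k' \<or> k = k' \<and> m \<noteq> m')" using assms(5) by auto
  then consider "k' < k \<or> k' = k \<and> m' \<noteq> m" | "k < k' \<or> k = k' \<and> m \<noteq> m'" by blast
  then have "(\<integral>\<omega>. nz k m \<omega> $ i * nz k' m' \<omega> $ i \<partial>P) = 0 \<and> (\<integral>\<omega>. nz k m \<omega> \<bullet> nz k' m' \<omega> \<partial>P) = 0"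
  proof cases
    case 1
    then show ?thesis using assms
      by (intro conjI nz_orth nz_orth_inner borel_measurable_nth sq_integrable_nth nz_N nz_sq) auto
  next
    case 2
    then have "(\<integral>\<omega>. nz k' m' \<omega> $ i * nz k m \<omega> $ i \<partial>P) = 0 \<and> (\<integral>\<omega>. nz k' m' \<omega> \<bullet> nz k m \<omega> \<partial>P) = 0"
      using assms by (intro conjI nz_orth nz_orth_inner borel_measurable_nth sq_integrable_nth nz_N nz_sq) auto
    then show ?thesis by (simp add: mult.commute inner_commute)
  qed
  then show "(\<integral>\<omega>. nz k m \<omega> $ i * nz k' m' \<omega> $ i \<partial>P) = 0" "(\<integral>\<omega>. nz k m \<omega> \<bullet> nz k' m' \<omega> \<partial>P) = 0" by auto
qed

lemma an_measurable: "k < K \<Longrightarrow> m \<in> {1..M} \<Longrightarrow> j < k \<Longrightarrow> an j \<in> borel_measurable (N k m)"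
  unfolding an_def by (intro borel_measurable_mean nz_N) auto

lemma an_orth_an:
  assumes "j < K" "k < K" "j \<noteq> k"
  shows "(\<integral>\<omega>. an j \<omega> \<bullet> an k \<omega> \<partial>P) = 0"
proof (cases "k < j")
  case True
  then show ?thesis using assms by (intro an_orth an_measurable an_sq)
next
  case False
  then have "(\<integral>\<omega>. an k \<omega> \<bullet> an j \<omega> \<partial>P) = 0" using assms by (intro an_orth an_measurable an_sq) auto
  then show ?thesis by (simp add: inner_commute)
qed

lemma mean_nz_le: "k < K \<Longrightarrow> mean M (\<lambda>m. msq (nz k m)) \<le> \<sigma>\<^sup>2"
  using mean_mono[of M "\<lambda>m. msq (nz k m)" "\<lambda>_. \<sigma>\<^sup>2"] nz_var by (simp add: mean_const[OF M])

lemma msq_an: "k < K \<Longrightarrow> msq (an k) = mean M (\<lambda>m. msq (nz k m)) / real M"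
proof -
  assume k: "k < K"
  have "msq (\<lambda>\<omega>. \<Sum>m=1..M. nz k m \<omega>) = (\<Sum>m=1..M. msq (nz k m))"
    using k nz_orth_nz(2)[of k _ k] nz_sq by (intro msq_sum_orth) auto
  then show ?thesis unfolding an_def mean_def msq_scaleR by (simp add: power2_eq_square)
qed

lemma msq_sum_an_le: "k \<le> K \<Longrightarrow> msq (\<lambda>\<omega>. \<Sum>j<k. an j \<omega>) \<le> real k * (\<sigma>\<^sup>2 / real M)"
proof -
  assume k: "k \<le> K"
  have "msq (\<lambda>\<omega>. \<Sum>j<k. an j \<omega>) = (\<Sum>j<k. msq (an j))"
    using k an_orth_an an_sq by (intro msq_sum_orth) auto
  also have "\<dots> \<le> (\<Sum>j<k. \<sigma>\<^sup>2 / real M)"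
    using k mean_nz_le by (intro sum_mono) (auto simp: msq_an intro!: divide_right_mono)
  finally show ?thesis by simp
qed

section \<open>Deviation of the workers from their average\<close>

definition nd :: "nat \<Rightarrow> nat \<Rightarrow> 'a \<Rightarrow> real^'d" where "nd k m \<omega> = (\<Sum>j<k. nz j m \<omega> - an j \<omega>)"

lemma nd_sq: "k \<le> K \<Longrightarrow> m \<in> {1..M} \<Longrightarrow> sq_integrable P (nd k m)"
  unfolding nd_def by (intro sq_integrable_sum sq_integrable_diff nz_sq an_sq) auto

text \<open>Subtracting the average removes \<open>msq (an j)\<close>, which is the fraction
  \<open>1 / M\<close> of the mean noise since workers are uncorrelated. Keeping this gain matters
  for small \<open>M\<close>.\<close>

lemma mean_msq_nd_le:
  assumes k: "k \<le> K"
  shows "mean M (\<lambda>m. msq (nd k m)) \<le> real k * ((1 - 1 / real M) * \<sigma>\<^sup>2)"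
proof -
  have nd: "nd k m = (\<lambda>\<omega>. (\<Sum>j<k. nz j m \<omega>) - mean M (\<lambda>m. \<Sum>j<k. nz j m \<omega>))" for m
    by (simp add: nd_def sum_subtractf mean_sum an_def fun_eq_iff)
  have "mean M (\<lambda>m. msq (nd k m))
      = mean M (\<lambda>m. msq (\<lambda>\<omega>. (\<Sum>j<k. nz j m \<omega>) - mean M (\<lambda>m. \<Sum>j<k. nz j m \<omega>)))"
    by (simp only: nd)
  also have "\<dots> = mean M (\<lambda>m. msq (\<lambda>\<omega>. \<Sum>j<k. nz j m \<omega>)) - msq (\<lambda>\<omega>. \<Sum>j<k. an j \<omega>)"
    using k by (subst mean_msq_variance[OF M]) (auto intro!: sq_integrable_sum nz_sq simp: mean_sum an_def)
  also have "mean M (\<lambda>m. msq (\<lambda>\<omega>. \<Sum>j<k. nz j m \<omega>)) = mean M (\<lambda>m. \<Sum>j<k. msq (nz j m))"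
    using k nz_orth_nz(2) nz_sq by (intro mean_cong msq_sum_orth) auto
  also have "\<dots> = (\<Sum>j<k. mean M (\<lambda>m. msq (nz j m)))" by (rule mean_sum)
  also have "msq (\<lambda>\<omega>. \<Sum>j<k. an j \<omega>) = (\<Sum>j<k. msq (an j))"
    using k an_orth_an an_sq by (intro msq_sum_orth) auto
  also have "(\<Sum>j<k. mean M (\<lambda>m. msq (nz j m))) - (\<Sum>j<k. msq (an j))
      = (\<Sum>j<k. (1 - 1 / real M) * mean M (\<lambda>m. msq (nz j m)))"
    unfolding sum_subtractf[symmetric] using k by (intro sum.cong) (auto simp: msq_an algebra_simps)
  also have "\<dots> \<le> (\<Sum>j<k. (1 - 1 / real M) * \<sigma>\<^sup>2)"
    using k mean_nz_le M by (intro sum_mono mult_left_mono) auto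
  finally show ?thesis by simp
qed

lemma mean_msq_kap_le: "k \<le> K \<Longrightarrow> mean M (\<lambda>m. msq (kap k m)) \<le> \<kappa>\<^sup>2"
  using mean_msq_mono[of M "kap k" "\<lambda>_. 1 :: real" "\<kappa>\<^sup>2"] kap_sq hetero
  by (simp add: kap_def p_def ga_def msq_def prob_space sq_integrable_const)

text \<open>\<open>kap 0\<close> is determined at the start of the round, so every noise of the
  round is orthogonal to it and the two second moments add without a Young factor.\<close>

lemma mean_msq_nd_kap_le:
  assumes k: "k \<le> K"
  shows "mean M (\<lambda>m. msq (\<lambda>\<omega>. nd k m \<omega> + real k *\<^sub>R kap 0 m \<omega>))
    \<le> real k * ((1 - 1 / real M) * \<sigma>\<^sup>2) + (real k)\<^sup>2 * \<kappa>\<^sup>2"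
proof -
  have "msq (\<lambda>\<omega>. nd k m \<omega> + real k *\<^sub>R kap 0 m \<omega>) = msq (nd k m) + (real k)\<^sup>2 * msq (kap 0 m)"
    if m: "m \<in> {1..M}" for m
  proof -
    have "(\<integral>\<omega>. (nz j m \<omega> - an j \<omega>) \<bullet> kap 0 m \<omega> \<partial>P) = 0" if "j < k" for j
    proof -
      have j: "j < K" using that k by simp
      have "integrable P (\<lambda>\<omega>. nz j m \<omega> \<bullet> kap 0 m \<omega>)" "integrable P (\<lambda>\<omega>. an j \<omega> \<bullet> kap 0 m \<omega>)"
        using j m by (auto intro!: sq_integrable_inner nz_sq an_sq kap_sq)
      moreover have "(\<integral>\<omega>. nz j m \<omega> \<bullet> kap 0 m \<omega> \<partial>P) = 0"
        using j m by (intro nz_orth_inner past_measurable kap_sq) auto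
      moreover have "(\<integral>\<omega>. an j \<omega> \<bullet> kap 0 m \<omega> \<partial>P) = 0"
        using j m by (intro an_orth past_measurable kap_sq) auto
      ultimately show ?thesis by (simp add: inner_diff_left)
    qed
    then have "(\<integral>\<omega>. nd k m \<omega> \<bullet> (real k *\<^sub>R kap 0 m \<omega>) \<partial>P) = 0"
      using k m unfolding nd_def inner_sum_left inner_scaleR_right
      by (subst Bochner_Integration.integral_mult_right_zero)
        (auto simp: intro!: Bochner_Integration.integral_sum[THEN trans] sq_integrable_inner nz_sq an_sq kap_sq sq_integrable_diff)
    then show ?thesis
      using msq_add[OF nd_sq[OF k m] sq_integrable_scaleR[OF kap_sq[OF _ m], of 0 "real k"]]
      by (simp add: msq_scaleR)
  qed
  then have "mean M (\<lambda>m. msq (\<lambda>\<omega>. nd k m \<omega> + real k *\<^sub>R kap 0 m \<omega>))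
      = mean M (\<lambda>m. msq (nd k m) + (real k)\<^sup>2 * msq (kap 0 m))" by (intro mean_cong)
  also have "\<dots> = mean M (\<lambda>m. msq (nd k m)) + (real k)\<^sup>2 * mean M (\<lambda>m. msq (kap 0 m))"
    by (simp add: mean_add mean_mult)
  also have "\<dots> \<le> real k * ((1 - 1 / real M) * \<sigma>\<^sup>2) + (real k)\<^sup>2 * \<kappa>\<^sup>2"
    using mean_msq_nd_le[OF k] mean_msq_kap_le[of 0] by (intro add_mono mult_left_mono) auto
  finally show ?thesis .
qed

lemma xb_0: "m \<in> {1..M} \<Longrightarrow> \<omega> \<in> space P \<Longrightarrow> xs 0 m \<omega> = xb 0 \<omega>"
proof -
  assume m: "m \<in> {1..M}" and \<omega>: "\<omega> \<in> space P"
  have "xb 0 \<omega> = mean M (\<lambda>_. xs 0 1 \<omega>)"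
    unfolding xb_def using \<omega> by (intro mean_cong start)
  also have "\<dots> = xs 0 m \<omega>" unfolding start[OF m \<omega>] by (rule mean_const[OF M])
  finally show "xs 0 m \<omega> = xb 0 \<omega>" by simp
qed

lemma xb_Suc:
  assumes "k < K" "\<omega> \<in> space P"
  shows "xb (Suc k) \<omega> = xb k \<omega> - \<gamma> *\<^sub>R (ah k \<omega> + an k \<omega>)"
proof -
  have "xb (Suc k) \<omega> = mean M (\<lambda>m. xs k m \<omega> - \<gamma> *\<^sub>R (h k m \<omega> + nz k m \<omega>))"
    unfolding xb_def h_def using step assms by (intro mean_cong) auto
  then show ?thesis by (simp add: mean_diff mean_scaleR mean_add xb_def ah_def an_def)
qed

lemma deviation_eq:
  assumes "k \<le> K" "m \<in> {1..M}" "\<omega> \<in> space P"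
  shows "xs k m \<omega> - xb k \<omega>
    = - \<gamma> *\<^sub>R ((nd k m \<omega> + real k *\<^sub>R kap 0 m \<omega>) + (\<Sum>j<k. kp j m \<omega> + rt j m \<omega>))"
  using assms(1)
proof (induction k)
  case 0
  then show ?case using xb_0[OF assms(2,3)] by (simp add: nd_def)
next
  case (Suc k)
  then have k: "k < K" by simp
  have "xs (Suc k) m \<omega> - xb (Suc k) \<omega>
      = (xs k m \<omega> - xb k \<omega>) - \<gamma> *\<^sub>R ((nz k m \<omega> - an k \<omega>) + kap 0 m \<omega> + (kp k m \<omega> + rt k m \<omega>))"
    unfolding step[OF k assms(2,3)] xb_Suc[OF k assms(3)] kp_def rt_def rho_def dl_def kap_def h_def
    by (simp add: algebra_simps)
  also have "xs k m \<omega> - xb k \<omega>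
      = - \<gamma> *\<^sub>R ((nd k m \<omega> + real k *\<^sub>R kap 0 m \<omega>) + (\<Sum>j<k. kp j m \<omega> + rt j m \<omega>))"
    using Suc by simp
  finally show ?case by (simp add: nd_def algebra_simps)
qed

text \<open>\<open>w\<close> separates the part with exactly additive second moments from the drift
  part, and \<open>w'\<close> separates \<open>kp\<close> from \<open>rt\<close>. Both stay free
  since \<open>SV_bound\<close> and \<open>SD_bound\<close> choose them differently.\<close>

lemma EV_le:
  assumes k: "k < K" and w: "0 < w" "w < 1" "0 < w'" "w' < 1"
  shows "EV k \<le> \<gamma>\<^sup>2 * ((real k * ((1 - 1 / real M) * \<sigma>\<^sup>2) + (real k)\<^sup>2 * \<kappa>\<^sup>2) / (1 - w)
    + real k / w * (\<Sum>j<k. EKP j / (1 - w') + ER j / w'))"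
proof -
  let ?A = "\<lambda>m \<omega>. nd k m \<omega> + real k *\<^sub>R kap 0 m \<omega>" and ?B = "\<lambda>m \<omega>. \<Sum>j<k. kp j m \<omega> + rt j m \<omega>"
  have "msq (\<lambda>\<omega>. xs k m \<omega> - xb k \<omega>)
      \<le> \<gamma>\<^sup>2 * (msq (?A m) / (1 - w) + real k / w * (\<Sum>j<k. msq (kp j m) / (1 - w') + msq (rt j m) / w'))"
    if m: "m \<in> {1..M}" for m
  proof -
    have A: "sq_integrable P (?A m)" using k m
      by (intro sq_integrable_add nd_sq sq_integrable_scaleR kap_sq) auto
    have kr: "\<And>j. j < k \<Longrightarrow> sq_integrable P (\<lambda>\<omega>. kp j m \<omega> + rt j m \<omega>)"
      using k m by (intro sq_integrable_add kp_sq rt_sq) auto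
    have B: "sq_integrable P (?B m)" using kr by (intro sq_integrable_sum) auto
    have e1: "msq (\<lambda>\<omega>. xs k m \<omega> - xb k \<omega>) = msq (\<lambda>\<omega>. - \<gamma> *\<^sub>R (?A m \<omega> + ?B m \<omega>))"
      using k m deviation_eq[of k m] by (intro msq_cong) auto
    have e2: "\<dots> = \<gamma>\<^sup>2 * msq (\<lambda>\<omega>. ?A m \<omega> + ?B m \<omega>)" by (subst msq_scaleR) simp
    have e3: "msq (\<lambda>\<omega>. ?A m \<omega> + ?B m \<omega>) \<le> msq (?A m) / (1 - w) + msq (?B m) / w"
      by (intro msq_young A B w)
    have "msq (?B m) \<le> real k * (\<Sum>j<k. msq (\<lambda>\<omega>. kp j m \<omega> + rt j m \<omega>))"
      using msq_sum_le[of "{..<k}" "\<lambda>j \<omega>. kp j m \<omega> + rt j m \<omega>"] kr by simp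
    also have "\<dots> \<le> real k * (\<Sum>j<k. msq (kp j m) / (1 - w') + msq (rt j m) / w')"
      using k m w by (intro mult_left_mono sum_mono msq_young kp_sq rt_sq) auto
    finally have "msq (?B m) / w \<le> real k * (\<Sum>j<k. msq (kp j m) / (1 - w') + msq (rt j m) / w') / w"
      using w by (intro divide_right_mono) auto
    with e3 have "msq (\<lambda>\<omega>. ?A m \<omega> + ?B m \<omega>)
        \<le> msq (?A m) / (1 - w) + real k / w * (\<Sum>j<k. msq (kp j m) / (1 - w') + msq (rt j m) / w')"
      by simp
    then show ?thesis unfolding e1 e2 by (rule mult_left_mono) simp
  qed
  then have "EV k \<le> mean M (\<lambda>m. \<gamma>\<^sup>2 * (msq (?A m) / (1 - w) + real k / w * (\<Sum>j<k. msq (kp j m) / (1 - w') + msq (rt j m) / w')))"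
    unfolding EV_def by (intro mean_mono)
  also have "\<dots> = \<gamma>\<^sup>2 * (mean M (\<lambda>m. msq (?A m)) / (1 - w) + real k / w * (\<Sum>j<k. EKP j / (1 - w') + ER j / w'))"
    by (simp add: mean_mult mean_add mean_sum mean_divide EKP_def ER_def)
  also have "\<dots> \<le> \<gamma>\<^sup>2 * ((real k * ((1 - 1 / real M) * \<sigma>\<^sup>2) + (real k)\<^sup>2 * \<kappa>\<^sup>2) / (1 - w)
    + real k / w * (\<Sum>j<k. EKP j / (1 - w') + ER j / w'))"
    using mean_msq_nd_kap_le[of k] k w by (intro mult_left_mono add_right_mono divide_right_mono) auto
  finally show ?thesis .
qed

lemma xb_drift_le:
  assumes k: "k \<le> K"
  shows "msq (\<lambda>\<omega>. xb k \<omega> - xb 0 \<omega>)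
    \<le> \<gamma>\<^sup>2 * (2 * (real k * (\<sigma>\<^sup>2 / real M)) + 2 * (real k * (\<Sum>i<k. msq (ah i))))"
proof -
  have eq: "xb k \<omega> - xb 0 \<omega> = - \<gamma> *\<^sub>R ((\<Sum>i<k. an i \<omega>) + (\<Sum>i<k. ah i \<omega>))" if "\<omega> \<in> space P" for \<omega>
    using k by (induction k) (auto simp: xb_Suc that algebra_simps)
  have an: "sq_integrable P (\<lambda>\<omega>. \<Sum>i<k. an i \<omega>)" and ah: "sq_integrable P (\<lambda>\<omega>. \<Sum>i<k. ah i \<omega>)"
    using k by (auto intro!: sq_integrable_sum an_sq ah_sq)
  have e1: "msq (\<lambda>\<omega>. xb k \<omega> - xb 0 \<omega>) = msq (\<lambda>\<omega>. - \<gamma> *\<^sub>R ((\<Sum>i<k. an i \<omega>) + (\<Sum>i<k. ah i \<omega>)))"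
    using eq by (intro msq_cong) auto
  have e2: "\<dots> = \<gamma>\<^sup>2 * msq (\<lambda>\<omega>. (\<Sum>i<k. an i \<omega>) + (\<Sum>i<k. ah i \<omega>))" by (subst msq_scaleR) simp
  have "msq (\<lambda>\<omega>. (\<Sum>i<k. an i \<omega>) + (\<Sum>i<k. ah i \<omega>))
      \<le> msq (\<lambda>\<omega>. \<Sum>i<k. an i \<omega>) / (1 - 1 / 2) + msq (\<lambda>\<omega>. \<Sum>i<k. ah i \<omega>) / (1 / 2)"
    by (intro msq_young an ah) auto
  also have "\<dots> \<le> 2 * (real k * (\<sigma>\<^sup>2 / real M)) + 2 * (real k * (\<Sum>i<k. msq (ah i)))"
    using msq_sum_an_le[OF k] msq_sum_le[of "{..<k}" ah] ah_sq k by simp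
  finally show ?thesis unfolding e1 e2 by (rule mult_left_mono) simp
qed

lemma mean_msq_p_diff_le:
  assumes "k \<le> K"
  shows "mean M (\<lambda>m. msq (\<lambda>\<omega>. p k m \<omega> - p 0 m \<omega>)) \<le> L\<^sup>2 * msq (\<lambda>\<omega>. xb k \<omega> - xb 0 \<omega>)"
proof (rule mean_msq_mono)
  fix \<omega>
  have "mean M (\<lambda>m. (norm (p k m \<omega> - p 0 m \<omega>))\<^sup>2) \<le> mean M (\<lambda>m. L\<^sup>2 * (norm (xb k \<omega> - xb 0 \<omega>))\<^sup>2)"
  proof (rule mean_mono)
    fix m assume m: "m \<in> {1..M}"
    have "norm (p k m \<omega> - p 0 m \<omega>) \<le> L * norm (xb k \<omega> - xb 0 \<omega>)"
      using lipschitz_onD[OF lip[OF m], of "xb k \<omega>" "xb 0 \<omega>"] by (simp add: p_def dist_norm)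
    then have "(norm (p k m \<omega> - p 0 m \<omega>))\<^sup>2 \<le> (L * norm (xb k \<omega> - xb 0 \<omega>))\<^sup>2"
      by (intro power_mono) auto
    then show "(norm (p k m \<omega> - p 0 m \<omega>))\<^sup>2 \<le> L\<^sup>2 * (norm (xb k \<omega> - xb 0 \<omega>))\<^sup>2"
      by (simp add: power_mult_distrib)
  qed
  then show "mean M (\<lambda>m. (norm (p k m \<omega> - p 0 m \<omega>))\<^sup>2) \<le> L\<^sup>2 * (norm (xb k \<omega> - xb 0 \<omega>))\<^sup>2"
    by (simp add: mean_const[OF M])
qed (use assms in \<open>auto intro!: sq_integrable_diff p_sq xb_sq\<close>)

lemma EKP_le:
  assumes k: "k \<le> K"
  shows "EKP k \<le> L\<^sup>2 * msq (\<lambda>\<omega>. xb k \<omega> - xb 0 \<omega>)"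
proof -
  have kp: "kp k m = (\<lambda>\<omega>. (p k m \<omega> - p 0 m \<omega>) - mean M (\<lambda>m. p k m \<omega> - p 0 m \<omega>))" for m
    by (simp add: kp_def kap_def ga_def mean_diff fun_eq_iff)
  have "EKP k = mean M (\<lambda>m. msq (\<lambda>\<omega>. (p k m \<omega> - p 0 m \<omega>) - mean M (\<lambda>m. p k m \<omega> - p 0 m \<omega>)))"
    by (simp only: EKP_def kp)
  also have "\<dots> \<le> mean M (\<lambda>m. msq (\<lambda>\<omega>. p k m \<omega> - p 0 m \<omega>))"
    using k by (subst mean_msq_variance[OF M]) (auto intro!: sq_integrable_diff p_sq simp: msq_nonneg)
  also have "\<dots> \<le> L\<^sup>2 * msq (\<lambda>\<omega>. xb k \<omega> - xb 0 \<omega>)" by (rule mean_msq_p_diff_le[OF k])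
  finally show ?thesis .
qed

lemma mean_msq_rho_le:
  assumes k: "k \<le> K"
  shows "mean M (\<lambda>m. msq (rho k m)) \<le> L\<^sup>2 * EV k"
proof -
  have "msq (rho k m) \<le> L\<^sup>2 * msq (\<lambda>\<omega>. xs k m \<omega> - xb k \<omega>)" if m: "m \<in> {1..M}" for m
  proof -
    have "msq (rho k m) \<le> msq (\<lambda>\<omega>. L *\<^sub>R (xs k m \<omega> - xb k \<omega>))"
    proof (rule msq_mono)
      show "norm (rho k m \<omega>) \<le> norm (L *\<^sub>R (xs k m \<omega> - xb k \<omega>))" for \<omega>
        using lipschitz_onD[OF lip[OF m], of "xs k m \<omega>" "xb k \<omega>"] L
        by (simp add: rho_def h_def p_def dist_norm)
    qed (use k m in \<open>auto intro!: sq_integrable_scaleR sq_integrable_diff rho_sq xs_sq xb_sq\<close>)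
    then show ?thesis by (simp add: msq_scaleR)
  qed
  then have "mean M (\<lambda>m. msq (rho k m)) \<le> mean M (\<lambda>m. L\<^sup>2 * msq (\<lambda>\<omega>. xs k m \<omega> - xb k \<omega>))"
    by (rule mean_mono)
  then show ?thesis by (simp add: mean_mult EV_def)
qed

text \<open>\<open>dl\<close> is the average of \<open>rho\<close> over the workers and
  \<open>rt\<close> the deviation from it, so the variance identity lets both share a single
  Lipschitz budget. This makes it possible to cancel the sum of \<open>ER\<close> in
  \<open>SD_bound\<close> instead of estimating it.\<close>

lemma msq_dl_ER_le:
  assumes k: "k \<le> K"
  shows "msq (dl k) + ER k \<le> L\<^sup>2 * EV k"
proof -
  have dl: "dl k \<omega> = mean M (\<lambda>m. rho k m \<omega>)" for \<omega>
    by (simp add: dl_def ah_def ga_def rho_def mean_diff)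
  have "ER k = mean M (\<lambda>m. msq (\<lambda>\<omega>. rho k m \<omega> - mean M (\<lambda>m. rho k m \<omega>)))"
    unfolding ER_def rt_def[abs_def] dl ..
  also have "\<dots> = mean M (\<lambda>m. msq (rho k m)) - msq (dl k)"
    using k by (subst mean_msq_variance[OF M]) (auto intro!: rho_sq simp: dl[abs_def])
  finally show ?thesis using mean_msq_rho_le[OF k] by simp
qed

lemma EV_nonneg: "0 \<le> EV k" and ER_nonneg: "0 \<le> ER k" and EKP_nonneg: "0 \<le> EKP k"
  unfolding EV_def ER_def EKP_def by (auto intro!: mean_nonneg msq_nonneg)

lemma EV_0: "EV 0 = 0"
proof -
  have "msq (\<lambda>\<omega>. xs 0 m \<omega> - xb 0 \<omega>) = 0" if "m \<in> {1..M}" for m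
    using xb_0[OF that] msq_cong[of "\<lambda>\<omega>. xs 0 m \<omega> - xb 0 \<omega>" "\<lambda>_. 0 :: real^'d"] by (simp add: msq_def)
  then have "EV 0 = mean M (\<lambda>_. 0)" unfolding EV_def by (intro mean_cong)
  then show ?thesis by (simp add: mean_const[OF M])
qed

lemma ER_0: "ER 0 = 0" and msq_dl_0: "msq (dl 0) = 0"
  using msq_dl_ER_le[of 0] EV_0 ER_nonneg[of 0] msq_nonneg[of "dl 0"] by auto

end

section \<open>Smooth functions\<close>

text \<open>Riesz representation in finite dimension: the gradient collects the values of the
  derivative on the basis.\<close>

lemma gderiv_gradient:
  fixes g :: "'v::euclidean_space \<Rightarrow> real"
  assumes "g differentiable (at y)"
  shows "GDERIV g y :> gradient g y"
proof -
  obtain g' where g': "(g has_derivative g') (at y)"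
    using assms unfolding differentiable_def by blast
  interpret bounded_linear g' using g' by (rule has_derivative_bounded_linear)
  define D where "D = (\<Sum>b\<in>Basis. g' b *\<^sub>R b)"
  have "g' h = h \<bullet> D" for h
  proof -
    have "g' h = g' (\<Sum>b\<in>Basis. (h \<bullet> b) *\<^sub>R b)" by (simp add: euclidean_representation)
    also have "\<dots> = h \<bullet> D"
      unfolding D_def by (simp add: sum scaleR inner_sum_right mult.commute)
    finally show ?thesis .
  qed
  then have "g' = (\<lambda>h. h \<bullet> D)" by (rule ext)
  then have "GDERIV g y :> D" using g' unfolding gderiv_def by simp
  then show ?thesis using gradient_eqI by metis
qed

lemma gderiv_average:
  assumes "\<And>m. m \<in> A \<Longrightarrow> GDERIV (f m) y :> G m"
  shows "GDERIV (\<lambda>y. (\<Sum>m\<in>A. f m y) / c) y :> (1 / c) *\<^sub>R (\<Sum>m\<in>A. G m)"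
proof -
  have "((\<lambda>y. (1 / c) *\<^sub>R (\<Sum>m\<in>A. f m y)) has_derivative (\<lambda>h. (1 / c) *\<^sub>R (\<Sum>m\<in>A. h \<bullet> G m))) (at y)"
    using assms unfolding gderiv_def by (intro has_derivative_scaleR_right has_derivative_sum) auto
  then show ?thesis unfolding gderiv_def by (simp add: inner_sum_right divide_inverse mult.commute)
qed

text \<open>\<open>\<phi>\<close> is \<open>F\<close> along the segment minus its linear and
  quadratic model, up to a constant; the Lipschitz bound makes its derivative nonpositive on
  [0, 1].\<close>

lemma lipschitz_gradient_descent:
  fixes F :: "'v::euclidean_space \<Rightarrow> real"
  assumes F: "\<And>y. GDERIV F y :> G y" and G: "L-lipschitz_on UNIV G"
  shows "F (y + h) \<le> F y + G y \<bullet> h + L / 2 * (norm h)\<^sup>2"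
proof -
  define \<phi> where "\<phi> t = F (y + t *\<^sub>R h) - t * (G y \<bullet> h) - L / 2 * t\<^sup>2 * (norm h)\<^sup>2" for t :: real
  have d: "(\<phi> has_real_derivative (G (y + t *\<^sub>R h) \<bullet> h - G y \<bullet> h - L * t * (norm h)\<^sup>2)) (at t)" for t
  proof -
    have "((\<lambda>t. F (y + t *\<^sub>R h)) has_derivative (\<lambda>s. (s *\<^sub>R h) \<bullet> G (y + t *\<^sub>R h))) (at t)"
    proof (rule has_derivative_compose[where g = F and f = "\<lambda>t. y + t *\<^sub>R h"])
      show "((\<lambda>t. y + t *\<^sub>R h) has_derivative (\<lambda>s. s *\<^sub>R h)) (at t)"
        by (auto intro!: derivative_eq_intros)
      show "(F has_derivative (\<lambda>k. k \<bullet> G (y + t *\<^sub>R h))) (at (y + t *\<^sub>R h))"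
        using F unfolding gderiv_def .
    qed
    then have "((\<lambda>t. F (y + t *\<^sub>R h)) has_real_derivative G (y + t *\<^sub>R h) \<bullet> h) (at t)"
      unfolding has_field_derivative_def by (simp add: inner_commute mult_commute_abs)
    then show ?thesis unfolding \<phi>_def
      by (auto intro!: derivative_eq_intros)
  qed
  have "\<phi> 1 \<le> \<phi> 0"
  proof (rule DERIV_nonpos_imp_nonincreasing[where f = \<phi>])
    fix t :: real assume t: "0 \<le> t" "t \<le> 1"
    have "(G (y + t *\<^sub>R h) - G y) \<bullet> h \<le> norm (G (y + t *\<^sub>R h) - G y) * norm h"
      by (rule norm_cauchy_schwarz)
    also have "\<dots> \<le> (L * (t * norm h)) * norm h"
      using lipschitz_onD[OF G, of "y + t *\<^sub>R h" y] t
      by (intro mult_right_mono) (auto simp: dist_norm)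
    finally have "G (y + t *\<^sub>R h) \<bullet> h - G y \<bullet> h - L * t * (norm h)\<^sup>2 \<le> 0"
      by (simp add: inner_diff_left power2_eq_square mult.assoc)
    then show "\<exists>D. DERIV \<phi> t :> D \<and> D \<le> 0" using d by blast
  qed simp
  then show ?thesis by (simp add: \<phi>_def)
qed

section \<open>Bounds for one round\<close>

text \<open>\<open>F\<close> is bounded below by \<open>c\<close> and, by the descent lemma started
  at 0, above by a quadratic.\<close>

lemma (in prob_space) integrable_smooth:
  fixes F :: "'b::euclidean_space \<Rightarrow> real"
  assumes F: "\<And>y. GDERIV F y :> G y" and G: "L-lipschitz_on UNIV G" and b: "\<And>y. c \<le> F y"
    and X: "sq_integrable M X"
  shows "integrable M (\<lambda>\<omega>. F (X \<omega>))"
proof -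
  have "continuous_on UNIV F"
    by (intro continuous_at_imp_continuous_on ballI has_derivative_continuous[OF F[unfolded gderiv_def]])
  then have [measurable]: "F \<in> borel_measurable borel" by (rule borel_measurable_continuous_onI)
  note [measurable] = sq_integrable_measurable[OF X]
  let ?U = "\<lambda>\<omega>. \<bar>c\<bar> + (\<bar>F 0\<bar> + ((norm (G 0))\<^sup>2 + (norm (X \<omega>))\<^sup>2) + L / 2 * (norm (X \<omega>))\<^sup>2)"
  show ?thesis
  proof (rule Bochner_Integration.integrable_bound)
    show "integrable M ?U" using sq_integrable_norm[OF X] by auto
    show "AE \<omega> in M. norm (F (X \<omega>)) \<le> norm (?U \<omega>)"
    proof (rule AE_I2)
      fix \<omega>
      have "F (X \<omega>) \<le> F 0 + G 0 \<bullet> X \<omega> + L / 2 * (norm (X \<omega>))\<^sup>2"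
        using lipschitz_gradient_descent[OF F G, of 0 "X \<omega>"] by simp
      moreover have "G 0 \<bullet> X \<omega> \<le> (norm (G 0))\<^sup>2 + (norm (X \<omega>))\<^sup>2"
      proof -
        have "G 0 \<bullet> X \<omega> \<le> norm (G 0) * norm (X \<omega>)" by (rule norm_cauchy_schwarz)
        also have "\<dots> \<le> (norm (G 0))\<^sup>2 + (norm (X \<omega>))\<^sup>2"
          using sum_squares_bound[of "norm (G 0)" "norm (X \<omega>)"]
            mult_nonneg_nonneg[OF norm_ge_zero[of "G 0"] norm_ge_zero[of "X \<omega>"]] by linarith
        finally show ?thesis .
      qed
      moreover have "0 \<le> L / 2 * (norm (X \<omega>))\<^sup>2" "0 \<le> (norm (G 0))\<^sup>2" "0 \<le> (norm (X \<omega>))\<^sup>2"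
        using lipschitz_on_nonneg[OF G] by auto
      ultimately have "F (X \<omega>) \<le> ?U \<omega>" "- ?U \<omega> \<le> F (X \<omega>)"
        using b[of "X \<omega>"] abs_ge_self[of "F 0"] abs_ge_zero[of "F 0"] abs_ge_zero[of c] abs_ge_minus_self[of c]
        by linarith+
      then have "\<bar>F (X \<omega>)\<bar> \<le> ?U \<omega>" by (intro abs_leI) linarith+
      then show "norm (F (X \<omega>)) \<le> norm (?U \<omega>)" unfolding real_norm_def by linarith
    qed
  qed measurable
qed

section \<open>Deviations and gradient discrepancy summed over the local steps\<close>

context local_sgd
begin

definition u :: real where "u = L * \<gamma>"
definition XX :: real where "XX = real K * (real K - 1) * u\<^sup>2"
text \<open>The quantity subtracted from 1 in the denominators of the step size conditions. It is
  negative for \<open>K = 1\<close> and zero for \<open>K = 2\<close>, so these cases need separate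
  attention.\<close>

definition DD :: real where "DD = 2 * (real K + 1) * (real K - 2) * u\<^sup>2"
definition SG :: real where "SG = (\<Sum>k<K. msq (ga k))"
definition SH :: real where "SH = (\<Sum>k<K. msq (ah k))"
definition SD :: real where "SD = (\<Sum>k<K. msq (dl k))"
definition SV :: real where "SV = L\<^sup>2 * (\<Sum>k<K. EV k)"

lemma u_pos: "u > 0"
  using L \<gamma> by (simp add: u_def)

lemma XX_nonneg: "XX \<ge> 0"
  using K by (simp add: XX_def)

lemma SG_nonneg: "0 \<le> SG" and SH_nonneg: "0 \<le> SH" and SD_nonneg: "0 \<le> SD" and SV_nonneg: "0 \<le> SV"
  unfolding SG_def SH_def SD_def SV_def by (auto intro!: sum_nonneg mult_nonneg_nonneg msq_nonneg EV_nonneg)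

lemma L2_xb_drift_le:
  "k \<le> K \<Longrightarrow> L\<^sup>2 * msq (\<lambda>\<omega>. xb k \<omega> - xb 0 \<omega>)
    \<le> u\<^sup>2 * (2 * (real k * (\<sigma>\<^sup>2 / real M)) + 2 * (real k * (\<Sum>i<k. msq (ah i))))"
  using mult_left_mono[OF xb_drift_le[of k], of "L\<^sup>2"] by (simp add: u_def power_mult_distrib)

lemma SV_le:
  assumes K2: "K \<ge> 2" and w: "0 < w" "w < 1" "0 < w'" "w' < 1"
  shows "SV \<le> (XX * ((1 - 1 / real M) * \<sigma>\<^sup>2) / 2 + real K * XX * \<kappa>\<^sup>2 / 3) / (1 - w)
     + DD / 4 / w * (XX / 2 * (\<sigma>\<^sup>2 / real M + SH) / (1 - w') + (\<Sum>k<K. ER k) / w')"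
proof -
  have "SV = (\<Sum>k<K. L\<^sup>2 * EV k)" by (simp add: SV_def sum_distrib_left)
  also have "\<dots> \<le> (real K * (real K - 1) * u\<^sup>2 * ((1 - 1 / real M) * \<sigma>\<^sup>2) / 2
      + real K * (real K * (real K - 1) * u\<^sup>2) * \<kappa>\<^sup>2 / 3) / (1 - w)
     + u\<^sup>2 * (((real K)\<^sup>2 - real K - 2) / 2) / w
       * (real K * (real K - 1) * u\<^sup>2 / 2 * (\<sigma>\<^sup>2 / real M + (\<Sum>k<K. msq (ah k))) / (1 - w') + (\<Sum>k<K. ER k) / w')"
  proof (rule drift_sum_le[OF K2 w, where e = EKP])
    fix k assume k: "k < K"
    show "L\<^sup>2 * EV k \<le> u\<^sup>2 * ((real k * ((1 - 1 / real M) * \<sigma>\<^sup>2) + (real k)\<^sup>2 * \<kappa>\<^sup>2) / (1 - w)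
        + real k / w * (\<Sum>j<k. EKP j / (1 - w') + ER j / w'))"
      using mult_left_mono[OF EV_le[OF k w], of "L\<^sup>2"] by (simp add: u_def power_mult_distrib mult.assoc)
    show "EKP k \<le> u\<^sup>2 * (2 * (real k * (\<sigma>\<^sup>2 / real M)) + 2 * (real k * (\<Sum>i<k. msq (ah i))))"
      using EKP_le[of k] L2_xb_drift_le[of k] k by simp
  qed (use M in \<open>auto simp: ER_0 ER_nonneg msq_nonneg\<close>)
  \<comment> \<open>The weight of \<open>sum_weighted_partial_sums_le\<close> turns into
    \<open>DD\<close>, as \<open>(K + 1) * (K - 2) = K^2 - K - 2\<close>.\<close>
  also have "u\<^sup>2 * (((real K)\<^sup>2 - real K - 2) / 2) = DD / 4"
    by (simp add: DD_def power2_eq_square field_simps)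
  finally show ?thesis by (simp only: XX_def SH_def)
qed

lemma SD_SR_le: "SD + (\<Sum>k<K. ER k) \<le> SV"
  unfolding SD_def SV_def sum_distrib_left sum.distrib[symmetric]
  using msq_dl_ER_le by (intro sum_mono) auto

lemma SR_nonneg: "0 \<le> (\<Sum>k<K. ER k)"
  by (intro sum_nonneg ER_nonneg)

text \<open>With one local step all gradients are taken at the common starting point. The case is
  split off because the summation lemmas require \<open>K \<ge> 2\<close>.\<close>

lemma K_1:
  assumes "K = 1"
  shows "SD = 0" "SV = 0" "XX = 0"
proof -
  have e: "{..<K} = {0}" using assms by auto
  show "SD = 0" unfolding SD_def e by (simp add: msq_dl_0)
  show "SV = 0" unfolding SV_def e by (simp add: EV_0)
  show "XX = 0" unfolding XX_def using assms by simp
qed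

lemma DD_nonneg: "K \<ge> 2 \<Longrightarrow> DD \<ge> 0"
  by (simp add: DD_def)

text \<open>The Young weights 2/5 and 5/8 have product 1/4, which gives the sum of \<open>ER\<close>
  the coefficient \<open>DD\<close> exactly; being at most \<open>SV\<close>, it moves to the
  left-hand side. Subject to this product the split is tuned for
  \<open>quantization_budget\<close>.\<close>

lemma SV_bound:
  shows "(1 - DD) * SV \<le> 5 / 3 * (XX * \<sigma>\<^sup>2 * (1 - 1 / real M) / 2 + real K * XX * \<kappa>\<^sup>2 / 3)
    + 5 / 6 * DD * XX * (\<sigma>\<^sup>2 / real M + SH)"
proof (cases "K = 1")
  case True
  show ?thesis unfolding K_1[OF True] by simp
next
  case False
  then have K2: "K \<ge> 2" using K by simp
  have "DD * (\<Sum>k<K. ER k) \<le> DD * SV"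
    using SD_SR_le SD_nonneg DD_nonneg[OF K2] by (intro mult_left_mono) auto
  moreover have "SV \<le> (XX * ((1 - 1 / real M) * \<sigma>\<^sup>2) / 2 + real K * XX * \<kappa>\<^sup>2 / 3) / (1 - 2 / 5)
      + DD / 4 / (2 / 5) * (XX / 2 * (\<sigma>\<^sup>2 / real M + SH) / (1 - 5 / 8) + (\<Sum>k<K. ER k) / (5 / 8))"
    by (rule SV_le[OF K2]) auto
  moreover have "DD / 4 / (2 / 5) * (XX / 2 * (\<sigma>\<^sup>2 / real M + SH) / (1 - 5 / 8) + (\<Sum>k<K. ER k) / (5 / 8))
      = 5 / 6 * DD * XX * (\<sigma>\<^sup>2 / real M + SH) + DD * (\<Sum>k<K. ER k)"
    by (simp add: distrib_left)
  moreover have "(XX * ((1 - 1 / real M) * \<sigma>\<^sup>2) / 2 + real K * XX * \<kappa>\<^sup>2 / 3) / (1 - 2 / 5)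
      = 5 / 3 * (XX * \<sigma>\<^sup>2 * (1 - 1 / real M) / 2 + real K * XX * \<kappa>\<^sup>2 / 3)"
    by (simp add: mult_ac)
  moreover have "(1 - DD) * SV = SV - DD * SV" by (simp add: algebra_simps)
  ultimately show ?thesis by linarith
qed

text \<open>For \<open>K \<ge> 3\<close> the weights \<open>DD / 2\<close> and 1/2 give the sum of
  \<open>ER\<close> the coefficient 1, and it cancels against the same sum in
  \<open>SD_SR_le\<close>. The denominator \<open>1 - DD / 2\<close> is then weakened to
  \<open>1 - DD\<close>.\<close>

lemma SD_bound:
  assumes D: "DD < 1"
  shows "SD \<le> XX / (1 - DD) * (\<sigma>\<^sup>2 * (1 + 1 / real M) / 2 + 2 * real K * \<kappa>\<^sup>2 + 2 * SG + SH)"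
proof -
  let ?m = "1 / real M"
  have m: "0 \<le> ?m" "?m \<le> 1" using M by auto
  have X: "XX \<ge> 0" by (rule XX_nonneg)
  define Y where "Y = XX / (1 - DD)"
  have Y: "Y \<ge> 0" using X D by (simp add: Y_def)
  define t where "t = Y * (\<sigma>\<^sup>2 * ?m)"
  have s: "0 \<le> Y * \<sigma>\<^sup>2" "0 \<le> t" "0 \<le> Y * (real K * \<kappa>\<^sup>2)" "0 \<le> Y * SG" "0 \<le> Y * SH"
    using Y SG_nonneg SH_nonneg by (auto simp: t_def)
  have goal: "Y * (\<sigma>\<^sup>2 * (1 + ?m) / 2 + 2 * real K * \<kappa>\<^sup>2 + 2 * SG + SH)
     = (Y * \<sigma>\<^sup>2) / 2 + t / 2 + 2 * (Y * (real K * \<kappa>\<^sup>2)) + 2 * (Y * SG) + Y * SH"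
    unfolding t_def by (simp add: algebra_simps add_divide_distrib)
  consider "K = 1" | "K = 2" | "K \<ge> 3" using K by linarith
  then show ?thesis
  proof cases
    case 1
    show ?thesis unfolding K_1[OF 1] by simp
  next
    case 2
    have D0: "DD = 0" unfolding DD_def using 2 by simp
    have K2: "2 \<le> K" using 2 by simp
    \<comment> \<open>the Young weight \<open>DD / 2\<close> of the general case degenerates to \<open>0\<close> here\<close>
    define w where "w = 1 / (real M + 1)"
    have w: "0 < w" "w < 1" using M unfolding w_def by auto
    \<comment> \<open>Chosen so that this Young factor is compensated by the gain from centring the
      noise: \<open>(1 + 1 / M) * (1 - 1 / M) \<le> 1\<close>.\<close>
    have wi: "1 / (1 - w) = 1 + ?m" using M by (simp add: w_def field_simps)
    have "SV \<le> (XX * ((1 - ?m) * \<sigma>\<^sup>2) / 2 + real K * XX * \<kappa>\<^sup>2 / 3) * (1 + ?m)"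
      using SV_le[OF K2 w, of "1/2"] unfolding D0 wi[symmetric] by simp
    also have "\<dots> = (XX * \<sigma>\<^sup>2) / 2 * (1 - ?m * ?m) + XX * (real K * \<kappa>\<^sup>2) / 3 * (1 + ?m)"
      by (simp add: algebra_simps add_divide_distrib)
    also have "\<dots> \<le> (XX * \<sigma>\<^sup>2) / 2 * 1 + XX * (real K * \<kappa>\<^sup>2) / 3 * 2"
      using m X by (intro add_mono mult_left_mono) auto
    also have "\<dots> \<le> (Y * \<sigma>\<^sup>2) / 2 + Y * (real K * \<kappa>\<^sup>2)" using s(3) by (simp add: Y_def D0 mult_ac)
    finally have "SV \<le> (Y * \<sigma>\<^sup>2) / 2 + Y * (real K * \<kappa>\<^sup>2)" .
    moreover have "SD \<le> SV" using SD_SR_le SR_nonneg by simp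
    ultimately show ?thesis unfolding Y_def[symmetric] goal using s by linarith
  next
    case 3
    then have Dp: "DD > 0" unfolding DD_def using u_pos by (intro mult_pos_pos) auto
    have "SV \<le> (XX * ((1 - ?m) * \<sigma>\<^sup>2) / 2 + real K * XX * \<kappa>\<^sup>2 / 3) / (1 - DD / 2)
        + DD / 4 / (DD / 2) * (XX / 2 * (\<sigma>\<^sup>2 / real M + SH) / (1 - 1 / 2) + (\<Sum>k<K. ER k) / (1 / 2))"
      using 3 Dp D by (intro SV_le) auto
    also have "DD / 4 / (DD / 2) * (XX / 2 * (\<sigma>\<^sup>2 / real M + SH) / (1 - 1 / 2) + (\<Sum>k<K. ER k) / (1 / 2))
        = XX / 2 * (\<sigma>\<^sup>2 / real M + SH) + (\<Sum>k<K. ER k)"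
      using Dp by (simp add: field_simps)
    also have "(XX * ((1 - ?m) * \<sigma>\<^sup>2) / 2 + real K * XX * \<kappa>\<^sup>2 / 3) / (1 - DD / 2)
        \<le> (XX * ((1 - ?m) * \<sigma>\<^sup>2) / 2 + real K * XX * \<kappa>\<^sup>2 / 3) / (1 - DD)"
      using X m D Dp by (intro divide_left_mono mult_pos_pos) (auto intro!: add_nonneg_nonneg mult_nonneg_nonneg)
    also have "\<dots> = Y * ((1 - ?m) * \<sigma>\<^sup>2) / 2 + Y * (real K * \<kappa>\<^sup>2) / 3"
      by (simp add: Y_def add_divide_distrib mult_ac)
    finally have "SD \<le> Y * ((1 - ?m) * \<sigma>\<^sup>2) / 2 + Y * (real K * \<kappa>\<^sup>2) / 3 + XX / 2 * (\<sigma>\<^sup>2 / real M + SH)"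
      using SD_SR_le by simp
    also have "XX / 2 * (\<sigma>\<^sup>2 / real M + SH) \<le> Y / 2 * (\<sigma>\<^sup>2 / real M + SH)"
    proof (rule mult_right_mono)
      have "XX / 1 \<le> XX / (1 - DD)" using X D Dp by (intro divide_left_mono) auto
      then have "XX \<le> Y" unfolding Y_def by simp
      then show "XX / 2 \<le> Y / 2" by (rule divide_right_mono) simp
    qed (use SH_nonneg in auto)
    finally have "SD \<le> (Y * \<sigma>\<^sup>2) / 2 + Y * (real K * \<kappa>\<^sup>2) / 3 + (Y * SH) / 2"
      by (simp add: algebra_simps add_divide_distrib diff_divide_distrib)
    then show ?thesis unfolding Y_def[symmetric] goal using s by linarith
  qed
qed

section \<open>Sums of the local updates over a group of workers\<close>

text \<open>
  \<open>na\<close> collects the sampling noise; being uncorrelated across workers, it does not pick up the size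
  of the group in \<open>msq_upd_sum_le\<close> below, unlike the gradients in \<open>nb\<close>.
\<close>

definition na :: "nat \<Rightarrow> 'd \<Rightarrow> real" where
  "na m i = (\<Sum>l<K. (1 + 2 / real K * (real K - 1 - real l)) * msq (\<lambda>\<omega>. nz l m \<omega> $ i))"

definition nb :: "nat \<Rightarrow> 'd \<Rightarrow> real" where
  "nb m i = real K * (\<Sum>k<K. 8 / 3 * msq (\<lambda>\<omega>. p k m \<omega> $ i) + 47 / 20 * msq (\<lambda>\<omega>. rho k m \<omega> $ i)
      + 3 / 2 * msq (\<lambda>\<omega>. (p k m \<omega> - p 0 m \<omega>) $ i))"

definition upd :: "nat \<Rightarrow> 'a \<Rightarrow> real^'d" where
  "upd m \<omega> = (\<Sum>k<K. h k m \<omega> + nz k m \<omega>)"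

lemma h_0_eq: "m \<in> {1..M} \<Longrightarrow> \<omega> \<in> space P \<Longrightarrow> h 0 m \<omega> = p 0 m \<omega>"
  by (simp add: h_def p_def xb_0)

text \<open>The noise is paired with gradient increments since step 0 only. Young weights 5/8 for
  the gradients and 2/3 for the increments yield the constants of \<open>nb\<close>: 8/3 is
  \<open>1 / (1 - 5/8)\<close>, 47/20 is 8/5 + 3/4, and 3/2 is half of
  \<open>1 / (1 - 2/3)\<close>.\<close>

lemma msq_upd_sum_le:
  assumes T: "T \<subseteq> {1..M}"
  shows "msq (\<lambda>\<omega>. \<Sum>m\<in>T. upd m \<omega> $ i) \<le> (\<Sum>m\<in>T. na m i) + real (card T) * (\<Sum>m\<in>T. nb m i)"
proof -
  let ?c = "real (card T)"
  let ?p = "\<lambda>k m. msq (\<lambda>\<omega>. p k m \<omega> $ i)" and ?rh = "\<lambda>k m. msq (\<lambda>\<omega>. rho k m \<omega> $ i)"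
    and ?d = "\<lambda>k m. msq (\<lambda>\<omega>. (p k m \<omega> - p 0 m \<omega>) $ i)"
  have fT: "finite T" using T finite_subset by blast
  have mT: "\<And>m. m \<in> T \<Longrightarrow> m \<in> {1..M}" using T by auto
  define n where "n l \<omega> = (\<Sum>m\<in>T. nz l m \<omega> $ i)" for l \<omega>
  define H where "H k \<omega> = (\<Sum>m\<in>T. h k m \<omega> $ i)" for k \<omega>
  define v where "v l = (\<Sum>m\<in>T. msq (\<lambda>\<omega>. nz l m \<omega> $ i))" for l
  have n_sq: "\<And>l. l < K \<Longrightarrow> sq_integrable P (n l)" and H_sq: "\<And>k. k < K \<Longrightarrow> sq_integrable P (H k)"
    unfolding n_def H_def using mT by (auto intro!: sq_integrable_sum sq_integrable_nth nz_sq h_sq)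
  have n_orth: "(\<integral>\<omega>. n l \<omega> * Z \<omega> \<partial>P) = 0"
    if "l < K" "\<And>m. m \<in> T \<Longrightarrow> Z \<in> borel_measurable (N l m)" "sq_integrable P Z" for l Z
  proof -
    have "(\<integral>\<omega>. n l \<omega> * Z \<omega> \<partial>P) = (\<Sum>m\<in>T. \<integral>\<omega>. nz l m \<omega> $ i * Z \<omega> \<partial>P)"
      unfolding n_def sum_distrib_right using mT that
      by (intro Bochner_Integration.integral_sum sq_integrable_mult sq_integrable_nth nz_sq) auto
    also have "\<dots> = 0" using mT that by (intro sum.neutral ballI nz_orth) auto
    finally show ?thesis .
  qed
  have H_N: "H k \<in> borel_measurable (N l m)" if "k \<le> l" "l < K" "m \<in> T" for k l m
    unfolding H_def using that mT by (intro borel_measurable_sum borel_measurable_nth past_measurable) auto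
  have n_N: "n k \<in> borel_measurable (N l m)" if "k < l" "l < K" "m \<in> T" for k l m
    unfolding n_def using that mT by (intro borel_measurable_sum borel_measurable_nth nz_N) auto
  have n_n: "(\<integral>\<omega>. n l \<omega> * n k \<omega> \<partial>P) = 0" if "l < K" "k < K" "l \<noteq> k" for l k
  proof (cases "k < l")
    case True
    then show ?thesis using that by (intro n_orth n_N n_sq) auto
  next
    case False
    then have "(\<integral>\<omega>. n k \<omega> * n l \<omega> \<partial>P) = 0" using that by (intro n_orth n_N n_sq) auto
    then show ?thesis by (simp add: mult.commute)
  qed
  have msq_n: "msq (n l) = v l" if "l < K" for l
    unfolding n_def v_def using that mT fT nz_orth_nz(1)
    by (intro msq_sum_orth) (auto intro!: sq_integrable_nth nz_sq)
  have msq_ns: "msq (\<lambda>\<omega>. \<Sum>l<k. n l \<omega>) = (\<Sum>l<k. v l)" if "k \<le> K" for k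
  proof -
    have "msq (\<lambda>\<omega>. \<Sum>l<k. n l \<omega>) = (\<Sum>l<k. msq (n l))"
      using that n_n n_sq by (intro msq_sum_orth) auto
    then show ?thesis using that msq_n by simp
  qed
  have ns_sq: "sq_integrable P (\<lambda>\<omega>. \<Sum>l<k. n l \<omega>)" if "k \<le> K" for k
    using that n_sq by (intro sq_integrable_sum) auto
  have Hs_sq: "sq_integrable P (\<lambda>\<omega>. \<Sum>k<K. H k \<omega>)" using H_sq by (intro sq_integrable_sum) auto
  have Hd_sq: "sq_integrable P (\<lambda>\<omega>. H k \<omega> - H 0 \<omega>)" if "k < K" for k
    using that H_sq by (intro sq_integrable_diff) auto
  \<comment> \<open>the noise of step \<open>l\<close> is uncorrelated with \<open>H 0, \<dots>, H l\<close>\<close>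
  have cross: "(\<integral>\<omega>. (\<Sum>l<K. n l \<omega>) * H k \<omega> \<partial>P) = (\<integral>\<omega>. (\<Sum>l<k. n l \<omega>) * (H k \<omega> - H 0 \<omega>) \<partial>P)"
    if k: "k < K" for k
  proof -
    have "(\<integral>\<omega>. (\<Sum>l<K. n l \<omega>) * H k \<omega> \<partial>P) = (\<Sum>l<K. \<integral>\<omega>. n l \<omega> * H k \<omega> \<partial>P)"
      unfolding sum_distrib_right using k n_sq H_sq
      by (intro Bochner_Integration.integral_sum sq_integrable_mult) auto
    also have "\<dots> = (\<Sum>l<k. \<integral>\<omega>. n l \<omega> * H k \<omega> \<partial>P)"
      using k n_orth H_N H_sq by (intro sum.mono_neutral_right) auto
    also have "\<dots> = (\<Sum>l<k. \<integral>\<omega>. n l \<omega> * (H k \<omega> - H 0 \<omega>) \<partial>P)"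
    proof (rule sum.cong)
      fix l assume "l \<in> {..<k}"
      then have l: "l < K" using k by simp
      have "(\<integral>\<omega>. n l \<omega> * H 0 \<omega> \<partial>P) = 0" using l by (intro n_orth H_N H_sq) auto
      moreover have "integrable P (\<lambda>\<omega>. n l \<omega> * H k \<omega>)" "integrable P (\<lambda>\<omega>. n l \<omega> * H 0 \<omega>)"
        using l k by (auto intro!: sq_integrable_mult n_sq H_sq)
      ultimately show "(\<integral>\<omega>. n l \<omega> * H k \<omega> \<partial>P) = (\<integral>\<omega>. n l \<omega> * (H k \<omega> - H 0 \<omega>) \<partial>P)"
        by (simp add: right_diff_distrib)
    qed simp
    also have "\<dots> = (\<integral>\<omega>. (\<Sum>l<k. n l \<omega>) * (H k \<omega> - H 0 \<omega>) \<partial>P)"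
      unfolding sum_distrib_right using k n_sq Hd_sq
      by (intro Bochner_Integration.integral_sum[symmetric] sq_integrable_mult) auto
    finally show ?thesis .
  qed
  have K0: "real K > 0" using K by simp
  \<comment> \<open>The weight \<open>2 / K\<close> lets the cross terms cost at most as much noise
    again as the noise itself; see \<open>sum_na_le\<close>.\<close>
  have cross_le: "2 * (\<integral>\<omega>. (\<Sum>l<k. n l \<omega>) * (H k \<omega> - H 0 \<omega>) \<partial>P)
      \<le> 2 / real K * (\<Sum>l<k. v l) + real K / 2 * msq (\<lambda>\<omega>. H k \<omega> - H 0 \<omega>)" if k: "k < K" for k
  proof -
    let ?A = "\<lambda>\<omega>. \<Sum>l<k. n l \<omega>" and ?B = "\<lambda>\<omega>. H k \<omega> - H 0 \<omega>"
    have i: "integrable P (\<lambda>\<omega>. (?A \<omega>)\<^sup>2)" "integrable P (\<lambda>\<omega>. (?B \<omega>)\<^sup>2)"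
      using k by (auto intro!: sq_integrable_power2 ns_sq Hd_sq)
    have "2 * (a * b) \<le> 2 / real K * a\<^sup>2 + real K / 2 * b\<^sup>2" for a b :: real
    proof -
      have "0 \<le> (2 * a - real K * b)\<^sup>2 / (2 * real K)" using K0 by simp
      also have "\<dots> = 2 / real K * a\<^sup>2 + real K / 2 * b\<^sup>2 - 2 * (a * b)"
        using K0 by (simp add: power2_eq_square field_simps)
      finally show ?thesis by simp
    qed
    then have "(\<integral>\<omega>. 2 * (?A \<omega> * ?B \<omega>) \<partial>P) \<le> (\<integral>\<omega>. 2 / real K * (?A \<omega>)\<^sup>2 + real K / 2 * (?B \<omega>)\<^sup>2 \<partial>P)"
      using i k by (intro integral_mono)
        (auto intro!: sq_integrable_mult ns_sq Hd_sq Bochner_Integration.integrable_add integrable_mult_right)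
    also have "\<dots> = 2 / real K * msq ?A + real K / 2 * msq ?B"
      unfolding msq_def using i by simp
    finally show ?thesis using k msq_ns[of k] by simp
  qed
  have H_le: "msq (H k) \<le> ?c * (\<Sum>m\<in>T. 8 / 3 * ?p k m + 8 / 5 * ?rh k m)"
    if k: "k < K" for k
  proof -
    have "msq (H k) \<le> ?c * (\<Sum>m\<in>T. msq (\<lambda>\<omega>. h k m \<omega> $ i))"
      unfolding H_def using k mT by (intro msq_sum_le sq_integrable_nth h_sq) auto
    also have "\<dots> \<le> ?c * (\<Sum>m\<in>T. 8 / 3 * ?p k m + 8 / 5 * ?rh k m)"
    proof (intro mult_left_mono sum_mono)
      fix m assume m: "m \<in> T"
      have "msq (\<lambda>\<omega>. p k m \<omega> $ i + rho k m \<omega> $ i)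
          \<le> ?p k m / (1 - 5 / 8) + ?rh k m / (5 / 8)"
        using k m mT by (intro msq_young sq_integrable_nth p_sq rho_sq) auto
      then show "msq (\<lambda>\<omega>. h k m \<omega> $ i) \<le> 8 / 3 * ?p k m + 8 / 5 * ?rh k m"
        by (simp add: rho_def)
    qed simp
    finally show ?thesis .
  qed
  have Hd_le: "msq (\<lambda>\<omega>. H k \<omega> - H 0 \<omega>)
      \<le> ?c * (\<Sum>m\<in>T. 3 * ?d k m + 3 / 2 * ?rh k m)"
    if k: "k < K" for k
  proof -
    \<comment> \<open>By \<open>h_0_eq\<close> the deviation \<open>rho\<close> vanishes at step 0,
      so only its value at step \<open>k\<close> appears.\<close>
    have "msq (\<lambda>\<omega>. H k \<omega> - H 0 \<omega>) = msq (\<lambda>\<omega>. \<Sum>m\<in>T. (p k m \<omega> - p 0 m \<omega>) $ i + rho k m \<omega> $ i)"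
      using mT by (intro msq_cong) (auto simp: H_def sum_subtractf[symmetric] rho_def h_0_eq intro!: sum.cong)
    also have "\<dots> \<le> ?c * (\<Sum>m\<in>T. msq (\<lambda>\<omega>. (p k m \<omega> - p 0 m \<omega>) $ i + rho k m \<omega> $ i))"
      using k mT by (intro msq_sum_le sq_integrable_add sq_integrable_nth sq_integrable_diff p_sq rho_sq) auto
    also have "\<dots> \<le> ?c * (\<Sum>m\<in>T. 3 * ?d k m + 3 / 2 * ?rh k m)"
    proof (intro mult_left_mono sum_mono)
      fix m assume m: "m \<in> T"
      have "msq (\<lambda>\<omega>. (p k m \<omega> - p 0 m \<omega>) $ i + rho k m \<omega> $ i)
          \<le> ?d k m / (1 - 2 / 3) + ?rh k m / (2 / 3)"
        using k m mT by (intro msq_young sq_integrable_nth sq_integrable_diff p_sq rho_sq) auto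
      then show "msq (\<lambda>\<omega>. (p k m \<omega> - p 0 m \<omega>) $ i + rho k m \<omega> $ i)
          \<le> 3 * ?d k m + 3 / 2 * ?rh k m" by simp
    qed simp
    finally show ?thesis .
  qed
  have "msq (\<lambda>\<omega>. \<Sum>m\<in>T. upd m \<omega> $ i) = msq (\<lambda>\<omega>. (\<Sum>l<K. n l \<omega>) + (\<Sum>k<K. H k \<omega>))"
  proof (rule msq_cong)
    fix \<omega>
    have "(\<Sum>m\<in>T. upd m \<omega> $ i) = (\<Sum>m\<in>T. \<Sum>k<K. h k m \<omega> $ i + nz k m \<omega> $ i)"
      by (simp add: upd_def)
    also have "\<dots> = (\<Sum>l<K. n l \<omega>) + (\<Sum>k<K. H k \<omega>)"
      by (subst sum.swap) (simp add: sum.distrib n_def H_def)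
    finally show "(\<Sum>m\<in>T. upd m \<omega> $ i) = (\<Sum>l<K. n l \<omega>) + (\<Sum>k<K. H k \<omega>)" .
  qed
  also have "\<dots> = msq (\<lambda>\<omega>. \<Sum>l<K. n l \<omega>) + msq (\<lambda>\<omega>. \<Sum>k<K. H k \<omega>)
      + 2 * (\<integral>\<omega>. (\<Sum>l<K. n l \<omega>) * (\<Sum>k<K. H k \<omega>) \<partial>P)"
    using msq_add[OF ns_sq[of K] Hs_sq] by simp
  also have "(\<integral>\<omega>. (\<Sum>l<K. n l \<omega>) * (\<Sum>k<K. H k \<omega>) \<partial>P) = (\<Sum>k<K. \<integral>\<omega>. (\<Sum>l<K. n l \<omega>) * H k \<omega> \<partial>P)"
    unfolding sum_distrib_left using ns_sq H_sq
    by (intro Bochner_Integration.integral_sum sq_integrable_mult) auto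
  also have "\<dots> = (\<Sum>k<K. \<integral>\<omega>. (\<Sum>l<k. n l \<omega>) * (H k \<omega> - H 0 \<omega>) \<partial>P)"
    using cross by (intro sum.cong) auto
  also have "msq (\<lambda>\<omega>. \<Sum>l<K. n l \<omega>) = (\<Sum>l<K. v l)" by (rule msq_ns) simp
  finally have tot: "msq (\<lambda>\<omega>. \<Sum>m\<in>T. upd m \<omega> $ i) = (\<Sum>l<K. v l) + msq (\<lambda>\<omega>. \<Sum>k<K. H k \<omega>)
      + (\<Sum>k<K. 2 * (\<integral>\<omega>. (\<Sum>l<k. n l \<omega>) * (H k \<omega> - H 0 \<omega>) \<partial>P))"
    by (simp only: sum_distrib_left)
  have "msq (\<lambda>\<omega>. \<Sum>k<K. H k \<omega>) \<le> real K * (\<Sum>k<K. msq (H k))"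
    using msq_sum_le[of "{..<K}" H] H_sq by simp
  also have "\<dots> \<le> real K * (\<Sum>k<K. ?c * (\<Sum>m\<in>T. 8 / 3 * ?p k m + 8 / 5 * ?rh k m))"
    using H_le by (intro mult_left_mono sum_mono) auto
  finally have 1: "msq (\<lambda>\<omega>. \<Sum>k<K. H k \<omega>)
      \<le> real K * (\<Sum>k<K. ?c * (\<Sum>m\<in>T. 8 / 3 * ?p k m + 8 / 5 * ?rh k m))" .
  have "(\<Sum>k<K. 2 * (\<integral>\<omega>. (\<Sum>l<k. n l \<omega>) * (H k \<omega> - H 0 \<omega>) \<partial>P))
     \<le> (\<Sum>k<K. 2 / real K * (\<Sum>l<k. v l) + real K / 2 * (?c * (\<Sum>m\<in>T. 3 * ?d k m + 3 / 2 * ?rh k m)))"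
  proof (rule sum_mono)
    fix k assume "k \<in> {..<K}"
    then have k: "k < K" by simp
    have "real K / 2 * msq (\<lambda>\<omega>. H k \<omega> - H 0 \<omega>)
      \<le> real K / 2 * (?c * (\<Sum>m\<in>T. 3 * ?d k m + 3 / 2 * ?rh k m))"
      by (intro mult_left_mono Hd_le k) simp
    with cross_le[OF k]
    show "2 * (\<integral>\<omega>. (\<Sum>l<k. n l \<omega>) * (H k \<omega> - H 0 \<omega>) \<partial>P)
      \<le> 2 / real K * (\<Sum>l<k. v l) + real K / 2 * (?c * (\<Sum>m\<in>T. 3 * ?d k m + 3 / 2 * ?rh k m))"
      by linarith
  qed
  also have "\<dots> = 2 / real K * (\<Sum>l<K. (real K - 1 - real l) * v l)
      + real K * (\<Sum>k<K. ?c * (\<Sum>m\<in>T. 3 / 2 * ?d k m + 3 / 4 * ?rh k m))"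
    unfolding sum_partial_sums[symmetric] by (simp add: sum.distrib sum_distrib_left algebra_simps)
  finally have 2: "(\<Sum>k<K. 2 * (\<integral>\<omega>. (\<Sum>l<k. n l \<omega>) * (H k \<omega> - H 0 \<omega>) \<partial>P))
     \<le> 2 / real K * (\<Sum>l<K. (real K - 1 - real l) * v l)
      + real K * (\<Sum>k<K. ?c * (\<Sum>m\<in>T. 3 / 2 * ?d k m + 3 / 4 * ?rh k m))" .
  have a: "(\<Sum>l<K. v l) + 2 / real K * (\<Sum>l<K. (real K - 1 - real l) * v l) = (\<Sum>m\<in>T. na m i)"
  proof -
    have "(\<Sum>l<K. v l) + 2 / real K * (\<Sum>l<K. (real K - 1 - real l) * v l)
        = (\<Sum>l<K. (1 + 2 / real K * (real K - 1 - real l)) * v l)"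
      unfolding distrib_right sum.distrib sum_distrib_left by (simp only: mult_1 mult.assoc)
    also have "\<dots> = (\<Sum>m\<in>T. na m i)"
      unfolding na_def v_def sum_distrib_left by (rule sum.swap)
    finally show ?thesis .
  qed
  have b: "real K * (\<Sum>k<K. ?c * (\<Sum>m\<in>T. 8 / 3 * ?p k m + 8 / 5 * ?rh k m))
     + real K * (\<Sum>k<K. ?c * (\<Sum>m\<in>T. 3 / 2 * ?d k m + 3 / 4 * ?rh k m))
     = ?c * (\<Sum>m\<in>T. nb m i)" (is "?l = ?r")
  proof -
    have "?l = real K * (\<Sum>k<K. ?c * (\<Sum>m\<in>T. 8 / 3 * ?p k m + 47 / 20 * ?rh k m
      + 3 / 2 * ?d k m))"
      unfolding distrib_left[symmetric] sum.distrib[symmetric] by (simp add: algebra_simps)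
    also have "\<dots> = ?r"
      unfolding nb_def sum_distrib_left by (subst sum.swap) (simp add: mult.left_commute)
    finally show ?thesis .
  qed
  show ?thesis using tot 1 2 unfolding a[symmetric] b[symmetric] by linarith
qed

lemma sum_msq_nth: "sq_integrable P X \<Longrightarrow> (\<Sum>i\<in>UNIV. msq (\<lambda>\<omega>. X \<omega> $ i)) = msq X" for X :: "'a \<Rightarrow> real^'d"
  unfolding msq_def norm_power2_cart
  by (subst Bochner_Integration.integral_sum) (auto intro!: sq_integrable_power2 sq_integrable_nth)

text \<open>The weights in \<open>na\<close> add up to \<open>K + (K - 1)\<close>: correlation with
  later gradients at most doubles the noise. This is the 2 in
  \<open>2 * C1 * \<sigma>\<^sup>2\<close> of the claim.\<close>

lemma sum_na_le:
  assumes m: "m \<in> {1..M}"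
  shows "(\<Sum>i\<in>UNIV. na m i) \<le> 2 * real K * \<sigma>\<^sup>2"
proof -
  have c: "0 \<le> 1 + 2 / real K * (real K - 1 - real l)" if "l < K" for l
    using that by (intro add_nonneg_nonneg mult_nonneg_nonneg) auto
  have "(\<Sum>i\<in>UNIV. na m i) = (\<Sum>l<K. (1 + 2 / real K * (real K - 1 - real l)) * msq (nz l m))"
    unfolding na_def using m nz_sq
    by (subst sum.swap) (simp add: sum_msq_nth flip: sum_distrib_left)
  also have "\<dots> \<le> (\<Sum>l<K. (1 + 2 / real K * (real K - 1 - real l)) * \<sigma>\<^sup>2)"
    using c m nz_var by (intro sum_mono mult_left_mono) auto
  also have "\<dots> = (\<Sum>l<K. 1 + 2 / real K * (real K - 1 - real l)) * \<sigma>\<^sup>2" by (simp add: sum_distrib_right)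
  also have "(\<Sum>l<K. 1 + 2 / real K * (real K - 1 - real l)) = 2 * real K - 1"
  proof -
    have 1: "(\<Sum>l<K. real K - 1 - real l) = real K * (real K - 1) / 2"
      unfolding sum_subtractf sum_nat_below by (simp add: field_simps)
    have "(\<Sum>l<K. 1 + 2 / real K * (real K - 1 - real l)) = real K + 2 / real K * (\<Sum>l<K. real K - 1 - real l)"
      by (simp only: sum.distrib sum_distrib_left) simp
    then show ?thesis using K unfolding 1 by simp
  qed
  also have "(2 * real K - 1) * \<sigma>\<^sup>2 \<le> 2 * real K * \<sigma>\<^sup>2" by (intro mult_right_mono) auto
  finally show ?thesis .
qed

lemma mean_sum_nb_le:
  "mean M (\<lambda>m. \<Sum>i\<in>UNIV. nb m i) \<le> real K * (8 / 3 * (real K * \<kappa>\<^sup>2 + SG) + 47 / 20 * SV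
     + 3 / 2 * XX * (\<sigma>\<^sup>2 / real M + SH))"
proof -
  have p: "mean M (\<lambda>m. msq (p k m)) \<le> msq (ga k) + \<kappa>\<^sup>2" if "k < K" for k
  proof -
    have "mean M (\<lambda>m. msq (kap k m)) = mean M (\<lambda>m. msq (p k m)) - msq (ga k)"
      unfolding kap_def[abs_def] ga_def[abs_def] using that by (intro mean_msq_variance[OF M] p_sq) auto
    then show ?thesis using mean_msq_kap_le[of k] that by simp
  qed
  have d: "mean M (\<lambda>m. msq (\<lambda>\<omega>. p k m \<omega> - p 0 m \<omega>)) \<le> 2 * u\<^sup>2 * (\<sigma>\<^sup>2 / real M + SH) * real k" if k: "k < K" for k
  proof -
    have "(\<Sum>i<k. msq (ah i)) \<le> SH" unfolding SH_def using k by (intro sum_mono2 msq_nonneg) auto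
    then have "u\<^sup>2 * (2 * (real k * (\<sigma>\<^sup>2 / real M)) + 2 * (real k * (\<Sum>i<k. msq (ah i))))
      \<le> u\<^sup>2 * (2 * (real k * (\<sigma>\<^sup>2 / real M)) + 2 * (real k * SH))"
      by (intro mult_left_mono add_left_mono) auto
    then show ?thesis
      using mean_msq_p_diff_le[of k] L2_xb_drift_le[of k] k by (simp add: algebra_simps)
  qed
  have "(\<Sum>i\<in>UNIV. nb m i) = real K * (\<Sum>k<K. 8 / 3 * msq (p k m) + 47 / 20 * msq (rho k m)
      + 3 / 2 * msq (\<lambda>\<omega>. p k m \<omega> - p 0 m \<omega>))" if m: "m \<in> {1..M}" for m
  proof -
    have "(\<Sum>i\<in>UNIV. nb m i) = real K * (\<Sum>k<K. 8 / 3 * (\<Sum>i\<in>UNIV. msq (\<lambda>\<omega>. p k m \<omega> $ i))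
       + 47 / 20 * (\<Sum>i\<in>UNIV. msq (\<lambda>\<omega>. rho k m \<omega> $ i))
       + 3 / 2 * (\<Sum>i\<in>UNIV. msq (\<lambda>\<omega>. (p k m \<omega> - p 0 m \<omega>) $ i)))"
      unfolding nb_def sum_distrib_left[symmetric] by (subst sum.swap) (simp add: sum.distrib sum_distrib_left)
    also have "\<dots> = real K * (\<Sum>k<K. 8 / 3 * msq (p k m) + 47 / 20 * msq (rho k m)
      + 3 / 2 * msq (\<lambda>\<omega>. p k m \<omega> - p 0 m \<omega>))"
      using m by (intro arg_cong2[of _ _ _ _ "(*)"] refl sum.cong arg_cong2[of _ _ _ _ "(+)"] sum_msq_nth
        p_sq rho_sq sq_integrable_diff) auto
    finally show ?thesis .
  qed
  then have "mean M (\<lambda>m. \<Sum>i\<in>UNIV. nb m i) = mean M (\<lambda>m. real K * (\<Sum>k<K. 8 / 3 * msq (p k m) + 47 / 20 * msq (rho k m)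
      + 3 / 2 * msq (\<lambda>\<omega>. p k m \<omega> - p 0 m \<omega>)))" by (rule mean_cong)
  also have "\<dots> = real K * (\<Sum>k<K. 8 / 3 * mean M (\<lambda>m. msq (p k m)) + 47 / 20 * mean M (\<lambda>m. msq (rho k m))
      + 3 / 2 * mean M (\<lambda>m. msq (\<lambda>\<omega>. p k m \<omega> - p 0 m \<omega>)))"
    by (simp only: mean_mult mean_sum mean_add)
  also have "\<dots> \<le> real K * (\<Sum>k<K. 8 / 3 * (msq (ga k) + \<kappa>\<^sup>2) + 47 / 20 * (L\<^sup>2 * EV k)
      + 3 / 2 * (2 * u\<^sup>2 * (\<sigma>\<^sup>2 / real M + SH) * real k))"
    using p d mean_msq_rho_le by (intro mult_left_mono sum_mono add_mono) auto
  also have "(\<Sum>k<K. 8 / 3 * (msq (ga k) + \<kappa>\<^sup>2) + 47 / 20 * (L\<^sup>2 * EV k)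
      + 3 / 2 * (2 * u\<^sup>2 * (\<sigma>\<^sup>2 / real M + SH) * real k))
     = 8 / 3 * (real K * \<kappa>\<^sup>2 + SG) + 47 / 20 * SV + 3 / 2 * (2 * u\<^sup>2 * (\<sigma>\<^sup>2 / real M + SH) * (\<Sum>k<K. real k))"
    unfolding sum.distrib SG_def SV_def sum_distrib_left[symmetric] by (simp add: add.commute)
  also have "2 * u\<^sup>2 * (\<sigma>\<^sup>2 / real M + SH) * (\<Sum>k<K. real k) = XX * (\<sigma>\<^sup>2 / real M + SH)"
    by (simp add: sum_nat_below XX_def)
  finally show ?thesis by (simp only: mult.assoc)
qed

section \<open>Descent of the objective during the local steps\<close>

text \<open>Polarization writes the inner product of \<open>ga\<close> and \<open>ah\<close> as half
  of \<open>msq (ga k) + msq (ah k) - msq (dl k)\<close> in expectation. The noise is orthogonal to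
  both vectors and survives only in the quadratic term, which also takes the share \<open>u\<close>
  of \<open>msq (ah k)\<close>.\<close>

lemma descent_step:
  fixes F :: "real^'d \<Rightarrow> real"
  assumes F: "\<And>y. GDERIV F y :> mean M (\<lambda>m. gf m y)"
    and G: "L-lipschitz_on UNIV (\<lambda>y. mean M (\<lambda>m. gf m y))" and b: "\<And>y. c \<le> F y" and k: "k < K"
  shows "(\<integral>\<omega>. F (xb (Suc k) \<omega>) \<partial>P) \<le> (\<integral>\<omega>. F (xb k \<omega>) \<partial>P)
    - \<gamma> / 2 * (msq (ga k) + (1 - u) * msq (ah k) - msq (dl k)) + L * \<gamma>\<^sup>2 / 2 * (\<sigma>\<^sup>2 / real M)"
proof -
  note iF = integrable_smooth[OF F G b]
  have s: "sq_integrable P (ga k)" "sq_integrable P (ah k)" "sq_integrable P (an k)" "sq_integrable P (dl k)"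
    using k by (auto intro: ga_sq ah_sq an_sq dl_sq)
  have an_ah: "(\<integral>\<omega>. an k \<omega> \<bullet> ah k \<omega> \<partial>P) = 0" and an_ga: "(\<integral>\<omega>. an k \<omega> \<bullet> ga k \<omega> \<partial>P) = 0"
    using k by (auto intro!: an_orth past_measurable s)
  have "F (xb (Suc k) \<omega>) \<le> F (xb k \<omega>) + (L * \<gamma>\<^sup>2 / 2 * (norm (ah k \<omega> + an k \<omega>))\<^sup>2 - \<gamma> * (ga k \<omega> \<bullet> ah k \<omega> + an k \<omega> \<bullet> ga k \<omega>))"
    if "\<omega> \<in> space P" for \<omega>
  proof -
    let ?v = "ah k \<omega> + an k \<omega>"
    have e1: "mean M (\<lambda>m. gf m (xb k \<omega>)) = ga k \<omega>" by (simp add: ga_def p_def)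
    have e2: "xb k \<omega> + - \<gamma> *\<^sub>R ?v = xb (Suc k) \<omega>" using xb_Suc[OF k that] by simp
    have e3: "(norm (- \<gamma> *\<^sub>R ?v))\<^sup>2 = \<gamma>\<^sup>2 * (norm ?v)\<^sup>2"
      unfolding norm_scaleR by (simp add: power_mult_distrib)
    have e4: "ga k \<omega> \<bullet> (- \<gamma> *\<^sub>R ?v) = - \<gamma> * (ga k \<omega> \<bullet> ah k \<omega> + an k \<omega> \<bullet> ga k \<omega>)"
      by (simp add: inner_add_right inner_commute)
    have "F (xb (Suc k) \<omega>) \<le> F (xb k \<omega>) + - \<gamma> * (ga k \<omega> \<bullet> ah k \<omega> + an k \<omega> \<bullet> ga k \<omega>)
        + L / 2 * (\<gamma>\<^sup>2 * (norm ?v)\<^sup>2)"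
      using lipschitz_gradient_descent[OF F G, of "xb k \<omega>" "- \<gamma> *\<^sub>R ?v"] unfolding e1 e2 e3 e4 .
    then show ?thesis by (simp add: algebra_simps)
  qed
  then have "(\<integral>\<omega>. F (xb (Suc k) \<omega>) \<partial>P)
      \<le> (\<integral>\<omega>. F (xb k \<omega>) + (L * \<gamma>\<^sup>2 / 2 * (norm (ah k \<omega> + an k \<omega>))\<^sup>2 - \<gamma> * (ga k \<omega> \<bullet> ah k \<omega> + an k \<omega> \<bullet> ga k \<omega>)) \<partial>P)"
    using k s by (intro integral_mono) (auto intro!: iF xb_sq sq_integrable_norm sq_integrable_add sq_integrable_inner
        Bochner_Integration.integrable_add Bochner_Integration.integrable_diff integrable_mult_right)
  also have "\<dots> = (\<integral>\<omega>. F (xb k \<omega>) \<partial>P) + (L * \<gamma>\<^sup>2 / 2 * msq (\<lambda>\<omega>. ah k \<omega> + an k \<omega>)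
      - \<gamma> * (\<integral>\<omega>. ga k \<omega> \<bullet> ah k \<omega> \<partial>P))"
    using iF[OF xb_sq[of k]] sq_integrable_norm[OF sq_integrable_add[OF s(2,3)]] sq_integrable_inner[OF s(1,2)]
      sq_integrable_inner[OF s(3,1)] k an_ga by (simp add: msq_def)
  also have "msq (\<lambda>\<omega>. ah k \<omega> + an k \<omega>) = msq (ah k) + msq (an k)"
    using msq_add[OF s(2,3)] an_ah by (simp add: inner_commute)
  also have "(\<integral>\<omega>. ga k \<omega> \<bullet> ah k \<omega> \<partial>P) = (msq (ga k) + msq (ah k) - msq (dl k)) / 2"
  proof -
    have "msq (ah k) = msq (\<lambda>\<omega>. dl k \<omega> + ga k \<omega>)" by (simp add: dl_def)
    also have "\<dots> = msq (dl k) + msq (ga k) + 2 * (\<integral>\<omega>. dl k \<omega> \<bullet> ga k \<omega> \<partial>P)" by (rule msq_add[OF s(4,1)])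
    also have "(\<integral>\<omega>. dl k \<omega> \<bullet> ga k \<omega> \<partial>P) = (\<integral>\<omega>. ga k \<omega> \<bullet> ah k \<omega> \<partial>P) - msq (ga k)"
    proof -
      have "dl k \<omega> \<bullet> ga k \<omega> = ga k \<omega> \<bullet> ah k \<omega> - (norm (ga k \<omega>))\<^sup>2" for \<omega>
        unfolding dl_def inner_diff_left power2_norm_eq_inner by (simp add: inner_commute)
      then show ?thesis
        using sq_integrable_inner[OF s(1,2)] sq_integrable_norm[OF s(1)] by (simp add: msq_def)
    qed
    finally show ?thesis by simp
  qed
  finally have "(\<integral>\<omega>. F (xb (Suc k) \<omega>) \<partial>P) \<le> (\<integral>\<omega>. F (xb k \<omega>) \<partial>P)
      + (L * \<gamma>\<^sup>2 / 2 * (msq (ah k) + msq (an k)) - \<gamma> * ((msq (ga k) + msq (ah k) - msq (dl k)) / 2))" .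
  moreover have "L * \<gamma>\<^sup>2 / 2 * msq (an k) \<le> L * \<gamma>\<^sup>2 / 2 * (\<sigma>\<^sup>2 / real M)"
    using k L mean_nz_le by (intro mult_left_mono) (auto simp: msq_an divide_right_mono)
  ultimately show ?thesis
    by (simp add: u_def power2_eq_square algebra_simps add_divide_distrib diff_divide_distrib)
qed

lemma descent_local:
  fixes F :: "real^'d \<Rightarrow> real"
  assumes F: "\<And>y. GDERIV F y :> mean M (\<lambda>m. gf m y)"
    and G: "L-lipschitz_on UNIV (\<lambda>y. mean M (\<lambda>m. gf m y))" and b: "\<And>y. c \<le> F y"
  shows "(\<integral>\<omega>. F (xb K \<omega>) \<partial>P) \<le> (\<integral>\<omega>. F (xb 0 \<omega>) \<partial>P)
    - \<gamma> / 2 * (SG + (1 - u) * SH - SD) + real K * (L * \<gamma>\<^sup>2 / 2 * (\<sigma>\<^sup>2 / real M))"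
proof -
  have all: "(\<integral>\<omega>. F (xb k \<omega>) \<partial>P) \<le> (\<integral>\<omega>. F (xb 0 \<omega>) \<partial>P)
    - (\<Sum>j<k. \<gamma> / 2 * (msq (ga j) + (1 - u) * msq (ah j) - msq (dl j))) + real k * (L * \<gamma>\<^sup>2 / 2 * (\<sigma>\<^sup>2 / real M))"
    if "k \<le> K" for k
    using that
  proof (induction k)
    case (Suc k)
    then have k: "k \<le> K" "k < K" by auto
    show ?case using Suc.IH[OF k(1)] descent_step[OF F G b k(2)]
      by (simp only: sum.lessThan_Suc of_nat_Suc distrib_right mult_1)
  qed simp
  have "(\<Sum>j<K. \<gamma> / 2 * (msq (ga j) + (1 - u) * msq (ah j) - msq (dl j)))
      = \<gamma> / 2 * (SG + (1 - u) * SH - SD)"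
    unfolding SG_def SH_def SD_def sum_distrib_left[symmetric] sum_subtractf sum.distrib ..
  then show ?thesis using all[OF le_refl] by (simp only:)
qed

end

section \<open>Numerical constants\<close>

lemma geometric_weight_sum:
  fixes q :: real
  shows "(\<Sum>t<M. q * (1 + q) ^ (M - 1 - t)) = (1 + q) ^ M - 1"
proof (induction M)
  case (Suc M)
  have "(\<Sum>t<Suc M. q * (1 + q) ^ (Suc M - 1 - t)) = (\<Sum>t<M. (1 + q) * (q * (1 + q) ^ (M - 1 - t))) + q"
    by (auto intro!: sum.cong simp: algebra_simps Suc_diff_Suc simp flip: power_Suc)
  also have "\<dots> = (1 + q) ^ Suc M - 1"
    by (subst sum_distrib_left[symmetric], subst Suc) (simp add: algebra_simps)
  finally show ?case .
qed simp

lemma geometric_weight_sum_linear: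
  fixes q :: real
  shows "(\<Sum>t<M. q * (1 + q) ^ (M - 1 - t) * (real t + 1)) = (\<Sum>i<M. (1 + q) ^ Suc i) - real M"
proof (induction M)
  case (Suc M)
  have "(\<Sum>t<Suc M. q * (1 + q) ^ (Suc M - 1 - t) * (real t + 1))
      = (\<Sum>t<M. (1 + q) * (q * (1 + q) ^ (M - 1 - t) * (real t + 1))) + q * (real M + 1)"
    by (auto intro!: sum.cong simp: algebra_simps Suc_diff_Suc simp flip: power_Suc)
  also have "\<dots> = (\<Sum>i<M. (1 + q) ^ Suc (Suc i)) - (1 + q) * real M + q * (real M + 1)"
    by (subst sum_distrib_left[symmetric], subst Suc) (simp add: right_diff_distrib sum_distrib_left mult.assoc)
  also have "\<dots> = (\<Sum>i<Suc M. (1 + q) ^ Suc i) - real (Suc M)"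
    by (subst sum.lessThan_Suc_shift) (simp add: algebra_simps)
  finally show ?case .
qed simp

text \<open>The quadratic lower bound of \<open>exp q\<close> raised to the power \<open>M\<close>,
  keeping the first two terms of the binomial expansion in \<open>q^2 / 2\<close>. The second term
  is what carries \<open>noise_weight_le_three_quarters\<close>.\<close>

lemma exp_mult_ge_power:
  fixes q :: real
  assumes "q \<ge> 0"
  shows "exp (real M * q) \<ge> (1 + q) ^ M + real M * q\<^sup>2 / 2 * (1 + q) ^ (M - 1)"
proof -
  have "(1 + q) ^ M + real M * q\<^sup>2 / 2 * (1 + q) ^ (M - 1) \<le> (1 + q + q\<^sup>2 / 2) ^ M"
  proof (induction M)
    case (Suc M)
    have "(1 + q) ^ Suc M + real (Suc M) * q\<^sup>2 / 2 * (1 + q) ^ (Suc M - 1)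
        \<le> ((1 + q) ^ M + real M * q\<^sup>2 / 2 * (1 + q) ^ (M - 1)) * (1 + q + q\<^sup>2 / 2)"
    proof -
      have "q\<^sup>2 * (real M * (1 + q) ^ (M - 1) * (1 + q)) = q\<^sup>2 * (real M * (1 + q) ^ M)"
        by (cases M) auto
      moreover have "0 \<le> real M * q\<^sup>2 / 2 * (1 + q) ^ (M - 1) * (q\<^sup>2 / 2)"
        using assms by simp
      ultimately show ?thesis by (simp add: algebra_simps)
    qed
    also have "\<dots> \<le> (1 + q + q\<^sup>2 / 2) ^ M * (1 + q + q\<^sup>2 / 2)"
      using Suc assms by (intro mult_right_mono) auto
    finally show ?case by (simp add: mult.commute)
  qed simp
  also have "\<dots> \<le> exp q ^ M"
    using exp_lower_Taylor_quadratic[OF assms] assms by (intro power_mono) auto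
  finally show ?thesis by (simp add: exp_of_nat_mult)
qed

text \<open>The exponential dominates the power, and each of the \<open>M - 1\<close> summands is at
  least 1.\<close>

lemma noise_weight_le:
  fixes q :: real
  assumes "q \<ge> 0" "M \<ge> 1"
  shows "(1 + q) ^ M - 1 \<le> exp (real M * q) + (\<Sum>i<M - 1. (1 + q) ^ i) - real M"
proof -
  have "(\<Sum>i<M - 1. 1) \<le> (\<Sum>i<M - 1. (1 + q) ^ i)"
    using assms by (intro sum_mono) (simp add: one_le_power)
  moreover have "0 \<le> real M * q\<^sup>2 / 2 * (1 + q) ^ (M - 1)" using assms by simp
  ultimately show ?thesis
    using exp_mult_ge_power[OF assms(1), of M] assms(2) by (simp add: of_nat_diff)
qed

text \<open>To first order in \<open>q\<close> the claim reads
  \<open>M \<le> 3/4 * (M + (M - 1) * (M - 2) / 2)\<close>. This is an equality at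
  \<open>M = 3\<close> and false for \<open>M = 1\<close> and \<open>M = 2\<close>, which explains
  both the constant and the start of the induction.\<close>

lemma noise_weight_le_three_quarters:
  fixes q :: real
  assumes "q \<ge> 0" "M \<ge> 3"
  shows "(1 + q) ^ M - 1 \<le> 3 / 4 * (exp (real M * q) + (\<Sum>i<M - 1. (1 + q) ^ i) - real M)"
proof -
  have "(1 + q) ^ M - 4 + 3 * real M
      \<le> 3 * (\<Sum>i<M - 1. (1 + q) ^ i) + 3 / 2 * real M * q\<^sup>2 * (1 + q) ^ (M - 1)"
    using assms(2)
  proof (induction M rule: dec_induct)
    case base
    have "(1 + q)^3 - 1 \<le> 3 * q + 9 / 2 * q\<^sup>2 * (1 + q)\<^sup>2"
      using assms(1) by (simp add: power2_eq_square power3_eq_cube algebra_simps)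
    then show ?case by (simp add: numeral_2_eq_2 algebra_simps)
  next
    case (step M)
    define y where "y = (1 + q) ^ (M - 1)"
    have y1: "(1 + q)\<^sup>2 \<le> y"
      unfolding y_def using step.hyps assms(1) by (intro power_increasing) auto
    have xM: "(1 + q) ^ M = (1 + q) * y" "(1 + q) ^ Suc M = (1 + q)\<^sup>2 * y"
      using step.hyps unfolding y_def by (cases M; simp add: power2_eq_square)+
    have sum: "(\<Sum>i<Suc M - 1. (1 + q) ^ i) = (\<Sum>i<M - 1. (1 + q) ^ i) + y"
      using step.hyps unfolding y_def by (cases M) auto
    have "1 \<le> y" using y1 one_le_power[of "1 + q" 2] assms(1) by linarith
    \<comment> \<open>The increment of the claim from \<open>M\<close> to \<open>M + 1\<close>, with
      the factor \<open>M + 1\<close> lowered to 4, its least value.\<close>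
    have "(q + q\<^sup>2) * y + 3 \<le> 3 * y + 3 / 2 * q\<^sup>2 * (1 + 4 * q) * y"
    proof -
      have "3 \<le> (3 + 3 / 2 * q\<^sup>2 * (1 + 4 * q) - (q + q\<^sup>2)) * y"
      proof (cases "3 + 3 / 2 * q\<^sup>2 * (1 + 4 * q) - (q + q\<^sup>2) \<ge> 0")
        case True
        have "0 \<le> q * (5 + 3 / 2 * q + 6 * q\<^sup>2 + 25 / 2 * q ^ 3 + 6 * q ^ 4)"
          using assms(1) by simp
        moreover have "(3 + 3 / 2 * q\<^sup>2 * (1 + 4 * q) - (q + q\<^sup>2)) * (1 + q)\<^sup>2 - 3
            = q * (5 + 3 / 2 * q + 6 * q\<^sup>2 + 25 / 2 * q ^ 3 + 6 * q ^ 4)"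
          by (simp add: power2_eq_square power3_eq_cube power4_eq_xxxx field_simps)
        ultimately have "3 \<le> (3 + 3 / 2 * q\<^sup>2 * (1 + 4 * q) - (q + q\<^sup>2)) * (1 + q)\<^sup>2"
          by linarith
        also have "\<dots> \<le> (3 + 3 / 2 * q\<^sup>2 * (1 + 4 * q) - (q + q\<^sup>2)) * y"
          using y1 True by (rule mult_left_mono)
        finally show ?thesis .
      next
        \<comment> \<open>This case is void: the coefficient equals
          \<open>3 - q + q^2 / 2 + 6 * q^3\<close>, which is nonnegative.\<close>
        case False
        have "q \<le> 3 + q * q * q * 6"
        proof (cases "q \<le> 1")
          case False
          then have "1 * 1 \<le> q * q" by (intro mult_mono) auto
          then have "1 * q \<le> q * q * q" using False by (intro mult_right_mono) auto
          with False show ?thesis by linarith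
        next
          case True
          have "0 \<le> q * q * q" using assms(1) by simp
          with True show ?thesis by linarith
        qed
        moreover have "0 \<le> q * q" by simp
        moreover have "3 + 3 / 2 * q\<^sup>2 * (1 + 4 * q) - (q + q\<^sup>2) = (3 + q * q * q * 6 - q) + q * q / 2"
          by (simp add: power2_eq_square field_simps)
        ultimately have "3 + 3 / 2 * q\<^sup>2 * (1 + 4 * q) - (q + q\<^sup>2) \<ge> 0"
          by linarith
        with False show ?thesis by simp
      qed
      then show ?thesis by (simp add: algebra_simps)
    qed
    moreover have "3 / 2 * q\<^sup>2 * (1 + 4 * q) * y \<le> 3 / 2 * q\<^sup>2 * (1 + (real M + 1) * q) * y"
      using \<open>1 \<le> y\<close> assms(1) step.hyps by (intro mult_right_mono mult_left_mono add_left_mono) auto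
    ultimately have "(q + q\<^sup>2) * y + 3 \<le> 3 * y + 3 / 2 * q\<^sup>2 * (1 + (real M + 1) * q) * y"
      by linarith
    moreover have "(1 + q) * y - 4 + 3 * real M \<le> 3 * (\<Sum>i<M - 1. (1 + q) ^ i) + 3 / 2 * real M * q\<^sup>2 * y"
      using step.IH unfolding xM(1) y_def[symmetric] .
    ultimately have "(1 + q)\<^sup>2 * y - 4 + 3 * (real M + 1)
        \<le> 3 * ((\<Sum>i<M - 1. (1 + q) ^ i) + y) + 3 / 2 * (real M + 1) * q\<^sup>2 * ((1 + q) * y)"
      by (simp add: power2_eq_square field_simps)
    moreover have "(1 + q) ^ (Suc M - 1) = (1 + q) * y" using xM(1) by simp
    ultimately show ?case unfolding sum xM(2) by (simp only: of_nat_Suc add.commute)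
  qed
  then show ?thesis using exp_mult_ge_power[OF assms(1), of M] by (simp add: algebra_simps)
qed

text \<open>With \<open>x = 1 + q\<close> the increment of the induction is
  \<open>1 \<le> (x^2 - 3 * x + 3) * y\<close>, which follows from \<open>y \<ge> x\<close> and
  \<open>(x^2 - 3 * x + 3) * x = 1 + (x - 1)^3\<close>. Since \<open>y = x ^ (M - 1)\<close>, this
  starts at \<open>M = 2\<close>. The ratio 3/2 cannot be lowered: for \<open>M = 2\<close> and
  \<open>M = 3\<close> both sides agree to first order in \<open>q\<close>.\<close>

lemma drift_weight_le:
  fixes q :: real
  assumes "q \<ge> 0" "M \<ge> 1"
  shows "2 * ((\<Sum>i<M. (1 + q) ^ Suc i) - real M)
    \<le> 3 * (exp (real M * q) + (\<Sum>i<M - 1. (1 + q) ^ i) - real M)"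
proof -
  have "2 * (\<Sum>i<M. (1 + q) ^ Suc i) + real M \<le> 3 * (1 + q) ^ M + 3 * (\<Sum>i<M - 1. (1 + q) ^ i)"
  proof (cases "M = 1")
    case True
    then show ?thesis using assms by simp
  next
    case False
    with assms(2) have "2 \<le> M" by simp
    then show ?thesis
  proof (induction M rule: dec_induct)
    case base
    have "0 \<le> q\<^sup>2" by simp
    then show ?case by (simp add: numeral_2_eq_2 algebra_simps)
  next
    case (step M)
    define y where "y = (1 + q) ^ (M - 1)"
    have xM: "(1 + q) ^ M = (1 + q) * y" "(1 + q) ^ Suc M = (1 + q)\<^sup>2 * y"
      using step.hyps unfolding y_def by (cases M; simp add: power2_eq_square)+
    have sum: "(\<Sum>i<Suc M - 1. (1 + q) ^ i) = (\<Sum>i<M - 1. (1 + q) ^ i) + y"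
      using step.hyps unfolding y_def by (cases M) auto
    have "1 \<le> ((1 + q)\<^sup>2 - 3 * (1 + q) + 3) * y"
    proof -
      have "1 + q \<le> y" unfolding y_def using step.hyps assms(1)
          power_increasing[of 1 "M - 1" "1 + q"] by simp
      have nn: "(1 + q)\<^sup>2 - 3 * (1 + q) + 3 \<ge> 0" 
        using zero_le_power2[of "q - 1/2"] by (simp add: power2_eq_square algebra_simps)
      have "1 \<le> ((1 + q)\<^sup>2 - 3 * (1 + q) + 3) * (1 + q)"
        using assms(1) by (simp add: power2_eq_square algebra_simps)
      also have "\<dots> \<le> ((1 + q)\<^sup>2 - 3 * (1 + q) + 3) * y"
        using \<open>1 + q \<le> y\<close> nn by (rule mult_left_mono)
      finally show ?thesis .
    qed
    with step.IH show ?case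
      unfolding sum by (simp only: xM sum.lessThan_Suc) (simp add: power2_eq_square algebra_simps)
  qed
  qed
  moreover have "0 \<le> real M * q\<^sup>2 / 2 * (1 + q) ^ (M - 1)" using assms by simp
  ultimately show ?thesis
    using exp_mult_ge_power[OF assms(1), of M] by (simp add: algebra_simps)
qed

text \<open>
  The bound with \<open>3/4\<close> is what makes up for the factor \<open>3/2\<close> when \<open>M \<ge> 3\<close>; for \<open>M \<le> 2\<close> the factor
  \<open>1 - 1 / M\<close> in the deviation of the workers does.
\<close>

lemma quantization_weights_le:
  fixes a :: real
  assumes "a > 0" "M \<ge> 1" and q: "q = a / real M"
    and C1: "C1 = 1 / real M * exp a + 1 / a * (q + 1) ^ (M - 1) - (1 / a + 1)"
  shows "((1 + q) ^ M - 1) / real M \<le> C1"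
    and "M \<ge> 3 \<Longrightarrow> ((1 + q) ^ M - 1) / real M \<le> 3 / 4 * C1"
    and "(\<Sum>t<M. q * (1 + q) ^ (M - 1 - t) * (real t + 1)) / real M \<le> 3 / 2 * C1"
    and "C1 \<ge> 0"
proof -
  have M: "real M > 0" using assms by simp
  have q0: "q > 0" using q \<open>a > 0\<close> M by simp
  have a: "a = real M * q" using q M by simp
  \<comment> \<open>The two terms of \<open>C1\<close> with \<open>1 / a\<close> combine to a
    geometric sum, which removes the division by \<open>q\<close>.\<close>
  have "(\<Sum>i<M - 1. (1 + q) ^ i) = ((1 + q) ^ (M - 1) - 1) / q"
    using q0 by (subst geometric_sum) auto
  then have "(q + 1) ^ (M - 1) = 1 + q * (\<Sum>i<M - 1. (1 + q) ^ i)"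
    using q0 by (simp add: add.commute)
  then have C: "C1 = (exp (real M * q) + (\<Sum>i<M - 1. (1 + q) ^ i) - real M) / real M"
    unfolding C1 a using M q0 by (simp add: add_divide_distrib diff_divide_distrib distrib_left)
  show 1: "((1 + q) ^ M - 1) / real M \<le> C1"
    unfolding C using noise_weight_le[of q M] q0 assms(2) by (intro divide_right_mono) auto
  show "((1 + q) ^ M - 1) / real M \<le> 3 / 4 * C1" if "M \<ge> 3"
    unfolding C times_divide_eq_right
    using noise_weight_le_three_quarters[of q M] q0 that by (intro divide_right_mono) auto
  show "(\<Sum>t<M. q * (1 + q) ^ (M - 1 - t) * (real t + 1)) / real M \<le> 3 / 2 * C1"
    unfolding C geometric_weight_sum_linear times_divide_eq_right
    using drift_weight_le[of q M] q0 assms(2) by (intro divide_right_mono) auto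
  have "0 \<le> ((1 + q) ^ M - 1) / real M" using q0 by (simp add: one_le_power)
  with 1 show "C1 \<ge> 0" by linarith
qed

text \<open>The fractions are those produced by the Young inequalities for the local drift.\<close>

lemma quantization_budget:
  fixes X Dd s2 k2 Sg SH SV C1 bN B Kr :: real
  assumes M: "M \<ge> 1"
    and bN: "bN \<le> C1" "M \<ge> 3 \<Longrightarrow> bN \<le> 3 / 4 * C1" and B: "B \<le> 3 / 2 * C1" and C1: "C1 \<ge> 0"
    and nn: "X \<ge> 0" "s2 \<ge> 0" "k2 \<ge> 0" "Sg \<ge> 0" "SH \<ge> 0" "SV \<ge> 0" "Kr \<ge> 0"
    and Dd: "Dd < 1" "2 * X \<le> 1 - Dd" "Dd \<le> 2 * X" "X = 0 \<or> Dd \<ge> 0"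
    and SV: "(1 - Dd) * SV \<le> 5 / 3 * (X * s2 * (1 - 1 / real M) / 2 + Kr * X * k2 / 3)
          + 5 / 6 * Dd * X * (s2 / real M + SH)"
    and Z: "Z = X / (1 - Dd) * (s2 * (1 + 1 / real M) / 2 + 2 * Kr * k2 + 2 * Sg + SH)"
  shows "2 * bN * s2 + B * (8 / 3 * (Kr * k2 + Sg) + 47 / 20 * SV + 3 / 2 * X * (s2 / real M + SH))
    \<le> C1 * (2 * s2 + 4 * Kr * k2 + 4 * Sg + 4 * Z)"
proof -
  define m where "m = 1 / real M"
  define Y where "Y = X / (1 - Dd)"
  \<comment> \<open>The share of \<open>C1\<close> that the noise uses. For \<open>M \<ge> 3\<close>
    it leaves \<open>s2 / 2\<close> spare, enough for \<open>Y * s2\<close> because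
    \<open>Y \<le> 1/2\<close>.\<close>
  define \<nu> where "\<nu> = (if M \<ge> 3 then 3 / 4 else 1 :: real)"
  have D1: "1 - Dd > 0" using Dd by simp
  have Y: "0 \<le> Y" "Y \<le> 1 / 2" "X = Y * (1 - Dd)"
    using D1 nn Dd unfolding Y_def by (auto simp: field_simps)
  have m: "0 \<le> m" "m \<le> 1" using M unfolding m_def by auto
  define w where "w = s2 * m + SH"
  have w: "0 \<le> w" using nn m by (simp add: w_def)
  have SVY: "SV \<le> 5 / 6 * (Y * s2) - 5 / 6 * (Y * (m * s2)) + 5 / 9 * (Y * (Kr * k2)) + 5 / 6 * (Y * Dd * w)"
    (is "SV \<le> ?r")
  proof -
    have "(1 - Dd) * SV \<le> 5 / 3 * (X * s2 * (1 - m) / 2 + Kr * X * k2 / 3) + 5 / 6 * Dd * X * w"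
      using SV unfolding m_def w_def by simp
    also have "\<dots> = (1 - Dd) * ?r"
      unfolding Y(3) by (simp add: field_simps)
    finally show ?thesis using D1 by (simp only: mult_le_cancel_left_pos)
  qed
  have YD: "0 \<le> Y * Dd" "Y * Dd \<le> Y / 2"
  proof -
    show "0 \<le> Y * Dd" 
    proof (cases "X = 0")
      case True
      then show ?thesis by (simp add: Y_def)
    next
      case False
      then show ?thesis using Dd(4) Y(1) by simp
    qed
    \<comment> \<open>Combining \<open>Dd \<le> 2 * X\<close> with
      \<open>2 * X \<le> 1 - Dd\<close>.\<close>
    have "Dd \<le> 1 / 2" using Dd by linarith
    then show "Y * Dd \<le> Y / 2" using mult_left_mono[of Dd "1/2" Y] Y by simp
  qed
  \<comment> \<open>The terms with \<open>Dd\<close> have total coefficient 11/16, halved by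
    \<open>Y * Dd \<le> Y / 2\<close>; then 9/4 + 11/32 = 83/32 is rounded up to 13/5.\<close>
  have W: "47 / 16 * (Y * Dd * w) + 9 / 4 * (Y * w) - 9 / 4 * (Y * Dd * w) \<le> 13 / 5 * (Y * w)"
  proof -
    have "Y * Dd * w \<le> Y * w / 2" "0 \<le> Y * Dd * w"
      using mult_right_mono[OF YD(2) w] mult_right_mono[OF YD(1) w] by auto
    then show ?thesis by linarith
  qed
  have noise: "2 * \<nu> * s2 + Y * s2 * (47 / 16 * (1 - m) + 13 / 5 * m) \<le> 2 * s2 + 2 * Y * s2 * (1 + m)"
  proof -
    \<comment> \<open>For \<open>M = 1\<close> the comparison of the coefficients of
      \<open>Y\<close> is 13/5 against 4, for \<open>M = 2\<close> it is 47/32 + 13/10 against 3;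
      for larger \<open>M\<close> the reserve in \<open>\<nu>\<close> is needed.\<close>
    consider "M = 1" | "M = 2" | "M \<ge> 3" using M by linarith
    then have "2 * \<nu> + Y * (47 / 16 * (1 - m) + 13 / 5 * m) \<le> 2 + Y * (2 * (1 + m))"
    proof cases
      case 3
      have "Y * (47 / 16 * (1 - m) + 13 / 5 * m) \<le> Y * (1 + 2 * (1 + m))"
      proof (rule mult_left_mono)
        show "47 / 16 * (1 - m) + 13 / 5 * m \<le> 1 + 2 * (1 + m)"
          using m(1) by (simp add: algebra_simps diff_divide_distrib add_divide_distrib)
      qed (use Y in simp)
      then show ?thesis using 3 Y by (simp add: \<nu>_def algebra_simps)
    qed (use Y in \<open>auto simp: \<nu>_def m_def algebra_simps\<close>)
    then have "s2 * (2 * \<nu> + Y * (47 / 16 * (1 - m) + 13 / 5 * m)) \<le> s2 * (2 + Y * (2 * (1 + m)))"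
      using nn by (intro mult_left_mono) auto
    then show ?thesis by (simp add: algebra_simps)
  qed
  let ?br = "8 / 3 * (Kr * k2 + Sg) + 47 / 20 * SV + 3 / 2 * X * (s2 / real M + SH)"
  have "2 * bN * s2 + B * ?br \<le> 2 * (\<nu> * C1) * s2 + 3 / 2 * C1 * ?br"
    using bN B nn by (intro add_mono mult_right_mono) (auto simp: \<nu>_def)
  also have "\<dots> = C1 * (2 * \<nu> * s2 + 3 / 2 * ?br)" by (simp add: algebra_simps)
  also have "\<dots> \<le> C1 * (2 * s2 + 4 * Kr * k2 + 4 * Sg + 4 * Z)"
  proof (rule mult_left_mono[OF _ C1])
    have s: "0 \<le> Y * Kr * k2" "0 \<le> Y * Sg" "0 \<le> Y * SH" using Y nn by auto
    have "X * (s2 / real M + SH) = Y * w - Y * Dd * w"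
      unfolding w_def m_def Y(3) by (simp add: algebra_simps)
    \<comment> \<open>Here 3/2 * 8/3 = 4 meets the available coefficients of \<open>Kr * k2\<close>
      and \<open>Sg\<close> exactly, so all the remaining terms must be paid by \<open>Z\<close> and
      the noise reserve.\<close>
    moreover have "3 / 2 * ?br = 4 * (Kr * k2) + 4 * Sg + 141 / 40 * SV + 9 / 4 * (X * (s2 / real M + SH))"
      by (simp add: algebra_simps add_divide_distrib)
    ultimately have "3 / 2 * ?br = 4 * (Kr * k2) + 4 * Sg + 141 / 40 * SV + 9 / 4 * (Y * w) - 9 / 4 * (Y * Dd * w)"
      by linarith
    with SVY W have "3 / 2 * ?br \<le> 4 * (Kr * k2) + 4 * Sg
        + (47 / 16 * (Y * s2) - 47 / 16 * (Y * (m * s2)) + 47 / 24 * (Y * (Kr * k2))) + 13 / 5 * (Y * w)"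
      by linarith
    moreover have "Y * w = Y * (m * s2) + Y * SH" by (simp add: w_def algebra_simps)
    moreover have "4 * Z = 2 * (Y * s2) + 2 * (Y * (m * s2)) + 8 * (Y * (Kr * k2)) + 8 * (Y * Sg) + 4 * (Y * SH)"
      unfolding Z Y_def[symmetric] m_def[symmetric] by (simp add: field_simps)
    moreover have "2 * \<nu> * s2 + (47 / 16 * (Y * s2) - 47 / 16 * (Y * (m * s2))) + 13 / 5 * (Y * (m * s2))
        \<le> 2 * s2 + 2 * (Y * s2) + 2 * (Y * (m * s2))"
      using noise by (simp add: field_simps)
    moreover have "0 \<le> Y * (Kr * k2)" using s(1) by (simp add: mult.assoc)
    ultimately show "2 * \<nu> * s2 + 3 / 2 * ?br \<le> 2 * s2 + 4 * Kr * k2 + 4 * Sg + 4 * Z"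
      using s by linarith
  qed
  finally show ?thesis .
qed

lemma lipschitz_on_mean:
  fixes G :: "nat \<Rightarrow> 'a::metric_space \<Rightarrow> 'b::real_normed_vector"
  assumes M: "M \<ge> 1" and G: "\<And>m. m \<in> {1..M} \<Longrightarrow> L-lipschitz_on S (G m)"
  shows "L-lipschitz_on S (\<lambda>y. mean M (\<lambda>m. G m y))"
proof (rule lipschitz_onI)
  show "0 \<le> L" using lipschitz_on_nonneg[OF G[of 1]] M by simp
  fix y z assume yz: "y \<in> S" "z \<in> S"
  have "dist (mean M (\<lambda>m. G m y)) (mean M (\<lambda>m. G m z)) = norm (\<Sum>m=1..M. G m y - G m z) / real M"
    unfolding dist_norm mean_def sum_subtractf by (simp add: scaleR_diff_right[symmetric])
  also have "\<dots> \<le> (\<Sum>m=1..M. L * dist y z) / real M"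
    using lipschitz_onD[OF G yz] by (intro divide_right_mono sum_norm_le) (auto simp: dist_norm)
  also have "\<dots> = L * dist y z" using M by simp
  finally show "dist (mean M (\<lambda>m. G m y)) (mean M (\<lambda>m. G m z)) \<le> L * dist y z" .
qed

section \<open>Segments and the ring\<close>

definition seg_set :: "nat \<Rightarrow> ('d::finite \<Rightarrow> nat) \<Rightarrow> nat \<Rightarrow> 'd set" where
  "seg_set M pos j = {i. (j - 1) * (CARD('d) div M) < pos i \<and> pos i \<le> j * (CARD('d) div M)}"

lemma segment_nth: "segment M pos j v $ i = (if i \<in> seg_set M pos j then v $ i else 0)"
  by (simp add: segment_def seg_set_def Let_def)

lemma card_seg_set:
  fixes pos :: "'d::finite \<Rightarrow> nat"
  assumes pos: "bij_betw pos UNIV {1..CARD('d)}" and M: "M dvd CARD('d)" and j: "j \<in> {1..M}"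
  shows "card (seg_set M pos j) = CARD('d) div M"
proof -
  let ?p = "CARD('d) div M"
  have "pos ` seg_set M pos j = {(j - 1) * ?p <.. j * ?p}"
  proof
    show "pos ` seg_set M pos j \<subseteq> {(j - 1) * ?p <.. j * ?p}" by (auto simp: seg_set_def)
    show "{(j - 1) * ?p <.. j * ?p} \<subseteq> pos ` seg_set M pos j"
    proof
      fix n assume n: "n \<in> {(j - 1) * ?p <.. j * ?p}"
      have "j * ?p \<le> M * ?p" using j by (intro mult_right_mono) auto
      also have "\<dots> = CARD('d)" using M by simp
      finally have "n \<in> {1..CARD('d)}" using n by auto
      then have "n \<in> range pos" using pos unfolding bij_betw_def by simp
      then obtain i where "pos i = n" by blast
      then show "n \<in> pos ` seg_set M pos j" using n by (auto simp: seg_set_def)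
    qed
  qed
  moreover have "inj_on pos (seg_set M pos j)"
    using pos unfolding bij_betw_def by (meson inj_on_subset subset_UNIV)
  ultimately have "card (seg_set M pos j) = card {(j - 1) * ?p <.. j * ?p}"
    by (metis card_image)
  also have "\<dots> = ?p" using j by (cases j) auto
  finally show ?thesis .
qed

text \<open>\<open>pos\<close> counts from 1, hence the shift before the division; the quotient
  identifies the one segment that contains the coordinate.\<close>

lemma seg_set_iff:
  fixes pos :: "'d::finite \<Rightarrow> nat"
  assumes pos: "bij_betw pos UNIV {1..CARD('d)}" and M: "M dvd CARD('d)"
  shows "(pos i - 1) div (CARD('d) div M) + 1 \<in> {1..M}"
    and "j \<ge> 1 \<Longrightarrow> i \<in> seg_set M pos j \<longleftrightarrow> (pos i - 1) div (CARD('d) div M) + 1 = j"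
proof -
  let ?p = "CARD('d) div M"
  have "pos i \<in> {1..CARD('d)}" using pos unfolding bij_betw_def by blast
  then have pi: "1 \<le> pos i" "pos i \<le> CARD('d)" by auto
  have Mp: "M * ?p = CARD('d)" using M by simp
  then have p0: "?p > 0" using zero_less_card_finite[where 'a = 'd] by (cases "?p = 0") auto
  have "(pos i - 1) div ?p < M" using pi Mp p0 by (subst div_less_iff_less_mult) auto
  then show "(pos i - 1) div ?p + 1 \<in> {1..M}" by simp
  assume "j \<ge> 1"
  then obtain k where k: "j = Suc k" by (cases j) auto
  obtain n where n: "pos i = Suc n" using pi by (cases "pos i") auto
  have "i \<in> seg_set M pos j \<longleftrightarrow> k * ?p \<le> n \<and> n < Suc k * ?p"
    unfolding seg_set_def k by (auto simp: n)
  also have "\<dots> \<longleftrightarrow> n div ?p = k"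
  proof
    assume "k * ?p \<le> n \<and> n < Suc k * ?p"
    then show "n div ?p = k" by (intro div_nat_eqI) (auto simp: mult.commute)
  next
    assume "n div ?p = k"
    then show "k * ?p \<le> n \<and> n < Suc k * ?p"
      using dividend_less_div_times[OF p0, of n] by auto
  qed
  finally show "i \<in> seg_set M pos j \<longleftrightarrow> (pos i - 1) div ?p + 1 = j" by (simp add: k n)
qed

lemma sum_seg_set:
  fixes pos :: "'d::finite \<Rightarrow> nat" and c :: "'d \<Rightarrow> 'b::comm_monoid_add"
  assumes pos: "bij_betw pos UNIV {1..CARD('d)}" and M: "M dvd CARD('d)"
  shows "(\<Sum>j=1..M. \<Sum>i\<in>seg_set M pos j. c i) = (\<Sum>i\<in>UNIV. c i)"
proof -
  let ?g = "\<lambda>i. (pos i - 1) div (CARD('d) div M) + 1"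
  have "(\<Sum>j=1..M. \<Sum>i\<in>seg_set M pos j. c i) = (\<Sum>j=1..M. sum c {i \<in> UNIV. ?g i = j})"
    using seg_set_iff(2)[OF pos M] by (intro sum.cong) auto
  also have "\<dots> = (\<Sum>i\<in>UNIV. c i)"
    using seg_set_iff(1)[OF pos M] by (intro sum.group) auto
  finally show ?thesis .
qed

lemma sum_segment:
  fixes pos :: "'d::finite \<Rightarrow> nat"
  assumes pos: "bij_betw pos UNIV {1..CARD('d)}" and M: "M dvd CARD('d)"
  shows "(\<Sum>j=1..M. segment M pos j v) = v"
proof (rule vec_eq_iff[THEN iffD2], rule allI)
  fix i
  let ?j = "(pos i - 1) div (CARD('d) div M) + 1"
  have "(\<Sum>j=1..M. segment M pos j v) $ i = (\<Sum>j=1..M. if ?j = j then v $ i else 0)"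
    unfolding sum_component segment_nth using seg_set_iff(2)[OF pos M] by (intro sum.cong) auto
  then show "(\<Sum>j=1..M. segment M pos j v) $ i = v $ i"
    using seg_set_iff(1)[OF pos M, of i] by (simp only: sum.delta' finite_atLeastAtMost if_True)
qed

text \<open>Two step numbers below \<open>M\<close> with the same residue coincide, so a tour of the
  ring meets every worker exactly once.\<close>

lemma bij_betw_ring_worker:
  assumes "M \<ge> 1"
  shows "bij_betw (ring_worker M j) {..<M} {1..M}"
proof -
  have inj: "inj_on (ring_worker M j) {..<M}"
  proof (rule inj_onI)
    fix a b assume ab: "a \<in> {..<M}" "b \<in> {..<M}" "ring_worker M j a = ring_worker M j b"
    then have eq: "(j - 1 + a) mod M = (j - 1 + b) mod M" by (simp add: ring_worker_def)
    have "M dvd b - a \<and> M dvd a - b"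
    proof (cases "a \<le> b")
      case True
      then show ?thesis using eq mod_eq_dvd_iff_nat[of "j - 1 + a" "j - 1 + b" M] by simp
    next
      case False
      then show ?thesis using eq mod_eq_dvd_iff_nat[of "j - 1 + b" "j - 1 + a" M] by simp
    qed
    then have "\<not> 0 < b - a" "\<not> 0 < a - b" using ab by (auto dest: dvd_imp_le)
    then show "a = b" by simp
  qed
  have "ring_worker M j ` {..<M} \<subseteq> {1..M}" using assms by (auto simp: ring_worker_def Suc_le_eq)
  then have "ring_worker M j ` {..<M} = {1..M}"
    using inj by (intro card_subset_eq) (auto simp: card_image)
  with inj show ?thesis by (simp add: bij_betw_def)
qed

lemma segment_measurable:
  assumes "v \<in> borel_measurable N"
  shows "(\<lambda>\<omega>. segment M pos j (v \<omega>)) \<in> borel_measurable N"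
proof (rule borel_measurable_vecI)
  show "(\<lambda>\<omega>. segment M pos j (v \<omega>) $ i) \<in> borel_measurable N" for i
    using borel_measurable_nth[OF assms, of i] by (cases "i \<in> seg_set M pos j") (simp_all add: segment_nth)
qed

lemma sq_integrable_segment:
  assumes "sq_integrable P v"
  shows "sq_integrable P (\<lambda>\<omega>. segment M pos j (v \<omega>))"
proof (rule sq_integrable_vecI)
  show "sq_integrable P (\<lambda>\<omega>. segment M pos j (v \<omega>) $ i)" for i
    using sq_integrable_nth[OF assms, of i] by (cases "i \<in> seg_set M pos j") (simp_all add: segment_nth sq_integrable_zero)
qed

lemma nested_quantize_measurable:
  fixes a :: "nat \<Rightarrow> 'a \<Rightarrow> real^'d"
  assumes R: "stochastic_rounding R s \<zeta>"
    and "\<And>r. r < t \<Longrightarrow> a r \<in> borel_measurable N" "\<And>r i. r < t \<Longrightarrow> w r i \<in> measurable N R"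
  shows "(\<lambda>\<omega>. nested_sum (\<lambda>r. quantize s \<zeta> (\<lambda>i. w r i \<omega>)) (\<lambda>r. a r \<omega>) t) \<in> borel_measurable N"
  using assms(2,3)
proof (induction t)
  case (Suc t)
  then have "(\<lambda>\<omega>. nested_sum (\<lambda>r. quantize s \<zeta> (\<lambda>i. w r i \<omega>)) (\<lambda>r. a r \<omega>) t + a t \<omega>) \<in> borel_measurable N"
    by (intro borel_measurable_add) auto
  from quantize_measurable[OF R this, of "w t"] Suc.prems show ?case by simp
qed simp

lemma ring_all_reduce_measurable:
  fixes g :: "nat \<Rightarrow> 'a \<Rightarrow> real^'d"
  assumes R: "stochastic_rounding R s \<zeta>" and M: "M \<ge> 1"
    and g: "\<And>m. m \<in> {1..M} \<Longrightarrow> g m \<in> borel_measurable N"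
    and w: "\<And>j t i. j \<in> {1..M} \<Longrightarrow> t < M \<Longrightarrow> w j t i \<in> measurable N R"
  shows "(\<lambda>\<omega>. ring_all_reduce M s pos \<zeta> (\<lambda>j t i. w j t i \<omega>) (\<lambda>m. g m \<omega>)) \<in> borel_measurable N"
  unfolding ring_all_reduce_def
proof (rule borel_measurable_sum)
  fix j assume j: "j \<in> {1..M}"
  have "ring_worker M j t \<in> {1..M}" for t using M by (simp add: ring_worker_def Suc_le_eq)
  then show "(\<lambda>\<omega>. nested_sum (\<lambda>t. quantize s \<zeta> (\<lambda>i. w j t i \<omega>)) (\<lambda>t. segment M pos j (g (ring_worker M j t) \<omega>)) M)
      \<in> borel_measurable N"
    using j g w by (intro nested_quantize_measurable[OF R] segment_measurable) auto
qed

text \<open>Let \<open>c = 4 * Kr * u * C1\<close> and \<open>Y = X / (1 - Dd)\<close>. Since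
  \<open>Kr * (Kr - 1) - (Kr + 1) * (Kr - 2) = 2\<close>, the first condition says exactly
  \<open>c + 2 * (1 + c) * Y \<le> 1 - \<epsilon>\<close>, the total coefficient of
  \<open>SG\<close> on the right. The third gives \<open>(1 + c) * Y \<le> 1 - u\<close>, which
  absorbs \<open>SH\<close>, and the second replaces \<open>1 - Dd\<close> by
  \<open>\<delta>\<close> in the error terms.\<close>

lemma round_arithmetic:
  fixes u C1 Dd X Kr \<epsilon> \<delta> s2 k2 m SG SH SD Z G \<Delta> :: real
  assumes nn: "u > 0" "C1 \<ge> 0" "Kr \<ge> 1" "s2 \<ge> 0" "k2 \<ge> 0" "m \<ge> 0" "SG \<ge> 0" "SH \<ge> 0"
    and \<delta>: "\<delta> > 0"
    and X: "X = Kr * (Kr - 1) * u\<^sup>2" and Dd: "Dd = 2 * (Kr + 1) * (Kr - 2) * u\<^sup>2"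
    and step_1: "(8 * C1 * u\<^sup>2 + (Kr - 1) * u + 2 * C1) * Kr * u / (1 - Dd) \<le> (1 - \<epsilon>) / 2"
    and step_2: "Dd \<le> 1 - \<delta>"
    and step_3: "1 - u - (4 * Kr * u * C1 + 1) * (Kr - 1) * Kr * u\<^sup>2 / (1 - Dd) > 0"
    and Z: "Z = X / (1 - Dd) * (s2 * (1 + m) / 2 + 2 * Kr * k2 + 2 * SG + SH)"
    and SD: "SD \<le> Z"
    and descent: "SG + (1 - u) * SH \<le> \<Delta> + SD + Kr * u * (s2 * m)
        + u * Kr * C1 * (2 * s2 + 4 * Kr * k2 + 4 * SG + 4 * Z)"
  shows "\<epsilon> * SG \<le> \<Delta> + Kr * ((4 * Kr * u * C1 + 1) / \<delta> * (s2 * (1 + m) / 2 + 2 * Kr * k2) * (Kr - 1) * u\<^sup>2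
      + (2 * C1 * s2 + 4 * Kr * C1 * k2 + s2 * m) * u)"
proof -
  define c where "c = 4 * Kr * u * C1"
  define Y where "Y = X / (1 - Dd)"
  define b where "b = s2 * (1 + m) / 2 + 2 * Kr * k2"
  have D1: "1 - Dd > 0" "\<delta> \<le> 1 - Dd" using step_2 \<delta> by auto
  have c0: "c \<ge> 0" using nn by (simp add: c_def)
  have X0: "X \<ge> 0" using nn by (simp add: X)
  have Y0: "Y \<ge> 0" using X0 D1 by (simp add: Y_def)
  have b0: "b \<ge> 0" using nn by (simp add: b_def)
  have "(1 - Dd) * (c + 2 * (1 + c) * Y) = c * (1 - Dd) + 2 * (1 + c) * X"
  proof -
    have "(1 - Dd) * Y = X" using D1 by (simp add: Y_def)
    moreover have "(1 - Dd) * (c + 2 * (1 + c) * Y) = c * (1 - Dd) + 2 * (1 + c) * ((1 - Dd) * Y)"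
      by (simp add: algebra_simps)
    ultimately show ?thesis by (simp only:)
  qed
  also have "\<dots> = 2 * ((8 * C1 * u\<^sup>2 + (Kr - 1) * u + 2 * C1) * Kr * u)"
    unfolding c_def X Dd by (simp add: power2_eq_square algebra_simps)
  finally have "c + 2 * (1 + c) * Y = 2 * ((8 * C1 * u\<^sup>2 + (Kr - 1) * u + 2 * C1) * Kr * u / (1 - Dd))"
    using D1 by (simp add: field_simps)
  then have g: "c + 2 * (1 + c) * Y \<le> 1 - \<epsilon>" using mult_left_mono[OF step_1, of 2] by simp
  have "(4 * Kr * u * C1 + 1) * (Kr - 1) * Kr * u\<^sup>2 / (1 - Dd) = (1 + c) * Y"
    by (simp add: c_def Y_def X mult_ac add.commute)
  then have hh: "(1 + c) * Y \<le> 1 - u" using step_3 by linarith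
  have Yd: "Y \<le> X / \<delta>" unfolding Y_def using D1 X0 \<delta> by (intro divide_left_mono) auto
  have "SG + (1 - u) * SH \<le> \<Delta> + (1 + c) * Z + c * SG + Kr * u * (s2 * m) + u * Kr * C1 * (2 * s2 + 4 * Kr * k2)"
    using descent SD unfolding c_def by (simp add: algebra_simps)
  moreover have "(1 + c) * Z = (1 + c) * Y * b + 2 * (1 + c) * Y * SG + (1 + c) * Y * SH"
    unfolding Z Y_def[symmetric] b_def by (simp add: algebra_simps)
  moreover have "(1 + c) * Y * SH \<le> (1 - u) * SH" using hh nn by (intro mult_right_mono) auto
  moreover have "(c + 2 * (1 + c) * Y) * SG \<le> (1 - \<epsilon>) * SG" using g nn by (intro mult_right_mono) auto
  moreover have "(1 + c) * Y * b \<le> (1 + c) * (X / \<delta>) * b"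
    using Yd c0 b0 by (intro mult_right_mono mult_left_mono) auto
  ultimately have "\<epsilon> * SG \<le> \<Delta> + (1 + c) * (X / \<delta>) * b + Kr * u * (s2 * m) + u * Kr * C1 * (2 * s2 + 4 * Kr * k2)"
    by (simp add: algebra_simps)
  also have "\<dots> = \<Delta> + Kr * ((4 * Kr * u * C1 + 1) / \<delta> * b * (Kr - 1) * u\<^sup>2
      + (2 * C1 * s2 + 4 * Kr * C1 * k2 + s2 * m) * u)"
    unfolding c_def X by (simp add: algebra_simps add_divide_distrib diff_divide_distrib)
  finally show ?thesis unfolding b_def .
qed

section \<open>The algorithm\<close>

text \<open>The setting of the theorem with \<open>gm m\<close> in the role of the gradient of the
  \<open>m\<close>-th objective and averages expressed by \<open>mean\<close>. The global objective
  itself enters only in \<open>round\<close>.\<close>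

locale ring_sgd = prob_space P for P :: "'a measure" +
  fixes M K N s :: nat
    and D :: "nat \<Rightarrow> 'z measure"
    and f :: "nat \<Rightarrow> real^'d \<Rightarrow> 'z \<Rightarrow> real"
    and gm :: "nat \<Rightarrow> real^'d \<Rightarrow> real^'d"
    and L \<sigma> \<kappa> \<gamma> :: real
    and pos :: "'d \<Rightarrow> nat"
    and R :: "'w measure"
    and \<zeta> :: "real \<Rightarrow> 'w \<Rightarrow> nat"
    and \<xi> :: "nat \<Rightarrow> nat \<Rightarrow> nat \<Rightarrow> 'a \<Rightarrow> 'z"
    and W :: "nat \<Rightarrow> nat \<Rightarrow> nat \<Rightarrow> 'd \<Rightarrow> 'a \<Rightarrow> 'w"
    and x1 :: "real^'d"
    and xt :: "nat \<Rightarrow> 'a \<Rightarrow> real^'d"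
    and x :: "nat \<Rightarrow> nat \<Rightarrow> nat \<Rightarrow> 'a \<Rightarrow> real^'d"
    and g :: "nat \<Rightarrow> nat \<Rightarrow> 'a \<Rightarrow> real^'d"
  assumes M: "M \<ge> 1" and K: "K \<ge> 1" and s: "s \<ge> 1"
    and dvd: "M dvd CARD('d)"
    and data: "\<And>m. m \<in> {1..M} \<Longrightarrow> prob_space (D m)"
    and gradient_measurable: "\<And>m. m \<in> {1..M} \<Longrightarrow>
         (\<lambda>(y, z). gradient (\<lambda>u. f m u z) y) \<in> borel_measurable (borel \<Otimes>\<^sub>M D m)"
    and unbiased: "\<And>m y. m \<in> {1..M} \<Longrightarrow>
         has_bochner_integral (D m) (\<lambda>z. gradient (\<lambda>u. f m u z) y) (gm m y)"
    and L: "L > 0" and \<gamma>: "\<gamma> > 0"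
    and smooth: "\<And>m. m \<in> {1..M} \<Longrightarrow> L-lipschitz_on UNIV (gm m)"
    and variance_integrable: "\<And>m y. m \<in> {1..M} \<Longrightarrow>
         integrable (D m) (\<lambda>z. (norm (gradient (\<lambda>u. f m u z) y - gm m y))\<^sup>2)"
    and variance_local: "\<And>m y. m \<in> {1..M} \<Longrightarrow>
         (\<integral>z. (norm (gradient (\<lambda>u. f m u z) y - gm m y))\<^sup>2 \<partial>D m) \<le> \<sigma>\<^sup>2"
    and variance_global: "\<And>y. mean M (\<lambda>m. (norm (gm m y - mean M (\<lambda>m. gm m y)))\<^sup>2) \<le> \<kappa>\<^sup>2"
    and rounding: "stochastic_rounding R s \<zeta>"
    and sample_law: "\<And>n k m. n \<in> {1..N} \<Longrightarrow> k < K \<Longrightarrow> m \<in> {1..M} \<Longrightarrow> distr P (D m) (\<xi> n k m) = D m"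
    and seed_law: "\<And>n j t i. n \<in> {1..N} \<Longrightarrow> j \<in> {1..M} \<Longrightarrow> t < M \<Longrightarrow> distr P R (W n j t i) = R"
    and independent: "independent_families P
         ({1..N} \<times> {..<K} \<times> {1..M}) (\<lambda>(n, k, m). D m) (\<lambda>(n, k, m). \<xi> n k m)
         ({1..N} \<times> {1..M} \<times> {..<M} \<times> UNIV) (\<lambda>_. R) (\<lambda>(n, j, t, i). W n j t i)"
    and pos: "bij_betw pos UNIV {1..CARD('d)}"
    and init: "\<And>\<omega>. \<omega> \<in> space P \<Longrightarrow> xt 1 \<omega> = x1"
    and local_init: "\<And>n m \<omega>. n \<in> {1..N} \<Longrightarrow> m \<in> {1..M} \<Longrightarrow> \<omega> \<in> space P \<Longrightarrow> x n 0 m \<omega> = xt n \<omega>"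
    and local_update: "\<And>n k m \<omega>. n \<in> {1..N} \<Longrightarrow> k < K \<Longrightarrow> m \<in> {1..M} \<Longrightarrow> \<omega> \<in> space P \<Longrightarrow>
         x n (k + 1) m \<omega> = x n k m \<omega> - \<gamma> *\<^sub>R gradient (\<lambda>u. f m u (\<xi> n k m \<omega>)) (x n k m \<omega>)"
    and increment: "\<And>n m \<omega>. n \<in> {1..N} \<Longrightarrow> m \<in> {1..M} \<Longrightarrow> \<omega> \<in> space P \<Longrightarrow>
         g n m \<omega> = x n 0 m \<omega> - x n K m \<omega>"
    and global_update: "\<And>n \<omega>. n \<in> {1..N} \<Longrightarrow> \<omega> \<in> space P \<Longrightarrow>
         xt (n + 1) \<omega> = xt n \<omega> - (1 / real M) *\<^sub>R
             ring_all_reduce M s pos \<zeta> (\<lambda>j t i. W n j t i \<omega>) (\<lambda>m. g n m \<omega>)"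
begin

definition G :: "nat \<Rightarrow> real^'d \<Rightarrow> 'z \<Rightarrow> real^'d" where
  "G m y z = gradient (\<lambda>u. f m u z) y"

definition nz :: "nat \<Rightarrow> nat \<Rightarrow> nat \<Rightarrow> 'a \<Rightarrow> real^'d" where
  "nz n k m \<omega> = G m (x n k m \<omega>) (\<xi> n k m \<omega>) - gm m (x n k m \<omega>)"

abbreviation samples :: "(nat \<times> nat \<times> nat) set" where
  "samples \<equiv> {1..N} \<times> {..<K} \<times> {1..M}"

abbreviation seeds :: "(nat \<times> nat \<times> nat \<times> 'd) set" where
  "seeds \<equiv> {1..N} \<times> {1..M} \<times> {..<M} \<times> UNIV"

definition all_but_sample :: "'a measure \<Rightarrow> nat \<Rightarrow> nat \<Rightarrow> nat \<Rightarrow> bool" where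
  "all_but_sample A n k m \<longleftrightarrow> space A = space P \<and> sets A \<subseteq> sets P \<and>
     (\<forall>n'\<in>{1..N}. \<forall>k'<K. \<forall>m'\<in>{1..M}. (n', k', m') \<noteq> (n, k, m) \<longrightarrow> \<xi> n' k' m' \<in> measurable A (D m')) \<and>
     (\<forall>n'\<in>{1..N}. \<forall>j\<in>{1..M}. \<forall>t<M. \<forall>i. W n' j t i \<in> measurable A R) \<and>
     indep_set (sets A) {\<xi> n k m -` C \<inter> space P | C. C \<in> sets (D m)}"

definition all_but_seed :: "'a measure \<Rightarrow> nat \<Rightarrow> nat \<Rightarrow> nat \<Rightarrow> 'd \<Rightarrow> bool" where
  "all_but_seed A n j t i \<longleftrightarrow> space A = space P \<and> sets A \<subseteq> sets P \<and>
     (\<forall>n'\<in>{1..N}. \<forall>k'<K. \<forall>m'\<in>{1..M}. \<xi> n' k' m' \<in> measurable A (D m')) \<and>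
     (\<forall>n'\<in>{1..N}. \<forall>j'\<in>{1..M}. \<forall>t'<M. \<forall>i'. (n', j', t', i') \<noteq> (n, j, t, i) \<longrightarrow> W n' j' t' i' \<in> measurable A R) \<and>
     indep_set (sets A) {W n j t i -` C \<inter> space P | C. C \<in> sets R}"

text \<open>A choice, because \<open>independent_families_rest\<close> yields existence only, while
  \<open>local_sgd\<close> expects a family indexed by step and worker.\<close>

definition NX :: "nat \<Rightarrow> nat \<Rightarrow> nat \<Rightarrow> 'a measure" where
  "NX n k m = (SOME A. all_but_sample A n k m)"

definition NW :: "nat \<Rightarrow> nat \<Rightarrow> nat \<Rightarrow> 'd \<Rightarrow> 'a measure" where
  "NW n j t i = (SOME A. all_but_seed A n j t i)"

lemma NX: "n \<in> {1..N} \<Longrightarrow> k < K \<Longrightarrow> m \<in> {1..M} \<Longrightarrow> all_but_sample (NX n k m) n k m"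
  unfolding NX_def
proof (rule someI_ex)
  assume "n \<in> {1..N}" "k < K" "m \<in> {1..M}"
  then have i0: "(n, k, m) \<in> samples" by auto
  obtain A where A: "space A = space P" "sets A \<subseteq> sets P"
    "\<And>i. i \<in> samples \<Longrightarrow> i \<noteq> (n, k, m) \<Longrightarrow> (\<lambda>(n, k, m). \<xi> n k m) i \<in> measurable A ((\<lambda>(n, k, m). D m) i)"
    "\<And>j. j \<in> seeds \<Longrightarrow> (\<lambda>(n, j, t, i). W n j t i) j \<in> measurable A R"
    "indep_set (sets A) {(\<lambda>(n, k, m). \<xi> n k m) (n, k, m) -` C \<inter> space P | C. C \<in> sets ((\<lambda>(n, k, m). D m) (n, k, m))}"
    by (rule independent_families_rest[OF prob_space_axioms independent i0]) (rule that; assumption)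
  have "\<xi> n' k' m' \<in> measurable A (D m')" if "n' \<in> {1..N}" "k' < K" "m' \<in> {1..M}" "(n', k', m') \<noteq> (n, k, m)" for n' k' m'
    using A(3)[of "(n', k', m')"] that by auto
  moreover have "W n' j t i \<in> measurable A R" if "n' \<in> {1..N}" "j \<in> {1..M}" "t < M" for n' j t i
    using A(4)[of "(n', j, t, i)"] that by auto
  ultimately show "\<exists>A. all_but_sample A n k m"
    unfolding all_but_sample_def using A(1,2,5) by (intro exI[of _ A] conjI) simp_all
qed

lemma NW: "n \<in> {1..N} \<Longrightarrow> j \<in> {1..M} \<Longrightarrow> t < M \<Longrightarrow> all_but_seed (NW n j t i) n j t i"
  unfolding NW_def
proof (rule someI_ex)
  assume "n \<in> {1..N}" "j \<in> {1..M}" "t < M"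
  then have i0: "(n, j, t, i) \<in> seeds" by auto
  obtain A where A: "space A = space P" "sets A \<subseteq> sets P"
    "\<And>b. b \<in> seeds \<Longrightarrow> b \<noteq> (n, j, t, i) \<Longrightarrow> (\<lambda>(n, j, t, i). W n j t i) b \<in> measurable A R"
    "\<And>b. b \<in> samples \<Longrightarrow> (\<lambda>(n, k, m). \<xi> n k m) b \<in> measurable A ((\<lambda>(n, k, m). D m) b)"
    "indep_set (sets A) {(\<lambda>(n, j, t, i). W n j t i) (n, j, t, i) -` C \<inter> space P | C. C \<in> sets R}"
    by (rule independent_families_rest[OF prob_space_axioms
          independent_families_sym[OF prob_space_axioms independent] i0]) (rule that; assumption)
  have "\<xi> n' k' m' \<in> measurable A (D m')" if "n' \<in> {1..N}" "k' < K" "m' \<in> {1..M}" for n' k' m'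
    using A(4)[of "(n', k', m')"] that by auto
  moreover have "W n' j' t' i' \<in> measurable A R"
    if "n' \<in> {1..N}" "j' \<in> {1..M}" "t' < M" "(n', j', t', i') \<noteq> (n, j, t, i)" for n' j' t' i'
    using A(3)[of "(n', j', t', i')"] that by auto
  ultimately show "\<exists>A. all_but_seed A n j t i"
    unfolding all_but_seed_def using A(1,2,5) by (intro exI[of _ A] conjI) simp_all
qed

lemma sample_measurable: "n \<in> {1..N} \<Longrightarrow> k < K \<Longrightarrow> m \<in> {1..M} \<Longrightarrow> \<xi> n k m \<in> measurable P (D m)"
  using independent unfolding independent_families_def indep_vars_def2 by fastforce

lemma seed_measurable: "n \<in> {1..N} \<Longrightarrow> j \<in> {1..M} \<Longrightarrow> t < M \<Longrightarrow> W n j t i \<in> measurable P R"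
  using independent unfolding independent_families_def indep_vars_def2 by fastforce

section \<open>Measurability of the iterates\<close>

lemma G_measurable: "m \<in> {1..M} \<Longrightarrow> (\<lambda>(y, z). G m y z) \<in> borel_measurable (borel \<Otimes>\<^sub>M D m)"
  unfolding G_def by (rule gradient_measurable)

lemma G_compose_measurable:
  assumes "m \<in> {1..M}" "v \<in> borel_measurable A" "z \<in> measurable A (D m)"
  shows "(\<lambda>\<omega>. G m (v \<omega>) (z \<omega>)) \<in> borel_measurable A"
  using measurable_compose[OF measurable_Pair[OF assms(2,3)] G_measurable[OF assms(1)]] by simp

lemma gm_measurable: "m \<in> {1..M} \<Longrightarrow> gm m \<in> borel_measurable borel"
  using smooth by (intro borel_measurable_continuous_onI lipschitz_on_continuous_on)

lemma x_Suc: "n \<in> {1..N} \<Longrightarrow> k < K \<Longrightarrow> m \<in> {1..M} \<Longrightarrow> \<omega> \<in> space P \<Longrightarrow>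
    x n (Suc k) m \<omega> = x n k m \<omega> - \<gamma> *\<^sub>R G m (x n k m \<omega>) (\<xi> n k m \<omega>)"
  using local_update by (simp add: G_def)

text \<open>Stated for an arbitrary sigma-algebra so as to serve both \<open>NX\<close> and
  \<open>NW\<close>. It must have the same space as \<open>P\<close>, since the update equations
  hold only on that space.\<close>

lemma x_measurable:
  assumes sp: "space A = space P" and n: "n \<in> {1..N}" and m: "m \<in> {1..M}" and k: "k \<le> K"
    and xt: "xt n \<in> borel_measurable A"
    and \<xi>: "\<And>k'. k' < k \<Longrightarrow> \<xi> n k' m \<in> measurable A (D m)"
  shows "x n k m \<in> borel_measurable A"
  using k \<xi>
proof (induction k)
  case 0
  have "x n 0 m \<in> borel_measurable A \<longleftrightarrow> xt n \<in> borel_measurable A"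
    using local_init n m sp by (intro measurable_cong) auto
  then show ?case using xt by simp
next
  case (Suc k)
  have "x n (Suc k) m \<in> borel_measurable A
      \<longleftrightarrow> (\<lambda>\<omega>. x n k m \<omega> - \<gamma> *\<^sub>R G m (x n k m \<omega>) (\<xi> n k m \<omega>)) \<in> borel_measurable A"
    using x_Suc n m sp Suc.prems by (intro measurable_cong) auto
  moreover have "(\<lambda>\<omega>. x n k m \<omega> - \<gamma> *\<^sub>R G m (x n k m \<omega>) (\<xi> n k m \<omega>)) \<in> borel_measurable A"
    using Suc m by (intro borel_measurable_diff borel_measurable_scaleR G_compose_measurable) auto
  ultimately show ?case by simp
qed

lemma g_measurable:
  assumes sp: "space A = space P" and n: "n \<in> {1..N}" and m: "m \<in> {1..M}"
    and xt: "xt n \<in> borel_measurable A"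
    and \<xi>: "\<And>k'. k' < K \<Longrightarrow> \<xi> n k' m \<in> measurable A (D m)"
  shows "g n m \<in> borel_measurable A"
proof -
  have "g n m \<in> borel_measurable A \<longleftrightarrow> (\<lambda>\<omega>. x n 0 m \<omega> - x n K m \<omega>) \<in> borel_measurable A"
    using increment n m sp by (intro measurable_cong) auto
  moreover have "(\<lambda>\<omega>. x n 0 m \<omega> - x n K m \<omega>) \<in> borel_measurable A"
    using x_measurable[OF sp n m _ xt] \<xi> by (intro borel_measurable_diff) auto
  ultimately show ?thesis by simp
qed

lemma xt_measurable:
  assumes sp: "space A = space P" and n: "1 \<le> n" "n \<le> N + 1"
    and \<xi>: "\<And>n' k' m'. 1 \<le> n' \<Longrightarrow> n' < n \<Longrightarrow> k' < K \<Longrightarrow> m' \<in> {1..M} \<Longrightarrow> \<xi> n' k' m' \<in> measurable A (D m')"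
    and W: "\<And>n' j t i. 1 \<le> n' \<Longrightarrow> n' < n \<Longrightarrow> j \<in> {1..M} \<Longrightarrow> t < M \<Longrightarrow> W n' j t i \<in> measurable A R"
  shows "xt n \<in> borel_measurable A"
  using n \<xi> W
proof (induction n rule: dec_induct)
  case base
  have "xt 1 \<in> borel_measurable A \<longleftrightarrow> (\<lambda>_. x1) \<in> borel_measurable A"
    using init sp by (intro measurable_cong) auto
  then show ?case by simp
next
  case (step n)
  then have n: "n \<in> {1..N}" by auto
  have xt: "xt n \<in> borel_measurable A" using step by auto
  let ?X = "\<lambda>\<omega>. xt n \<omega> - (1 / real M) *\<^sub>R
     ring_all_reduce M s pos \<zeta> (\<lambda>j t i. W n j t i \<omega>) (\<lambda>m. g n m \<omega>)"
  have "xt (Suc n) \<in> borel_measurable A \<longleftrightarrow> ?X \<in> borel_measurable A"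
    using global_update[OF n] sp by (intro measurable_cong) auto
  moreover have "(\<lambda>\<omega>. ring_all_reduce M s pos \<zeta> (\<lambda>j t i. W n j t i \<omega>) (\<lambda>m. g n m \<omega>)) \<in> borel_measurable A"
  proof (rule ring_all_reduce_measurable[OF rounding M])
    show "g n m \<in> borel_measurable A" if "m \<in> {1..M}" for m
      using step.prems(2)[of n] step.hyps that by (intro g_measurable[OF sp n that xt]) auto
    show "W n j t i \<in> measurable A R" if "j \<in> {1..M}" "t < M" for j t i
      using step.prems(3)[of n] step.hyps that by auto
  qed
  then have "?X \<in> borel_measurable A" using xt by (intro borel_measurable_diff borel_measurable_scaleR) auto
  ultimately show ?case by simp
qed

section \<open>The sampling noise\<close>

text \<open>The iterate avoids the fresh sample, so it is measurable for \<open>NX\<close> and can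
  be frozen: then the variance bound and unbiasedness at a fixed point apply. For orthogonality the
  pair of iterate and \<open>Z\<close> is frozen.\<close>

lemma noise:
  assumes n: "n \<in> {1..N}" and k: "k < K" and m: "m \<in> {1..M}" and sq: "sq_integrable P (x n k m)"
  shows "sq_integrable P (nz n k m)" and "msq (nz n k m) \<le> \<sigma>\<^sup>2"
    and "Z \<in> borel_measurable (NX n k m) \<Longrightarrow> sq_integrable P Z \<Longrightarrow> (\<integral>\<omega>. nz n k m \<omega> $ i * Z \<omega> \<partial>P) = 0"
proof -
  let ?A = "NX n k m"
  have A: "space ?A = space P" "sets ?A \<subseteq> sets P" "indep_set (sets ?A) {\<xi> n k m -` C \<inter> space P | C. C \<in> sets (D m)}"
    and A\<xi>: "\<And>n' k' m'. n' \<in> {1..N} \<Longrightarrow> k' < K \<Longrightarrow> m' \<in> {1..M} \<Longrightarrow> (n', k', m') \<noteq> (n, k, m) \<Longrightarrow>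
        \<xi> n' k' m' \<in> measurable ?A (D m')"
    and AW: "\<And>n' j t i. n' \<in> {1..N} \<Longrightarrow> j \<in> {1..M} \<Longrightarrow> t < M \<Longrightarrow> W n' j t i \<in> measurable ?A R"
    using NX[OF n k m] unfolding all_but_sample_def by auto
  have xt: "xt n \<in> borel_measurable ?A" using n A\<xi> AW by (intro xt_measurable[OF A(1)]) auto
  have xA: "x n k m \<in> borel_measurable ?A"
    using k A\<xi> n m by (intro x_measurable[OF A(1) n m _ xt]) auto
  have xP[measurable]: "x n k m \<in> borel_measurable P" by (rule sq_integrable_measurable[OF sq])
  have \<xi>P[measurable]: "\<xi> n k m \<in> measurable P (D m)" by (rule sample_measurable[OF n k m])
  have PD: "prob_space (D m)" by (rule data[OF m])
  note law = sample_law[OF n k m]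
  have Gm[measurable]: "(\<lambda>p. G m (fst p) (snd p)) \<in> borel_measurable (borel \<Otimes>\<^sub>M D m)"
    using G_measurable[OF m] by (simp add: case_prod_beta)
  note [measurable] = gm_measurable[OF m]
  have nzm: "nz n k m \<in> borel_measurable P"
    unfolding nz_def using G_compose_measurable[OF m xP \<xi>P] by measurable
  have law1: "distr P (borel \<Otimes>\<^sub>M D m) (\<lambda>\<omega>. (x n k m \<omega>, \<xi> n k m \<omega>)) = distr P borel (x n k m) \<Otimes>\<^sub>M D m"
    using distr_pair_indep[OF A(1,2) xA \<xi>P A(3)] law by simp
  let ?\<phi> = "\<lambda>p. (norm (G m (fst p) (snd p) - gm m (fst p)))\<^sup>2"
  have \<phi>m: "?\<phi> \<in> borel_measurable (borel \<Otimes>\<^sub>M D m)" by measurable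
  have le: "integrable (D m) (\<lambda>z. ?\<phi> (y, z)) \<and> (\<integral>z. ?\<phi> (y, z) \<partial>D m) \<le> \<sigma>\<^sup>2" for y
    using variance_integrable[OF m, of y] variance_local[OF m, of y] by (simp add: G_def)
  have b: "integrable P (\<lambda>\<omega>. (\<lambda>_. \<sigma>\<^sup>2) (x n k m \<omega>))" by simp
  have 1: "integrable P (\<lambda>\<omega>. ?\<phi> (x n k m \<omega>, \<xi> n k m \<omega>))" "(\<integral>\<omega>. ?\<phi> (x n k m \<omega>, \<xi> n k m \<omega>) \<partial>P) \<le> (\<integral>\<omega>. \<sigma>\<^sup>2 \<partial>P)"
    using integral_indep_le[OF law1 xP \<xi>P PD \<phi>m _ _ _ b le] by simp_all
  show nz_sq: "sq_integrable P (nz n k m)"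
    using 1(1) nzm by (simp add: sq_integrable_def nz_def)
  show "msq (nz n k m) \<le> \<sigma>\<^sup>2" using 1(2) by (simp add: msq_def nz_def prob_space)
  assume Z: "Z \<in> borel_measurable ?A" "sq_integrable P Z"
  have ZP[measurable]: "Z \<in> borel_measurable P" using Z(2) by (rule sq_integrable_measurable)
  have xZ: "(\<lambda>\<omega>. (x n k m \<omega>, Z \<omega>)) \<in> measurable ?A (borel \<Otimes>\<^sub>M borel)" using xA Z(1) by measurable
  have law2: "distr P ((borel \<Otimes>\<^sub>M borel) \<Otimes>\<^sub>M D m) (\<lambda>\<omega>. ((x n k m \<omega>, Z \<omega>), \<xi> n k m \<omega>))
      = distr P (borel \<Otimes>\<^sub>M borel) (\<lambda>\<omega>. (x n k m \<omega>, Z \<omega>)) \<Otimes>\<^sub>M D m"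
    using distr_pair_indep[OF A(1,2) xZ \<xi>P A(3)] law by simp
  let ?\<psi> = "\<lambda>p :: ((real^'d) \<times> real) \<times> 'z. (G m (fst (fst p)) (snd p) - gm m (fst (fst p))) $ i * snd (fst p)"
  have "(\<lambda>p :: ((real^'d) \<times> real) \<times> 'z. (fst (fst p), snd p)) \<in> (borel \<Otimes>\<^sub>M borel) \<Otimes>\<^sub>M D m \<rightarrow>\<^sub>M borel \<Otimes>\<^sub>M D m"
    by measurable
  from measurable_compose[OF this Gm]
  have [measurable]: "(\<lambda>p :: ((real^'d) \<times> real) \<times> 'z. G m (fst (fst p)) (snd p)) \<in> borel_measurable ((borel \<Otimes>\<^sub>M borel) \<Otimes>\<^sub>M D m)"
    by simp
  have "(\<lambda>p :: ((real^'d) \<times> real) \<times> 'z. (G m (fst (fst p)) (snd p) - gm m (fst (fst p))) $ i) \<in> borel_measurable ((borel \<Otimes>\<^sub>M borel) \<Otimes>\<^sub>M D m)"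
    by (intro borel_measurable_nth) measurable
  then have \<psi>m: "?\<psi> \<in> borel_measurable ((borel \<Otimes>\<^sub>M borel) \<Otimes>\<^sub>M D m)" by measurable
  have "(\<integral>\<omega>. ?\<psi> ((x n k m \<omega>, Z \<omega>), \<xi> n k m \<omega>) \<partial>P) = 0"
  proof (rule integral_indep_eq_0[OF law2 _ \<xi>P PD \<psi>m])
    show "(\<lambda>\<omega>. (x n k m \<omega>, Z \<omega>)) \<in> measurable P (borel \<Otimes>\<^sub>M borel)" by measurable
    show "integrable P (\<lambda>\<omega>. ?\<psi> ((x n k m \<omega>, Z \<omega>), \<xi> n k m \<omega>))"
      using sq_integrable_mult[OF sq_integrable_nth[OF nz_sq, of i] Z(2)] by (simp add: nz_def)
    show "(\<integral>z. ?\<psi> (u, z) \<partial>D m) = 0" for u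
    proof -
      interpret Dm: prob_space "D m" by (rule PD)
      have "has_bochner_integral (D m) (\<lambda>z. G m (fst u) z - gm m (fst u)) (gm m (fst u) - gm m (fst u))"
        using unbiased[OF m, of "fst u"] unfolding G_def
        by (intro has_bochner_integral_diff) (auto simp: has_bochner_integral_iff Dm.prob_space)
      then have h: "has_bochner_integral (D m) (\<lambda>z. G m (fst u) z - gm m (fst u)) 0" by simp
      have "has_bochner_integral (D m) (\<lambda>z. (G m (fst u) z - gm m (fst u)) $ i) (0 $ i)"
        by (rule has_bochner_integral_bounded_linear[OF bounded_linear_vec_nth h])
      then show ?thesis by (simp add: has_bochner_integral_iff)
    qed
  qed
  then show "(\<integral>\<omega>. nz n k m \<omega> $ i * Z \<omega> \<partial>P) = 0" by (simp add: nz_def)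
qed

text \<open>The noise at step \<open>k\<close> is known to be square integrable only once the
  iterate at that step is, so the induction alternates between the two.\<close>

lemma x_sq:
  assumes n: "n \<in> {1..N}" and xt: "sq_integrable P (xt n)" and m: "m \<in> {1..M}"
  shows "k \<le> K \<Longrightarrow> sq_integrable P (x n k m)"
proof (induction k)
  case 0
  show ?case using xt local_init[OF n m] by (subst sq_integrable_cong) auto
next
  case (Suc k)
  then have k: "k < K" and sq: "sq_integrable P (x n k m)" by auto
  let ?X = "\<lambda>\<omega>. x n k m \<omega> - \<gamma> *\<^sub>R (gm m (x n k m \<omega>) + nz n k m \<omega>)"
  have "x n (Suc k) m \<omega> = ?X \<omega>" if "\<omega> \<in> space P" for \<omega>
    using x_Suc[OF n k m that] by (simp add: nz_def)
  moreover have "sq_integrable P ?X"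
    using sq noise(1)[OF n k m sq] sq_integrable_lipschitz[OF sq smooth[OF m]]
    by (intro sq_integrable_diff sq_integrable_scaleR sq_integrable_add)
  ultimately show ?case using sq_integrable_cong[of P "x n (Suc k) m" ?X] by blast
qed

lemma local_sgd:
  assumes n: "n \<in> {1..N}" and xt: "sq_integrable P (xt n)"
  shows "local_sgd P M K L \<gamma> \<sigma> \<kappa> gm (x n) (nz n) (NX n)"
proof unfold_locales
  show "M \<ge> 1" "K \<ge> 1" "L > 0" "\<gamma> > 0" by (fact M K L \<gamma>)+
  show "\<And>m. m \<in> {1..M} \<Longrightarrow> L-lipschitz_on UNIV (gm m)" by (fact smooth)
  show "\<And>y. mean M (\<lambda>m. (norm (gm m y - mean M (\<lambda>m. gm m y)))\<^sup>2) \<le> \<kappa>\<^sup>2" by (fact variance_global)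
  show "x n 0 m \<omega> = x n 0 1 \<omega>" if "m \<in> {1..M}" "\<omega> \<in> space P" for m \<omega>
    using local_init[OF n that] local_init[OF n _ that(2), of 1] M by simp
  show "x n (Suc k) m \<omega> = x n k m \<omega> - \<gamma> *\<^sub>R (gm m (x n k m \<omega>) + nz n k m \<omega>)"
    if "k < K" "m \<in> {1..M}" "\<omega> \<in> space P" for k m \<omega>
    using x_Suc[OF n that] by (simp add: nz_def)
  show sq: "sq_integrable P (x n k m)" if "k \<le> K" "m \<in> {1..M}" for k m
    by (rule x_sq[OF n xt that(2,1)])
  show "sq_integrable P (nz n k m)" "msq (nz n k m) \<le> \<sigma>\<^sup>2" if "k < K" "m \<in> {1..M}" for k m
    using noise(1,2)[OF n that sq] that by auto
  show "(\<integral>\<omega>. nz n k m \<omega> $ i * Z \<omega> \<partial>P) = 0"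
    if "k < K" "m \<in> {1..M}" "Z \<in> borel_measurable (NX n k m)" "sq_integrable P Z" for k m i Z
    using noise(3)[OF n that(1,2) sq that(3,4)] that by auto
  have A: "space (NX n k m) = space P"
    "n' \<in> {1..N} \<Longrightarrow> k' < K \<Longrightarrow> m' \<in> {1..M} \<Longrightarrow> (n', k', m') \<noteq> (n, k, m) \<Longrightarrow> \<xi> n' k' m' \<in> measurable (NX n k m) (D m')"
    "n' \<in> {1..N} \<Longrightarrow> j \<in> {1..M} \<Longrightarrow> t < M \<Longrightarrow> W n' j t i \<in> measurable (NX n k m) R"
    if "k < K" "m \<in> {1..M}" for k m n' k' m' j t i
    using NX[OF n that] unfolding all_but_sample_def by auto
  show xN: "x n j m' \<in> borel_measurable (NX n k m)" if "k < K" "m \<in> {1..M}" "j \<le> k" "m' \<in> {1..M}" for k m j m'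
  proof (rule x_measurable)
    show "xt n \<in> borel_measurable (NX n k m)"
      using A[OF that(1,2)] n by (intro xt_measurable) auto
  qed (use A[OF that(1,2)] that n in auto)
  show "nz n j m' \<in> borel_measurable (NX n k m)"
    if "k < K" "m \<in> {1..M}" "m' \<in> {1..M}" "j < k \<or> j = k \<and> m' \<noteq> m" for k m j m'
  proof -
    have xj: "x n j m' \<in> borel_measurable (NX n k m)" using that by (intro xN) auto
    have "\<xi> n j m' \<in> measurable (NX n k m) (D m')" using A(2)[OF that(1,2)] that n by auto
    then show ?thesis unfolding nz_def
      using G_compose_measurable[OF that(3) xj] measurable_compose[OF xj gm_measurable[OF that(3)]]
      by (intro borel_measurable_diff) auto
  qed
qed

section \<open>The quantization error of a round\<close>

definition part :: "nat \<Rightarrow> nat \<Rightarrow> nat \<Rightarrow> 'a \<Rightarrow> real^'d" where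
  "part n j t \<omega> = segment M pos j (g n (ring_worker M j t) \<omega>)"

lemma ring_worker_in: "ring_worker M j t \<in> {1..M}"
  using M by (simp add: ring_worker_def Suc_le_eq)

lemma g_sq: "n \<in> {1..N} \<Longrightarrow> sq_integrable P (xt n) \<Longrightarrow> m \<in> {1..M} \<Longrightarrow> sq_integrable P (g n m)"
  using sq_integrable_cong[of P "g n m" "\<lambda>\<omega>. x n 0 m \<omega> - x n K m \<omega>"] increment
  by (auto intro!: sq_integrable_diff x_sq)

lemma NW_measurable:
  assumes n: "n \<in> {1..N}" and j: "j \<in> {1..M}" and t: "t < M" and m: "m \<in> {1..M}"
  shows "xt n \<in> borel_measurable (NW n j t i)" and "k \<le> K \<Longrightarrow> x n k m \<in> borel_measurable (NW n j t i)"
    and "g n m \<in> borel_measurable (NW n j t i)"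
proof -
  let ?A = "NW n j t i"
  have A: "space ?A = space P"
    "\<And>n' k' m'. n' \<in> {1..N} \<Longrightarrow> k' < K \<Longrightarrow> m' \<in> {1..M} \<Longrightarrow> \<xi> n' k' m' \<in> measurable ?A (D m')"
    "\<And>n' j' t' i'. n' \<in> {1..N} \<Longrightarrow> j' \<in> {1..M} \<Longrightarrow> t' < M \<Longrightarrow> (n', j', t', i') \<noteq> (n, j, t, i) \<Longrightarrow> W n' j' t' i' \<in> measurable ?A R"
    using NW[OF n j t] unfolding all_but_seed_def by auto
  show xt: "xt n \<in> borel_measurable ?A" using A n by (intro xt_measurable) auto
  show "x n k m \<in> borel_measurable ?A" if "k \<le> K"
    using A n m that by (intro x_measurable[OF A(1) n m that xt]) auto
  show "g n m \<in> borel_measurable ?A"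
    using A n m by (intro g_measurable[OF A(1) n m xt]) auto
qed

lemma quantizer_chain:
  assumes n: "n \<in> {1..N}" and xt: "sq_integrable P (xt n)" and j: "j \<in> {1..M}"
  shows "quantizer_chain P R s \<zeta> (W n j) M (part n j) (NW n j) (seg_set M pos j)"
proof unfold_locales
  show "stochastic_rounding R s \<zeta>" "s \<ge> 1" by (fact rounding s)+
  show "space (NW n j t i) = space P" "sets (NW n j t i) \<subseteq> sets P"
    "indep_set (sets (NW n j t i)) {W n j t i -` C \<inter> space P | C. C \<in> sets R}" if "t < M" for t i
    using NW[OF n j that] unfolding all_but_seed_def by auto
  show "W n j t i \<in> measurable P R" "distr P R (W n j t i) = R" if "t < M" for t i
    using seed_measurable[OF n j that] seed_law[OF n j that] by auto
  show "W n j t' i' \<in> measurable (NW n j t i) R" if "t < M" "t' < t" for t i t' i'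
    using NW[OF n j that(1)] n j that unfolding all_but_seed_def by auto
  show "part n j t' \<in> borel_measurable (NW n j t i)" if "t < M" "t' < M" for t i t'
    unfolding part_def using n j that ring_worker_in by (intro segment_measurable NW_measurable)
  show "sq_integrable P (part n j t)" for t
    unfolding part_def using n xt ring_worker_in by (intro sq_integrable_segment g_sq)
  show "part n j t \<omega> $ i = 0" if "i \<notin> seg_set M pos j" for t i \<omega>
    using that by (simp add: part_def segment_nth)
qed

end

context ring_sgd
begin

definition qerr :: "nat \<Rightarrow> nat \<Rightarrow> 'a \<Rightarrow> real^'d" where
  "qerr n j \<omega> = nested_sum (\<lambda>t. quantize s \<zeta> (\<lambda>i. W n j t i \<omega>)) (\<lambda>t. part n j t \<omega>) M - (\<Sum>t<M. part n j t \<omega>)"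

definition rerr :: "nat \<Rightarrow> 'a \<Rightarrow> real^'d" where
  "rerr n \<omega> = (\<Sum>j=1..M. qerr n j \<omega>)"

definition qq :: real where
  "qq = real (CARD('d) div M) / (4 * (real s)\<^sup>2)"

text \<open>The ring order permutes the workers and the segments of a vector add up to it, so
  without quantization the ring would compute the plain sum.\<close>

lemma sum_part: "(\<Sum>j=1..M. \<Sum>t<M. part n j t \<omega>) = (\<Sum>m=1..M. g n m \<omega>)"
proof -
  have "(\<Sum>j=1..M. \<Sum>t<M. part n j t \<omega>) = (\<Sum>j=1..M. \<Sum>m=1..M. segment M pos j (g n m \<omega>))"
    unfolding part_def using bij_betw_ring_worker[OF M]
    by (intro sum.cong refl sum.reindex_bij_betw)
  also have "\<dots> = (\<Sum>m=1..M. \<Sum>j=1..M. segment M pos j (g n m \<omega>))" by (rule sum.swap)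
  also have "\<dots> = (\<Sum>m=1..M. g n m \<omega>)" by (simp only: sum_segment[OF pos dvd])
  finally show ?thesis .
qed

lemma xt_Suc:
  assumes n: "n \<in> {1..N}" and \<omega>: "\<omega> \<in> space P"
  shows "xt (Suc n) \<omega> = mean M (\<lambda>m. x n K m \<omega>) - (1 / real M) *\<^sub>R rerr n \<omega>"
proof -
  have "ring_all_reduce M s pos \<zeta> (\<lambda>j t i. W n j t i \<omega>) (\<lambda>m. g n m \<omega>)
      = rerr n \<omega> + (\<Sum>j=1..M. \<Sum>t<M. part n j t \<omega>)"
    by (simp add: ring_all_reduce_def rerr_def qerr_def part_def sum_subtractf)
  also have "\<dots> = rerr n \<omega> + (\<Sum>m=1..M. g n m \<omega>)" by (simp only: sum_part)
  finally have r: "ring_all_reduce M s pos \<zeta> (\<lambda>j t i. W n j t i \<omega>) (\<lambda>m. g n m \<omega>)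
      = rerr n \<omega> + (\<Sum>m=1..M. g n m \<omega>)" .
  have "mean M (\<lambda>m. x n K m \<omega>) = mean M (\<lambda>m. xt n \<omega> - g n m \<omega>)"
    using increment[OF n _ \<omega>] local_init[OF n _ \<omega>] by (intro mean_cong) auto
  also have "\<dots> = xt n \<omega> - mean M (\<lambda>m. g n m \<omega>)" by (simp only: mean_diff mean_const[OF M])
  finally show ?thesis
    using global_update[OF n \<omega>] unfolding r mean_def by (simp add: scaleR_add_right)
qed

text \<open>The square integrability of \<open>xt n\<close> is assumed for one round;
  \<open>xt_Suc_sq\<close> hands it on to the next.\<close>

context
  fixes n
  assumes n: "n \<in> {1..N}" and xt: "sq_integrable P (xt n)"
begin

interpretation lr: local_sgd P M K L \<gamma> \<sigma> \<kappa> gm "x n" "nz n" "NX n"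
  by (rule local_sgd[OF n xt])

lemma qc: "j \<in> {1..M} \<Longrightarrow> quantizer_chain P R s \<zeta> (W n j) M (part n j) (NW n j) (seg_set M pos j)"
  by (rule quantizer_chain[OF n xt])

lemma qerr_eq: "j \<in> {1..M} \<Longrightarrow> qerr n j = quantizer_chain.err s \<zeta> (W n j) (part n j) M"
proof -
  assume j: "j \<in> {1..M}"
  interpret qc: quantizer_chain P R s \<zeta> "W n j" M "part n j" "NW n j" "seg_set M pos j" by (rule qc[OF j])
  show ?thesis by (simp add: fun_eq_iff qerr_def qc.err_def qc.qsum_def qc.psum_def)
qed

lemma qerr_sq: "j \<in> {1..M} \<Longrightarrow> sq_integrable P (qerr n j)"
  using quantizer_chain.err_sq[OF qc] by (simp add: qerr_eq)

lemma qerr_supp: "j \<in> {1..M} \<Longrightarrow> i \<notin> seg_set M pos j \<Longrightarrow> qerr n j \<omega> $ i = 0"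
  using quantizer_chain.err_supp[OF qc] by (simp add: qerr_eq)

lemma rerr_sq: "sq_integrable P (rerr n)"
  unfolding rerr_def by (intro sq_integrable_sum qerr_sq)

lemma xb_eq: "lr.xb k \<omega> = mean M (\<lambda>m. x n k m \<omega>)"
  by (simp add: lr.xb_def)

text \<open>The average after \<open>K\<close> local steps involves no seed of round
  \<open>n\<close>, so it is measurable for every \<open>NW n j u i\<close> and
  \<open>err_orth\<close> applies. This removes the first-order effect of quantization on the
  objective.\<close>

lemma rerr_orth:
  assumes H: "H \<in> borel_measurable borel" and sq: "sq_integrable P (\<lambda>\<omega>. H (lr.xb K \<omega>))"
  shows "(\<integral>\<omega>. rerr n \<omega> \<bullet> H (lr.xb K \<omega>) \<partial>P) = 0"
proof -
  have "(\<integral>\<omega>. qerr n j \<omega> $ i * H (lr.xb K \<omega>) $ i \<partial>P) = 0" if j: "j \<in> {1..M}" for i j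
    unfolding qerr_eq[OF j]
  proof (rule quantizer_chain.err_orth[OF qc[OF j]])
    fix u assume u: "u < M"
    have "lr.xb K \<in> borel_measurable (NW n j u i)"
      unfolding lr.xb_def using n j u by (intro borel_measurable_mean NW_measurable) auto
    from measurable_compose[OF this H]
    show "(\<lambda>\<omega>. H (lr.xb K \<omega>) $ i) \<in> borel_measurable (NW n j u i)" by (rule borel_measurable_nth)
  qed (use sq in \<open>auto intro: sq_integrable_nth\<close>)
  then have "(\<integral>\<omega>. qerr n j \<omega> \<bullet> H (lr.xb K \<omega>) \<partial>P) = 0" if j: "j \<in> {1..M}" for j
    unfolding inner_vec_def using j sq qerr_sq
    by (subst Bochner_Integration.integral_sum) (auto intro!: sq_integrable_mult sq_integrable_nth)
  moreover have "(\<integral>\<omega>. rerr n \<omega> \<bullet> H (lr.xb K \<omega>) \<partial>P) = (\<Sum>j=1..M. \<integral>\<omega>. qerr n j \<omega> \<bullet> H (lr.xb K \<omega>) \<partial>P)"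
    unfolding rerr_def inner_sum_left
    by (intro Bochner_Integration.integral_sum sq_integrable_inner qerr_sq sq)
  ultimately show ?thesis by simp
qed

lemma g_eq:
  assumes m: "m \<in> {1..M}" and \<omega>: "\<omega> \<in> space P"
  shows "g n m \<omega> = \<gamma> *\<^sub>R lr.upd m \<omega>"
proof -
  have "x n k m \<omega> = x n 0 m \<omega> - \<gamma> *\<^sub>R (\<Sum>l<k. lr.h l m \<omega> + nz n l m \<omega>)" if "k \<le> K" for k
    using that
  proof (induction k)
    case (Suc k)
    have "x n (Suc k) m \<omega> = x n k m \<omega> - \<gamma> *\<^sub>R (lr.h k m \<omega> + nz n k m \<omega>)"
      using lr.step[of k m \<omega>] m \<omega> Suc.prems by (simp add: lr.h_def)
    also have "x n k m \<omega> = x n 0 m \<omega> - \<gamma> *\<^sub>R (\<Sum>l<k. lr.h l m \<omega> + nz n l m \<omega>)"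
      using Suc by simp
    finally show ?case by (simp add: algebra_simps)
  qed simp
  from this[of K] show ?thesis using increment[OF n m \<omega>] by (simp add: lr.upd_def)
qed

text \<open>The first \<open>t + 1\<close> workers on the ring form a group of that size, to which
  \<open>msq_upd_sum_le\<close> applies in each coordinate. The sums are then extended to all
  workers, which makes the bound independent of where the tour starts; only the factor
  \<open>t + 1\<close> remembers the group.\<close>

lemma msq_psum_le:
  assumes j: "j \<in> {1..M}" and t: "t < M"
  shows "msq (\<lambda>\<omega>. \<Sum>r<Suc t. part n j r \<omega>)
    \<le> \<gamma>\<^sup>2 * (\<Sum>i\<in>seg_set M pos j. (\<Sum>m=1..M. lr.na m i) + (real t + 1) * (\<Sum>m=1..M. lr.nb m i))"
proof -
  let ?T = "ring_worker M j ` {..<Suc t}"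
  have inj: "inj_on (ring_worker M j) {..<Suc t}"
    using bij_betw_ring_worker[OF M, of j] t unfolding bij_betw_def by (auto intro: inj_on_subset)
  have T: "?T \<subseteq> {1..M}" using ring_worker_in by auto
  have cT: "real (card ?T) = real t + 1" using inj by (simp add: card_image)
  have psq: "sq_integrable P (\<lambda>\<omega>. \<Sum>r<Suc t. part n j r \<omega>)"
    unfolding part_def using n xt ring_worker_in by (intro sq_integrable_sum sq_integrable_segment g_sq)
  have nn: "0 \<le> lr.na m i" "0 \<le> lr.nb m i" for m i
    unfolding lr.na_def lr.nb_def
    by (auto intro!: sum_nonneg mult_nonneg_nonneg add_nonneg_nonneg msq_nonneg divide_nonneg_nonneg)
  have "msq (\<lambda>\<omega>. \<Sum>r<Suc t. part n j r \<omega>) = (\<Sum>i\<in>UNIV. msq (\<lambda>\<omega>. (\<Sum>r<Suc t. part n j r \<omega>) $ i))"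
    by (rule lr.sum_msq_nth[OF psq, symmetric])
  also have "\<dots> = (\<Sum>i\<in>seg_set M pos j. msq (\<lambda>\<omega>. (\<Sum>r<Suc t. part n j r \<omega>) $ i))"
    by (intro sum.mono_neutral_right) (auto simp: part_def segment_nth msq_def)
  also have "\<dots> \<le> (\<Sum>i\<in>seg_set M pos j. \<gamma>\<^sup>2 * ((\<Sum>m=1..M. lr.na m i) + (real t + 1) * (\<Sum>m=1..M. lr.nb m i)))"
  proof (rule sum_mono)
    fix i assume i: "i \<in> seg_set M pos j"
    have "msq (\<lambda>\<omega>. (\<Sum>r<Suc t. part n j r \<omega>) $ i) = msq (\<lambda>\<omega>. \<gamma> *\<^sub>R (\<Sum>m\<in>?T. lr.upd m \<omega> $ i))"
    proof (rule msq_cong)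
      fix \<omega> assume \<omega>: "\<omega> \<in> space P"
      have "(\<Sum>r<Suc t. part n j r \<omega>) $ i = (\<Sum>r<Suc t. \<gamma> * lr.upd (ring_worker M j r) \<omega> $ i)"
        unfolding sum_component part_def segment_nth using i g_eq[OF ring_worker_in \<omega>] by simp
      also have "\<dots> = (\<Sum>m\<in>?T. \<gamma> * lr.upd m \<omega> $ i)" by (simp only: sum.reindex[OF inj] o_def)
      finally show "(\<Sum>r<Suc t. part n j r \<omega>) $ i = \<gamma> *\<^sub>R (\<Sum>m\<in>?T. lr.upd m \<omega> $ i)"
        by (simp add: sum_distrib_left)
    qed
    also have "\<dots> = \<gamma>\<^sup>2 * msq (\<lambda>\<omega>. \<Sum>m\<in>?T. lr.upd m \<omega> $ i)" by (rule msq_scaleR)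
    also have "\<dots> \<le> \<gamma>\<^sup>2 * ((\<Sum>m\<in>?T. lr.na m i) + (real t + 1) * (\<Sum>m\<in>?T. lr.nb m i))"
      using lr.msq_upd_sum_le[OF T, of i] unfolding cT by (intro mult_left_mono) auto
    also have "\<dots> \<le> \<gamma>\<^sup>2 * ((\<Sum>m=1..M. lr.na m i) + (real t + 1) * (\<Sum>m=1..M. lr.nb m i))"
      using T nn by (intro mult_left_mono add_mono sum_mono2) auto
    finally show "msq (\<lambda>\<omega>. (\<Sum>r<Suc t. part n j r \<omega>) $ i)
      \<le> \<gamma>\<^sup>2 * ((\<Sum>m=1..M. lr.na m i) + (real t + 1) * (\<Sum>m=1..M. lr.nb m i))" .
  qed
  finally show ?thesis by (simp only: sum_distrib_left)
qed

text \<open>The errors of different segments have disjoint supports, so their second moments add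
  without a factor \<open>M\<close>, and the coordinates of all segments together are all
  coordinates. Totals over \<open>M\<close> workers divided by \<open>M^2\<close> leave the
  \<open>1 / M\<close> of \<open>quantization_weights_le\<close>.\<close>

lemma msq_rerr_le:
  "msq (rerr n) / (real M)\<^sup>2 \<le> \<gamma>\<^sup>2 * (((1 + qq) ^ M - 1) / real M * (2 * real K * \<sigma>\<^sup>2)
     + (\<Sum>t<M. qq * (1 + qq) ^ (M - 1 - t) * (real t + 1)) / real M * mean M (\<lambda>m. \<Sum>i\<in>UNIV. lr.nb m i))"
proof -
  let ?w = "\<lambda>t. qq * (1 + qq) ^ (M - 1 - t)"
  let ?a = "\<lambda>i. \<Sum>m=1..M. lr.na m i" and ?b = "\<lambda>i. \<Sum>m=1..M. lr.nb m i"
  have q0: "qq \<ge> 0" by (simp add: qq_def)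
  have M0: "real M > 0" using M by simp
  have qj: "msq (qerr n j) \<le> (\<Sum>t<M. ?w t * (\<gamma>\<^sup>2 * (\<Sum>i\<in>seg_set M pos j. ?a i + (real t + 1) * ?b i)))"
    if j: "j \<in> {1..M}" for j
  proof -
    interpret qc: quantizer_chain P R s \<zeta> "W n j" M "part n j" "NW n j" "seg_set M pos j" by (rule qc[OF j])
    have "msq (qerr n j) \<le> (\<Sum>t<M. ?w t * msq (qc.psum (Suc t)))"
      using qc.err_le unfolding qerr_eq[OF j] msq_def card_seg_set[OF pos dvd j] qq_def .
    also have "\<dots> \<le> (\<Sum>t<M. ?w t * (\<gamma>\<^sup>2 * (\<Sum>i\<in>seg_set M pos j. ?a i + (real t + 1) * ?b i)))"
      using msq_psum_le[OF j] q0 unfolding qc.psum_def[abs_def] by (intro sum_mono mult_left_mono) auto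
    finally show ?thesis .
  qed
  have "msq (rerr n) = (\<Sum>i\<in>UNIV. msq (\<lambda>\<omega>. rerr n \<omega> $ i))" by (rule lr.sum_msq_nth[OF rerr_sq, symmetric])
  also have "\<dots> = (\<Sum>j=1..M. \<Sum>i\<in>seg_set M pos j. msq (\<lambda>\<omega>. rerr n \<omega> $ i))"
    by (rule sum_seg_set[OF pos dvd, symmetric])
  also have "\<dots> = (\<Sum>j=1..M. \<Sum>i\<in>seg_set M pos j. msq (\<lambda>\<omega>. qerr n j \<omega> $ i))"
  proof (intro sum.cong refl)
    fix j i assume j: "j \<in> {1..M}" and i: "i \<in> seg_set M pos j"
    have "rerr n \<omega> $ i = qerr n j \<omega> $ i" for \<omega>
    proof -
      have "rerr n \<omega> $ i = (\<Sum>j'=1..M. if j' = j then qerr n j \<omega> $ i else 0)"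
        unfolding rerr_def sum_component
      proof (intro sum.cong refl)
        fix j' assume j': "j' \<in> {1..M}"
        have "i \<notin> seg_set M pos j'" if "j' \<noteq> j"
          using seg_set_iff(2)[OF pos dvd, of j i] seg_set_iff(2)[OF pos dvd, of j' i] i j j' that by auto
        then show "qerr n j' \<omega> $ i = (if j' = j then qerr n j \<omega> $ i else 0)"
          using qerr_supp[OF j'] by auto
      qed
      then show ?thesis using j by simp
    qed
    then show "msq (\<lambda>\<omega>. rerr n \<omega> $ i) = msq (\<lambda>\<omega>. qerr n j \<omega> $ i)" by simp
  qed
  also have "\<dots> \<le> (\<Sum>j=1..M. msq (qerr n j))"
  proof (rule sum_mono)
    fix j assume j: "j \<in> {1..M}"
    show "(\<Sum>i\<in>seg_set M pos j. msq (\<lambda>\<omega>. qerr n j \<omega> $ i)) \<le> msq (qerr n j)"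
      unfolding lr.sum_msq_nth[OF qerr_sq[OF j], symmetric] by (intro sum_mono2) (auto simp: msq_nonneg)
  qed
  also have "\<dots> \<le> (\<Sum>j=1..M. \<Sum>t<M. ?w t * (\<gamma>\<^sup>2 * (\<Sum>i\<in>seg_set M pos j. ?a i + (real t + 1) * ?b i)))"
    by (intro sum_mono qj)
  also have "\<dots> = (\<Sum>t<M. \<Sum>j=1..M. ?w t * (\<gamma>\<^sup>2 * (\<Sum>i\<in>seg_set M pos j. ?a i + (real t + 1) * ?b i)))"
    by (rule sum.swap)
  also have "\<dots> = (\<Sum>t<M. ?w t * (\<gamma>\<^sup>2 * (\<Sum>i\<in>UNIV. ?a i + (real t + 1) * ?b i)))"
    by (simp only: sum_distrib_left[symmetric] sum_seg_set[OF pos dvd])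
  also have "\<dots> = \<gamma>\<^sup>2 * ((\<Sum>t<M. ?w t) * (\<Sum>i\<in>UNIV. ?a i) + (\<Sum>t<M. ?w t * (real t + 1)) * (\<Sum>i\<in>UNIV. ?b i))"
  proof -
    define A B where "A = (\<Sum>i\<in>UNIV. ?a i)" and "B = (\<Sum>i\<in>UNIV. ?b i)"
    have "(\<Sum>i\<in>UNIV. ?a i + (real t + 1) * ?b i) = A + (real t + 1) * B" for t
      by (simp only: sum.distrib sum_distrib_left[symmetric] A_def B_def)
    then have "(\<Sum>t<M. ?w t * (\<gamma>\<^sup>2 * (\<Sum>i\<in>UNIV. ?a i + (real t + 1) * ?b i)))
        = (\<Sum>t<M. \<gamma>\<^sup>2 * (?w t * A + ?w t * (real t + 1) * B))"
      by (simp add: algebra_simps)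
    also have "\<dots> = \<gamma>\<^sup>2 * ((\<Sum>t<M. ?w t) * A + (\<Sum>t<M. ?w t * (real t + 1)) * B)"
      by (simp only: sum_distrib_left[symmetric] sum.distrib sum_distrib_right[symmetric])
    finally show ?thesis by (simp only: A_def B_def)
  qed
  also have "\<dots> \<le> \<gamma>\<^sup>2 * (((1 + qq) ^ M - 1) * (real M * (2 * real K * \<sigma>\<^sup>2))
      + (\<Sum>t<M. ?w t * (real t + 1)) * (real M * mean M (\<lambda>m. \<Sum>i\<in>UNIV. lr.nb m i)))"
  proof (intro mult_left_mono add_mono)
    show "(\<Sum>t<M. ?w t) * (\<Sum>i\<in>UNIV. ?a i) \<le> ((1 + qq) ^ M - 1) * (real M * (2 * real K * \<sigma>\<^sup>2))"
      unfolding geometric_weight_sum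
    proof (rule mult_left_mono)
      have "(\<Sum>i\<in>UNIV. ?a i) = (\<Sum>m=1..M. \<Sum>i\<in>UNIV. lr.na m i)" by (rule sum.swap)
      also have "\<dots> \<le> (\<Sum>m=1..M. 2 * real K * \<sigma>\<^sup>2)" by (intro sum_mono lr.sum_na_le)
      finally show "(\<Sum>i\<in>UNIV. ?a i) \<le> real M * (2 * real K * \<sigma>\<^sup>2)" by simp
    qed (use q0 in \<open>simp add: one_le_power\<close>)
    show "(\<Sum>i\<in>UNIV. ?b i) \<le> real M * mean M (\<lambda>m. \<Sum>i\<in>UNIV. lr.nb m i)"
      unfolding mean_def using M0 by (subst sum.swap) simp
  qed (use q0 in \<open>auto intro!: sum_nonneg\<close>)
  finally have "msq (rerr n) / (real M)\<^sup>2 \<le> (\<gamma>\<^sup>2 * (((1 + qq) ^ M - 1) * (real M * (2 * real K * \<sigma>\<^sup>2))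
      + (\<Sum>t<M. ?w t * (real t + 1)) * (real M * mean M (\<lambda>m. \<Sum>i\<in>UNIV. lr.nb m i)))) / (real M)\<^sup>2"
    by (intro divide_right_mono) auto
  also have "\<dots> = \<gamma>\<^sup>2 * (((1 + qq) ^ M - 1) / real M * (2 * real K * \<sigma>\<^sup>2)
     + (\<Sum>t<M. ?w t * (real t + 1)) / real M * mean M (\<lambda>m. \<Sum>i\<in>UNIV. lr.nb m i))"
  proof -
    have "(c * (e1 * (r * y) + e2 * (r * z))) / r\<^sup>2 = c * (e1 / r * y + e2 / r * z)"
      if "r > 0" for c e1 e2 r y z :: real
      using that by (simp add: power2_eq_square field_simps)
    from this[OF M0] show ?thesis .
  qed
  finally show ?thesis .
qed

lemma xt_Suc_sq: "sq_integrable P (xt (Suc n))"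
proof -
  have "sq_integrable P (\<lambda>\<omega>. lr.xb K \<omega> - (1 / real M) *\<^sub>R rerr n \<omega>)"
    by (intro sq_integrable_diff sq_integrable_scaleR rerr_sq lr.xb_sq) simp
  then show ?thesis
    using sq_integrable_cong[of P "xt (Suc n)" "\<lambda>\<omega>. lr.xb K \<omega> - (1 / real M) *\<^sub>R rerr n \<omega>"] xt_Suc[OF n]
    by (simp add: xb_eq)
qed

text \<open>Two kinds of descent are chained: \<open>descent_local\<close> for the \<open>K\<close>
  averaged steps, and one more application of the descent lemma to the displacement by the
  quantization error, whose linear term vanishes by \<open>rerr_orth\<close>. Dividing by
  \<open>\<gamma> / 2\<close> gives the inequality that \<open>round_arithmetic\<close>
  closes.\<close>

lemma round:
  fixes F :: "real^'d \<Rightarrow> real" and a C1 \<epsilon> \<delta> :: real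
  assumes F: "\<And>y. GDERIV F y :> mean M (\<lambda>m. gm m y)" and c: "\<And>y. c \<le> F y"
    and a: "a = real CARD('d) / (4 * (real s)\<^sup>2)"
    and C1: "C1 = 1 / real M * exp a + 1 / a * (a / real M + 1) ^ (M - 1) - (1 / a + 1)"
    and \<delta>: "\<delta> > 0" and \<epsilon>: "\<epsilon> > 0"
    and step_1: "(8 * C1 * L\<^sup>2 * \<gamma>\<^sup>2 + (real K - 1) * L * \<gamma> + 2 * C1) * real K * L * \<gamma>
         / (1 - 2 * (real K + 1) * (real K - 2) * L\<^sup>2 * \<gamma>\<^sup>2) \<le> (1 - \<epsilon>) / 2"
    and step_2: "2 * (real K + 1) * (real K - 2) * L\<^sup>2 * \<gamma>\<^sup>2 \<le> 1 - \<delta>"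
    and step_3: "1 - L * \<gamma> - (4 * real K * L * \<gamma> * C1 + 1) * (real K - 1) * real K * L\<^sup>2 * \<gamma>\<^sup>2
         / (1 - 2 * (real K + 1) * (real K - 2) * L\<^sup>2 * \<gamma>\<^sup>2) > 0"
  shows "\<epsilon> * (\<Sum>k<K. msq (\<lambda>\<omega>. mean M (\<lambda>m. gm m (mean M (\<lambda>m. x n k m \<omega>)))))
    \<le> 2 / \<gamma> * ((\<integral>\<omega>. F (xt n \<omega>) \<partial>P) - (\<integral>\<omega>. F (xt (Suc n) \<omega>) \<partial>P))
      + real K * ((4 * real K * (L * \<gamma>) * C1 + 1) / \<delta> * (\<sigma>\<^sup>2 * (1 + 1 / real M) / 2 + 2 * real K * \<kappa>\<^sup>2) * (real K - 1) * (L * \<gamma>)\<^sup>2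
      + (2 * C1 * \<sigma>\<^sup>2 + 4 * real K * C1 * \<kappa>\<^sup>2 + \<sigma>\<^sup>2 * (1 / real M)) * (L * \<gamma>))"
proof -
  define Z where "Z = lr.XX / (1 - lr.DD) * (\<sigma>\<^sup>2 * (1 + 1 / real M) / 2 + 2 * real K * \<kappa>\<^sup>2 + 2 * lr.SG + lr.SH)"
  let ?m = "1 / real M"
  have Mr: "real M > 0" using M by simp
  have K1: "real K \<ge> 1" using K by simp
  have u: "L * \<gamma> = lr.u" by (simp add: lr.u_def)
  have u2: "L\<^sup>2 * \<gamma>\<^sup>2 = lr.u\<^sup>2" by (simp add: lr.u_def power_mult_distrib)
  have DD: "2 * (real K + 1) * (real K - 2) * L\<^sup>2 * \<gamma>\<^sup>2 = lr.DD" by (simp add: lr.DD_def u2[symmetric])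
  have s0: "(real s)\<^sup>2 > 0" using s by simp
  have a0: "a > 0" unfolding a using s0 by simp
  have q: "qq = a / real M"
    using dvd by (simp add: qq_def a real_of_nat_div)
  note wt = quantization_weights_le[OF a0 M q C1[folded q]]
  have D1: "lr.DD < 1" using step_2 \<delta> unfolding DD by simp
  have X0: "lr.XX \<ge> 0" by (rule lr.XX_nonneg)
  have s1: "(8 * C1 * lr.u\<^sup>2 + (real K - 1) * lr.u + 2 * C1) * real K * lr.u / (1 - lr.DD) \<le> (1 - \<epsilon>) / 2"
  proof -
    have "(8 * C1 * L\<^sup>2 * \<gamma>\<^sup>2 + (real K - 1) * L * \<gamma> + 2 * C1) * real K * L * \<gamma>
        = (8 * C1 * lr.u\<^sup>2 + (real K - 1) * lr.u + 2 * C1) * real K * lr.u"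
      by (simp add: lr.u_def power_mult_distrib mult.assoc)
    from step_1[unfolded DD this] show ?thesis .
  qed
  have s3: "1 - lr.u - (4 * real K * lr.u * C1 + 1) * (real K - 1) * real K * lr.u\<^sup>2 / (1 - lr.DD) > 0"
  proof -
    have "(4 * real K * L * \<gamma> * C1 + 1) * (real K - 1) * real K * L\<^sup>2 * \<gamma>\<^sup>2
        = (4 * real K * lr.u * C1 + 1) * (real K - 1) * real K * lr.u\<^sup>2"
      by (simp add: lr.u_def power_mult_distrib mult.assoc)
    from step_3[unfolded DD this u] show ?thesis .
  qed
  \<comment> \<open>The first step size condition with the nonnegative \<open>C1\<close> terms and
    \<open>\<epsilon>\<close> dropped.\<close>
  have X2: "2 * lr.XX \<le> 1 - lr.DD"
  proof -
    have "(real K - 1) * lr.u * (real K * lr.u) \<le> (8 * C1 * lr.u\<^sup>2 + (real K - 1) * lr.u + 2 * C1) * (real K * lr.u)"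
      using wt(4) lr.u_pos by (intro mult_right_mono) auto
    also have "\<dots> \<le> (1 - \<epsilon>) / 2 * (1 - lr.DD)"
      using s1 D1 by (simp add: pos_divide_le_eq mult.assoc)
    also have "\<dots> \<le> 1 / 2 * (1 - lr.DD)" using \<epsilon> D1 by (intro mult_right_mono) auto
    finally show ?thesis by (simp add: lr.XX_def power2_eq_square mult_ac)
  qed
  have DX: "lr.DD \<le> 2 * lr.XX"
  proof -
    have "2 * (real K + 1) * (real K - 2) \<le> 2 * (real K * (real K - 1))" by (simp add: algebra_simps)
    then have "lr.DD \<le> 2 * (real K * (real K - 1)) * lr.u\<^sup>2"
      unfolding lr.DD_def by (rule mult_right_mono) simp
    then show ?thesis by (simp add: lr.XX_def mult.assoc)
  qed
  \<comment> \<open>For \<open>K = 1\<close> the value of \<open>DD\<close> is negative, but then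
    \<open>XX\<close> vanishes.\<close>
  have X0D: "lr.XX = 0 \<or> lr.DD \<ge> 0"
    using lr.K_1(3) lr.DD_nonneg K by (cases "K = 1") auto
  have SV0: "0 \<le> lr.SV" by (rule lr.SV_nonneg)
  have budget: "2 * (((1 + qq) ^ M - 1) / real M) * \<sigma>\<^sup>2
      + (\<Sum>t<M. qq * (1 + qq) ^ (M - 1 - t) * (real t + 1)) / real M
        * (8 / 3 * (real K * \<kappa>\<^sup>2 + lr.SG) + 47 / 20 * lr.SV + 3 / 2 * lr.XX * (\<sigma>\<^sup>2 / real M + lr.SH))
    \<le> C1 * (2 * \<sigma>\<^sup>2 + 4 * real K * \<kappa>\<^sup>2 + 4 * lr.SG + 4 * Z)"
    by (rule quantization_budget[OF M wt(1,2,3,4) X0 _ _ lr.SG_nonneg lr.SH_nonneg SV0 _ D1 X2 DX X0D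
          lr.SV_bound Z_def]) (use K1 in auto)
  have "msq (rerr n) / (real M)\<^sup>2 \<le> \<gamma>\<^sup>2 * (((1 + qq) ^ M - 1) / real M * (2 * real K * \<sigma>\<^sup>2)
     + (\<Sum>t<M. qq * (1 + qq) ^ (M - 1 - t) * (real t + 1)) / real M
       * (real K * (8 / 3 * (real K * \<kappa>\<^sup>2 + lr.SG) + 47 / 20 * lr.SV + 3 / 2 * lr.XX * (\<sigma>\<^sup>2 / real M + lr.SH))))"
  proof (rule order_trans[OF msq_rerr_le], intro mult_left_mono add_left_mono)
    show "0 \<le> (\<Sum>t<M. qq * (1 + qq) ^ (M - 1 - t) * (real t + 1)) / real M"
      by (auto intro!: divide_nonneg_nonneg sum_nonneg simp: qq_def)
  qed (use lr.mean_sum_nb_le in auto)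
  also have "\<dots> = \<gamma>\<^sup>2 * (real K * (2 * (((1 + qq) ^ M - 1) / real M) * \<sigma>\<^sup>2
      + (\<Sum>t<M. qq * (1 + qq) ^ (M - 1 - t) * (real t + 1)) / real M
        * (8 / 3 * (real K * \<kappa>\<^sup>2 + lr.SG) + 47 / 20 * lr.SV + 3 / 2 * lr.XX * (\<sigma>\<^sup>2 / real M + lr.SH))))"
    by (simp add: distrib_left mult.assoc mult.left_commute)
  also have "\<dots> \<le> \<gamma>\<^sup>2 * (real K * (C1 * (2 * \<sigma>\<^sup>2 + 4 * real K * \<kappa>\<^sup>2 + 4 * lr.SG + 4 * Z)))"
    by (intro mult_left_mono budget) auto
  finally have E: "msq (rerr n) / (real M)\<^sup>2 \<le> \<gamma>\<^sup>2 * (real K * (C1 * (2 * \<sigma>\<^sup>2 + 4 * real K * \<kappa>\<^sup>2 + 4 * lr.SG + 4 * Z)))" .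
  let ?G = "\<lambda>y. mean M (\<lambda>m. gm m y)"
  have lipG: "L-lipschitz_on UNIV ?G" by (rule lipschitz_on_mean[OF M smooth])
  have Gm: "?G \<in> borel_measurable borel"
    by (intro borel_measurable_continuous_onI lipschitz_on_continuous_on[OF lipG])
  have xbK: "sq_integrable P (lr.xb K)" by (rule lr.xb_sq) simp
  have GxK: "sq_integrable P (\<lambda>\<omega>. ?G (lr.xb K \<omega>))" by (rule sq_integrable_lipschitz[OF xbK lipG])
  note iF = integrable_smooth[OF F lipG c]
  have "(\<integral>\<omega>. F (xt (Suc n) \<omega>) \<partial>P) \<le> (\<integral>\<omega>. F (lr.xb K \<omega>) + (L / 2 * (1 / (real M)\<^sup>2 * (norm (rerr n \<omega>))\<^sup>2)
      - 1 / real M * (rerr n \<omega> \<bullet> ?G (lr.xb K \<omega>))) \<partial>P)"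
  proof (rule integral_mono)
    fix \<omega> assume \<omega>: "\<omega> \<in> space P"
    have e1: "lr.xb K \<omega> + - (1 / real M) *\<^sub>R rerr n \<omega> = xt (Suc n) \<omega>" using xt_Suc[OF n \<omega>] by (simp add: xb_eq)
    have e2: "?G (lr.xb K \<omega>) \<bullet> (- (1 / real M) *\<^sub>R rerr n \<omega>) = - (1 / real M * (rerr n \<omega> \<bullet> ?G (lr.xb K \<omega>)))"
      by (simp add: inner_commute)
    have e3: "(norm (- (1 / real M) *\<^sub>R rerr n \<omega>))\<^sup>2 = 1 / (real M)\<^sup>2 * (norm (rerr n \<omega>))\<^sup>2"
      by (simp add: power_mult_distrib power_divide)
    show "F (xt (Suc n) \<omega>) \<le> F (lr.xb K \<omega>) + (L / 2 * (1 / (real M)\<^sup>2 * (norm (rerr n \<omega>))\<^sup>2)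
      - 1 / real M * (rerr n \<omega> \<bullet> ?G (lr.xb K \<omega>)))"
      using lipschitz_gradient_descent[OF F lipG, of "lr.xb K \<omega>" "- (1 / real M) *\<^sub>R rerr n \<omega>"]
      unfolding e1 e2 e3 by linarith
  qed (auto intro!: iF xt_Suc_sq xbK Bochner_Integration.integrable_add Bochner_Integration.integrable_diff
      integrable_mult_right sq_integrable_norm sq_integrable_inner rerr_sq GxK)
  also have "\<dots> = (\<integral>\<omega>. F (lr.xb K \<omega>) \<partial>P) + L / 2 * (msq (rerr n) / (real M)\<^sup>2)"
    using iF[OF xbK] sq_integrable_norm[OF rerr_sq] sq_integrable_inner[OF rerr_sq GxK] rerr_orth[OF Gm GxK]
    by (simp add: msq_def)
  finally have "(\<integral>\<omega>. F (xt (Suc n) \<omega>) \<partial>P) \<le> (\<integral>\<omega>. F (lr.xb K \<omega>) \<partial>P) + L / 2 * (msq (rerr n) / (real M)\<^sup>2)" .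
  moreover have "(\<integral>\<omega>. F (lr.xb K \<omega>) \<partial>P) \<le> (\<integral>\<omega>. F (lr.xb 0 \<omega>) \<partial>P)
    - \<gamma> / 2 * (lr.SG + (1 - lr.u) * lr.SH - lr.SD) + real K * (L * \<gamma>\<^sup>2 / 2 * (\<sigma>\<^sup>2 / real M))"
    by (rule lr.descent_local[OF F lipG c])
  moreover have "(\<integral>\<omega>. F (lr.xb 0 \<omega>) \<partial>P) = (\<integral>\<omega>. F (xt n \<omega>) \<partial>P)"
    using lr.xb_0[of 1] local_init[OF n, of 1] M by (intro Bochner_Integration.integral_cong) auto
  moreover have "L / 2 * (msq (rerr n) / (real M)\<^sup>2)
      \<le> L / 2 * (\<gamma>\<^sup>2 * (real K * (C1 * (2 * \<sigma>\<^sup>2 + 4 * real K * \<kappa>\<^sup>2 + 4 * lr.SG + 4 * Z))))"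
    using L E by (intro mult_left_mono) auto
  ultimately have "(\<integral>\<omega>. F (xt (Suc n) \<omega>) \<partial>P) \<le> (\<integral>\<omega>. F (xt n \<omega>) \<partial>P)
    - \<gamma> / 2 * (lr.SG + (1 - lr.u) * lr.SH - lr.SD) + real K * (L * \<gamma>\<^sup>2 / 2 * (\<sigma>\<^sup>2 / real M))
    + L / 2 * (\<gamma>\<^sup>2 * (real K * (C1 * (2 * \<sigma>\<^sup>2 + 4 * real K * \<kappa>\<^sup>2 + 4 * lr.SG + 4 * Z))))"
    by linarith
  then have "\<gamma> / 2 * (lr.SG + (1 - lr.u) * lr.SH)
    \<le> \<gamma> / 2 * (2 / \<gamma> * ((\<integral>\<omega>. F (xt n \<omega>) \<partial>P) - (\<integral>\<omega>. F (xt (Suc n) \<omega>) \<partial>P)) + lr.SD + real K * lr.u * (\<sigma>\<^sup>2 * ?m)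
        + lr.u * real K * C1 * (2 * \<sigma>\<^sup>2 + 4 * real K * \<kappa>\<^sup>2 + 4 * lr.SG + 4 * Z))"
    using \<gamma> by (simp add: lr.u_def power2_eq_square algebra_simps add_divide_distrib diff_divide_distrib)
  then have descent: "lr.SG + (1 - lr.u) * lr.SH
    \<le> 2 / \<gamma> * ((\<integral>\<omega>. F (xt n \<omega>) \<partial>P) - (\<integral>\<omega>. F (xt (Suc n) \<omega>) \<partial>P)) + lr.SD + real K * lr.u * (\<sigma>\<^sup>2 * ?m)
        + lr.u * real K * C1 * (2 * \<sigma>\<^sup>2 + 4 * real K * \<kappa>\<^sup>2 + 4 * lr.SG + 4 * Z)"
    using \<gamma> by (subst (asm) mult_le_cancel_left_pos) auto
  have "\<epsilon> * lr.SG \<le> 2 / \<gamma> * ((\<integral>\<omega>. F (xt n \<omega>) \<partial>P) - (\<integral>\<omega>. F (xt (Suc n) \<omega>) \<partial>P))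
      + real K * ((4 * real K * lr.u * C1 + 1) / \<delta> * (\<sigma>\<^sup>2 * (1 + ?m) / 2 + 2 * real K * \<kappa>\<^sup>2) * (real K - 1) * lr.u\<^sup>2
      + (2 * C1 * \<sigma>\<^sup>2 + 4 * real K * C1 * \<kappa>\<^sup>2 + \<sigma>\<^sup>2 * ?m) * lr.u)"
    by (rule round_arithmetic[OF lr.u_pos wt(4) K1 _ _ _ lr.SG_nonneg lr.SH_nonneg \<delta> lr.XX_def lr.DD_def s1
          step_2[unfolded DD] s3 Z_def lr.SD_bound[OF D1, folded Z_def] descent]) (use Mr in auto)
  then show ?thesis
    by (simp add: lr.SG_def lr.ga_def[abs_def] lr.p_def lr.xb_def u)
qed

end

section \<open>Integrability across the rounds and summation over them\<close>

lemma mean_gradient_sq: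
  assumes n: "n \<in> {1..N}" and xt: "sq_integrable P (xt n)" and k: "k \<le> K"
  shows "sq_integrable P (\<lambda>\<omega>. mean M (\<lambda>m. gm m (mean M (\<lambda>m. x n k m \<omega>))))"
proof -
  have "sq_integrable P (\<lambda>\<omega>. mean M (\<lambda>m. x n k m \<omega>))"
    using x_sq[OF n xt] k by (intro sq_integrable_mean)
  from sq_integrable_lipschitz[OF this lipschitz_on_mean[OF M smooth]] show ?thesis .
qed

lemma xt_sq: "1 \<le> n \<Longrightarrow> n \<le> N + 1 \<Longrightarrow> sq_integrable P (xt n)"
proof (induction n rule: dec_induct)
  case base
  show ?case using sq_integrable_cong[of P "xt 1" "\<lambda>_. x1"] init by (simp add: sq_integrable_const)
next
  case (step n)
  then show ?case by (intro xt_Suc_sq) auto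
qed

end

theorem theorem1:
  fixes M K N s :: nat
    and D :: "nat \<Rightarrow> 'z measure"
    and f :: "nat \<Rightarrow> real^'d \<Rightarrow> 'z \<Rightarrow> real"
    and Fm :: "nat \<Rightarrow> real^'d \<Rightarrow> real"
    and F :: "real^'d \<Rightarrow> real"
    and Fstar :: real
    and L \<sigma> \<kappa> \<gamma> \<epsilon> \<delta> d C1 :: real
    and pos :: "'d \<Rightarrow> nat"
    and P :: "'a measure"
    and R :: "'w measure"
    and \<zeta> :: "real \<Rightarrow> 'w \<Rightarrow> nat"
    and \<xi> :: "nat \<Rightarrow> nat \<Rightarrow> nat \<Rightarrow> 'a \<Rightarrow> 'z"
    and W :: "nat \<Rightarrow> nat \<Rightarrow> nat \<Rightarrow> 'd \<Rightarrow> 'a \<Rightarrow> 'w"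
    and x1 :: "real^'d"
    and xt :: "nat \<Rightarrow> 'a \<Rightarrow> real^'d"
    and x :: "nat \<Rightarrow> nat \<Rightarrow> nat \<Rightarrow> 'a \<Rightarrow> real^'d"
    and g :: "nat \<Rightarrow> nat \<Rightarrow> 'a \<Rightarrow> real^'d"
    and xbar :: "nat \<Rightarrow> nat \<Rightarrow> 'a \<Rightarrow> real^'d"
  assumes sizes: "M \<ge> 1" "K \<ge> 1" "N \<ge> 1" "s \<ge> 1"
    and d: "d = real CARD('d)" "M dvd CARD('d)"
    and data: "\<And>m. m \<in> {1..M} \<Longrightarrow> prob_space (D m)"
    and loss_integrable: "\<And>m y. m \<in> {1..M} \<Longrightarrow> integrable (D m) (f m y)"
    and loss_differentiable:
      "\<And>m y z. m \<in> {1..M} \<Longrightarrow> z \<in> space (D m) \<Longrightarrow> (\<lambda>u. f m u z) differentiable (at y)"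
    and gradient_measurable:
      "\<And>m. m \<in> {1..M} \<Longrightarrow>
         (\<lambda>(y, z). gradient (\<lambda>u. f m u z) y) \<in> borel_measurable (borel \<Otimes>\<^sub>M D m)"
    and Fm: "\<And>m. m \<in> {1..M} \<Longrightarrow> Fm m = local_obj (D m) (f m)"
    and F: "F = global_obj M D f"
    and Fstar: "bdd_below (range F)" "Fstar = (INF y. F y)"
    and unbiased:
      "\<And>m y. m \<in> {1..M} \<Longrightarrow>
         has_bochner_integral (D m) (\<lambda>z. gradient (\<lambda>u. f m u z) y) (gradient (Fm m) y)"
    and L: "L > 0"
    and Fm_differentiable: "\<And>m y. m \<in> {1..M} \<Longrightarrow> Fm m differentiable (at y)"
    and Fm_smooth: "\<And>m. m \<in> {1..M} \<Longrightarrow> L-lipschitz_on UNIV (gradient (Fm m))"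
    and variance_nonneg: "\<sigma> \<ge> 0" "\<kappa> \<ge> 0"
    and variance_integrable:
      "\<And>m y. m \<in> {1..M} \<Longrightarrow>
         integrable (D m) (\<lambda>z. (norm (gradient (\<lambda>u. f m u z) y - gradient (Fm m) y))\<^sup>2)"
    and variance_local:
      "\<And>m y. m \<in> {1..M} \<Longrightarrow>
         (\<integral>z. (norm (gradient (\<lambda>u. f m u z) y - gradient (Fm m) y))\<^sup>2 \<partial>D m) \<le> \<sigma>\<^sup>2"
    and variance_global:
      "\<And>y. (\<Sum>m=1..M. (norm (gradient F y - gradient (Fm m) y))\<^sup>2) / real M \<le> \<kappa>\<^sup>2"
    and P: "prob_space P"
    and rounding: "stochastic_rounding R s \<zeta>"
    and sample_law:
      "\<And>n k m. n \<in> {1..N} \<Longrightarrow> k < K \<Longrightarrow> m \<in> {1..M} \<Longrightarrow> distr P (D m) (\<xi> n k m) = D m"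
    and seed_law:
      "\<And>n j t i. n \<in> {1..N} \<Longrightarrow> j \<in> {1..M} \<Longrightarrow> t < M \<Longrightarrow> distr P R (W n j t i) = R"
    and independent:
      "independent_families P
         ({1..N} \<times> {..<K} \<times> {1..M}) (\<lambda>(n, k, m). D m) (\<lambda>(n, k, m). \<xi> n k m)
         ({1..N} \<times> {1..M} \<times> {..<M} \<times> UNIV) (\<lambda>_. R) (\<lambda>(n, j, t, i). W n j t i)"
    and pos: "bij_betw pos UNIV {1..CARD('d)}"
    and step: "\<gamma> > 0"
    and init: "\<And>\<omega>. \<omega> \<in> space P \<Longrightarrow> xt 1 \<omega> = x1"
    and local_init:
      "\<And>n m \<omega>. n \<in> {1..N} \<Longrightarrow> m \<in> {1..M} \<Longrightarrow> \<omega> \<in> space P \<Longrightarrow> x n 0 m \<omega> = xt n \<omega>"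
    and local_update:
      "\<And>n k m \<omega>. n \<in> {1..N} \<Longrightarrow> k < K \<Longrightarrow> m \<in> {1..M} \<Longrightarrow> \<omega> \<in> space P \<Longrightarrow>
         x n (k + 1) m \<omega> =
           x n k m \<omega> - \<gamma> *\<^sub>R gradient (\<lambda>u. f m u (\<xi> n k m \<omega>)) (x n k m \<omega>)"
    and increment:
      "\<And>n m \<omega>. n \<in> {1..N} \<Longrightarrow> m \<in> {1..M} \<Longrightarrow> \<omega> \<in> space P \<Longrightarrow>
         g n m \<omega> = x n 0 m \<omega> - x n K m \<omega>"
    and global_update:
      "\<And>n \<omega>. n \<in> {1..N} \<Longrightarrow> \<omega> \<in> space P \<Longrightarrow>
         xt (n + 1) \<omega> =
           xt n \<omega> - (1 / real M) *\<^sub>R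
             ring_all_reduce M s pos \<zeta> (\<lambda>j t i. W n j t i \<omega>) (\<lambda>m. g n m \<omega>)"
    and average:
      "\<And>n k \<omega>. n \<in> {1..N} \<Longrightarrow> k < K \<Longrightarrow> \<omega> \<in> space P \<Longrightarrow>
         xbar n k \<omega> = (1 / real M) *\<^sub>R (\<Sum>m=1..M. x n k m \<omega>)"
    and C1: "C1 = 1 / M * exp (d / (4 * s\<^sup>2))
                  + 4 * s\<^sup>2 / d * (d / (4 * s\<^sup>2 * M) + 1) ^ (M - 1)
                  - (4 * s\<^sup>2 / d + 1)"
    and \<epsilon>: "\<epsilon> \<in> {0<..<1}"
    and \<delta>: "\<delta> \<in> {0<..<1}"
    and step_1:
      "(8 * C1 * L\<^sup>2 * \<gamma>\<^sup>2 + (real K - 1) * L * \<gamma> + 2 * C1) * K * L * \<gamma>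
         / (1 - 2 * (real K + 1) * (real K - 2) * L\<^sup>2 * \<gamma>\<^sup>2) \<le> (1 - \<epsilon>) / 2"
    and step_2: "2 * (real K + 1) * (real K - 2) * L\<^sup>2 * \<gamma>\<^sup>2 \<le> 1 - \<delta>"
    and step_3:
      "1 - L * \<gamma> - (4 * K * L * \<gamma> * C1 + 1) * (real K - 1) * K * L\<^sup>2 * \<gamma>\<^sup>2
         / (1 - 2 * (real K + 1) * (real K - 2) * L\<^sup>2 * \<gamma>\<^sup>2) > 0"
  shows "(\<forall>n\<in>{1..N}. \<forall>k<K. integrable P (\<lambda>\<omega>. (norm (gradient F (xbar n k \<omega>)))\<^sup>2)) \<and>
    1 / (real N * real K) *
      (\<Sum>n=1..N. \<Sum>k<K. \<integral>\<omega>. (norm (gradient F (xbar n k \<omega>)))\<^sup>2 \<partial>P)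
    \<le> (4 * K * L * \<gamma> * C1 + 1) / (\<delta> * \<epsilon>)
          * (\<sigma>\<^sup>2 * (real M + 1) / (2 * M) + 2 * K * \<kappa>\<^sup>2) * (real K - 1) * L\<^sup>2 * \<gamma>\<^sup>2
      + 1 / \<epsilon> * (2 * C1 * \<sigma>\<^sup>2 + 4 * K * C1 * \<kappa>\<^sup>2 + \<sigma>\<^sup>2 / M) * L * \<gamma>
      + 2 * (F x1 - Fstar) / (N * K * \<gamma> * \<epsilon>)"
proof -
  define gm where "gm m = gradient (Fm m)" for m
  define d' where "d' = real CARD('d) / (4 * (real s)\<^sup>2)"
  \<comment> \<open>The error level per local step; divided by \<open>\<epsilon>\<close> it becomes
    the first two terms of the claim.\<close>
  define cst where "cst = (4 * real K * (L * \<gamma>) * C1 + 1) / \<delta> * (\<sigma>\<^sup>2 * (1 + 1 / real M) / 2 + 2 * real K * \<kappa>\<^sup>2)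
      * (real K - 1) * (L * \<gamma>)\<^sup>2 + (2 * C1 * \<sigma>\<^sup>2 + 4 * real K * C1 * \<kappa>\<^sup>2 + \<sigma>\<^sup>2 * (1 / real M)) * (L * \<gamma>)"
  interpret prob_space P by (rule P)
  have M0: "real M > 0" and K0: "real K > 0" and N0: "real N > 0" and s0: "real s > 0" using sizes by auto
  have Fy: "F = (\<lambda>y. (\<Sum>m=1..M. Fm m y) / real M)"
    unfolding F global_obj_def using Fm by (simp add: fun_eq_iff)
  have GF: "GDERIV F y :> mean M (\<lambda>m. gm m y)" for y
    unfolding Fy mean_def gm_def using Fm_differentiable by (intro gderiv_average gderiv_gradient)
  then have gF: "gradient F = (\<lambda>y. mean M (\<lambda>m. gm m y))" by (intro ext gradient_eqI)
  interpret rs: ring_sgd P M K N s D f gm L \<sigma> \<kappa> \<gamma> pos R \<zeta> \<xi> W x1 xt x g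
  proof (intro ring_sgd.intro ring_sgd_axioms.intro)
    show "mean M (\<lambda>m. (norm (gm m y - mean M (\<lambda>m. gm m y)))\<^sup>2) \<le> \<kappa>\<^sup>2" for y
      using variance_global[of y] unfolding gF by (simp add: mean_def gm_def norm_minus_commute)
  qed (fact P sizes(1,2,4) d(2) data gradient_measurable unbiased[folded gm_def] L step Fm_smooth[folded gm_def]
      variance_integrable[folded gm_def] variance_local[folded gm_def] rounding sample_law seed_law independent
      pos init local_init local_update increment global_update)+
  have xbar: "xbar n k \<omega> = mean M (\<lambda>m. x n k m \<omega>)" if "n \<in> {1..N}" "k < K" "\<omega> \<in> space P" for n k \<omega>
    using average[OF that] by (simp add: mean_def)
  define I where "I n k = msq (\<lambda>\<omega>. mean M (\<lambda>m. gm m (mean M (\<lambda>m. x n k m \<omega>))))" for n k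
  have xt_sq: "sq_integrable P (xt n)" if "n \<in> {1..N + 1}" for n using rs.xt_sq that by auto
  have int: "integrable P (\<lambda>\<omega>. (norm (gradient F (xbar n k \<omega>)))\<^sup>2)"
    and val: "(\<integral>\<omega>. (norm (gradient F (xbar n k \<omega>)))\<^sup>2 \<partial>P) = I n k" if n: "n \<in> {1..N}" and k: "k < K" for n k
  proof -
    have e: "(norm (gradient F (xbar n k \<omega>)))\<^sup>2 = (norm (mean M (\<lambda>m. gm m (mean M (\<lambda>m. x n k m \<omega>)))))\<^sup>2"
      if "\<omega> \<in> space P" for \<omega> using xbar[OF n k that] by (simp add: gF)
    have "sq_integrable P (\<lambda>\<omega>. mean M (\<lambda>m. gm m (mean M (\<lambda>m. x n k m \<omega>))))"
      using n k by (intro rs.mean_gradient_sq xt_sq) auto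
    then show "integrable P (\<lambda>\<omega>. (norm (gradient F (xbar n k \<omega>)))\<^sup>2)"
      using e by (subst Bochner_Integration.integrable_cong[OF refl e]) (auto simp: sq_integrable_def)
    show "(\<integral>\<omega>. (norm (gradient F (xbar n k \<omega>)))\<^sup>2 \<partial>P) = I n k"
      unfolding I_def msq_def using e by (intro Bochner_Integration.integral_cong) auto
  qed
  have low: "Fstar \<le> F y" for y using Fstar by (auto intro: cINF_lower)
  \<comment> \<open>\<open>4 * s^2 / d\<close> is \<open>1 / d'\<close>, the form in which
    \<open>quantization_weights_le\<close> expects the constant.\<close>
  have C1': "C1 = 1 / real M * exp d' + 1 / d' * (d' / real M + 1) ^ (M - 1) - (1 / d' + 1)"
    unfolding C1 d(1) d'_def by (simp add: mult.commute)
  have round: "\<epsilon> * (\<Sum>k<K. I n k) \<le> 2 / \<gamma> * ((\<integral>\<omega>. F (xt n \<omega>) \<partial>P) - (\<integral>\<omega>. F (xt (Suc n) \<omega>) \<partial>P)) + real K * cst"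
    if n: "n \<in> {1..N}" for n
    unfolding I_def cst_def
    using \<delta> \<epsilon> n step_1 step_2 step_3
    by (intro rs.round[OF n xt_sq GF low d'_def C1']) auto
  have "\<epsilon> * (\<Sum>n=1..N. \<Sum>k<K. I n k) = (\<Sum>n=1..N. \<epsilon> * (\<Sum>k<K. I n k))"
    by (rule sum_distrib_left)
  also have "\<dots> \<le> (\<Sum>n=1..N. 2 / \<gamma> * ((\<integral>\<omega>. F (xt n \<omega>) \<partial>P) - (\<integral>\<omega>. F (xt (Suc n) \<omega>) \<partial>P)) + real K * cst)"
    by (intro sum_mono round)
  also have "\<dots> = 2 / \<gamma> * (\<Sum>n=1..N. (\<integral>\<omega>. F (xt n \<omega>) \<partial>P) - (\<integral>\<omega>. F (xt (Suc n) \<omega>) \<partial>P)) + real N * (real K * cst)"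
    by (simp add: sum.distrib sum_distrib_left)
  \<comment> \<open>Telescoping; the last value is then bounded below by \<open>Fstar\<close>, and
    the first is deterministic.\<close>
  also have "(\<Sum>n=1..N. (\<integral>\<omega>. F (xt n \<omega>) \<partial>P) - (\<integral>\<omega>. F (xt (Suc n) \<omega>) \<partial>P))
      = (\<integral>\<omega>. F (xt 1 \<omega>) \<partial>P) - (\<integral>\<omega>. F (xt (Suc N) \<omega>) \<partial>P)"
    by (induction N) auto
  also have "(\<integral>\<omega>. F (xt 1 \<omega>) \<partial>P) = (\<integral>\<omega>. F x1 \<partial>P)"
    using init by (intro Bochner_Integration.integral_cong) auto
  also have "(\<integral>\<omega>. F x1 \<partial>P) = F x1" by (simp add: prob_space)
  also have "2 / \<gamma> * (F x1 - (\<integral>\<omega>. F (xt (Suc N) \<omega>) \<partial>P)) \<le> 2 / \<gamma> * (F x1 - Fstar)"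
  proof (intro mult_left_mono diff_left_mono)
    have "L-lipschitz_on UNIV (\<lambda>y. mean M (\<lambda>m. gm m y))"
      unfolding gm_def by (rule lipschitz_on_mean[OF sizes(1) Fm_smooth])
    from integrable_smooth[OF GF this low xt_sq[of "Suc N"]]
    have "(\<integral>\<omega>. Fstar \<partial>P) \<le> (\<integral>\<omega>. F (xt (Suc N) \<omega>) \<partial>P)" using low by (intro integral_mono) auto
    then show "Fstar \<le> (\<integral>\<omega>. F (xt (Suc N) \<omega>) \<partial>P)" by (simp add: prob_space)
  qed (use step in simp)
  finally have total: "\<epsilon> * (\<Sum>n=1..N. \<Sum>k<K. I n k) \<le> 2 / \<gamma> * (F x1 - Fstar) + real N * (real K * cst)"
    by simp
  have \<epsilon>0: "\<epsilon> > 0" using \<epsilon> by simp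
  have "1 / (real N * real K) * (\<Sum>n=1..N. \<Sum>k<K. I n k)
      = \<epsilon> * (\<Sum>n=1..N. \<Sum>k<K. I n k) / (real N * real K * \<epsilon>)" using \<epsilon>0 by simp
  also have "\<dots> \<le> (2 / \<gamma> * (F x1 - Fstar) + real N * (real K * cst)) / (real N * real K * \<epsilon>)"
    using N0 K0 \<epsilon>0 by (intro divide_right_mono[OF total]) simp
  also have "\<dots> = cst / \<epsilon> + 2 * (F x1 - Fstar) / (real N * real K * \<gamma> * \<epsilon>)"
    using N0 K0 \<epsilon>0 step by (simp add: add_divide_distrib field_simps)
  also have "cst / \<epsilon> = (4 * real K * L * \<gamma> * C1 + 1) / (\<delta> * \<epsilon>)
          * (\<sigma>\<^sup>2 * (real M + 1) / (2 * real M) + 2 * real K * \<kappa>\<^sup>2) * (real K - 1) * L\<^sup>2 * \<gamma>\<^sup>2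
      + 1 / \<epsilon> * (2 * C1 * \<sigma>\<^sup>2 + 4 * real K * C1 * \<kappa>\<^sup>2 + \<sigma>\<^sup>2 / real M) * L * \<gamma>"
  proof -
    have 1: "\<sigma>\<^sup>2 * (1 + 1 / real M) / 2 = \<sigma>\<^sup>2 * (real M + 1) / (2 * real M)"
      using M0 by (simp add: field_simps)
    have 2: "\<sigma>\<^sup>2 * (1 / real M) = \<sigma>\<^sup>2 / real M" "4 * real K * (L * \<gamma>) * C1 = 4 * real K * L * \<gamma> * C1"
      by (simp_all add: mult.assoc)
    have "(A / \<delta> * B * k * (L * \<gamma>)\<^sup>2 + E * (L * \<gamma>)) / \<epsilon>
        = A / (\<delta> * \<epsilon>) * B * k * L\<^sup>2 * \<gamma>\<^sup>2 + 1 / \<epsilon> * E * L * \<gamma>" for A B k E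
      by (simp add: add_divide_distrib power_mult_distrib)
    then show ?thesis unfolding cst_def 1 2 .
  qed
  finally have "1 / (real N * real K) * (\<Sum>n=1..N. \<Sum>k<K. \<integral>\<omega>. (norm (gradient F (xbar n k \<omega>)))\<^sup>2 \<partial>P)
    \<le> (4 * real K * L * \<gamma> * C1 + 1) / (\<delta> * \<epsilon>)
          * (\<sigma>\<^sup>2 * (real M + 1) / (2 * real M) + 2 * real K * \<kappa>\<^sup>2) * (real K - 1) * L\<^sup>2 * \<gamma>\<^sup>2
      + 1 / \<epsilon> * (2 * C1 * \<sigma>\<^sup>2 + 4 * real K * C1 * \<kappa>\<^sup>2 + \<sigma>\<^sup>2 / real M) * L * \<gamma>
      + 2 * (F x1 - Fstar) / (real N * real K * \<gamma> * \<epsilon>)"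
    using val by simp
  then show ?thesis using int by simp
qed

end
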